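(* Let $D=(V,A)$ be a countable digraph (multiple edges and loops allowed) with $s\neq t\in V$. Suppose that for each $v\in V$ there is a finitary matroid $\mathcal{M}_v$ on $\mathsf{in}_D(v)$ (the edges with head $v$), and let $\mathcal{M}=\bigoplus_{v\in V}\mathcal{M}_v$. Then there is a system $\mathcal{P}$ of pairwise edge-disjoint $s\rightarrow t$ paths with $A(\mathcal{P})$ independent in $\mathcal{M}$, and a set $X$ with $t\in X\subseteq V\setminus\{s\}$, such that (1) $A(\mathcal{P})\cap\mathsf{out}_D(X)=\varnothing$, and (2) $A(\mathcal{P})\cap\mathsf{in}_D(X)$ spans $\mathsf{in}_D(X)$ in $\mathcal{M}$.
   Context: Paths are finite directed paths without repeated vertices. For a set $\mathcal{P}$ of paths, $A(\mathcal{P})=\bigcup_{P\in\mathcal{P}}A(P)$. For $X\subseteq V$, $\mathsf{in}_D(X)$ is the set of edges with tail in $V\setminus X$ and head in $X$, and $\mathsf{out}_D(X)$ the set of edges with tail in $X$ and head in $V\setminus X$. A matroid is finitary if all circuits are finite. A set $S$ spans a set $T$ in $\mathcal{M}$ if $T\subseteq\mathsf{span}_{\mathcal{M}}(S)$, the closure of $S$. *)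

theory Defs
  imports "HOL-Library.Countable_Set" "Graph_Theory.Arc_Walk"
begin

text \<open>
  Possibly infinite matroids, via the independence axioms of Bruhn, Diestel, Kriesell,
  Pendavingh and Wollan. On a finite ground set these are the usual matroids.
\<close>

record 'e indep_system =
  ground :: "'e set"
  indep :: "'e set \<Rightarrow> bool"

definition inclusion_maximal :: "('e set \<Rightarrow> bool) \<Rightarrow> 'e set \<Rightarrow> bool" where
  "inclusion_maximal Q B \<longleftrightarrow> Q B \<and> (\<forall>B'. Q B' \<and> B \<subseteq> B' \<longrightarrow> B' = B)"

locale matroid =
  fixes M :: "'e indep_system"
  assumes indep_subset_ground: "indep M I \<Longrightarrow> I \<subseteq> ground M"
    and indep_empty: "indep M {}"
    and indep_subset: "indep M J \<Longrightarrow> I \<subseteq> J \<Longrightarrow> indep M I"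
    and indep_augment:
      "indep M I \<Longrightarrow> \<not> inclusion_maximal (indep M) I \<Longrightarrow> inclusion_maximal (indep M) J
        \<Longrightarrow> \<exists>x\<in>J - I. indep M (insert x I)"
    and indep_maximal:
      "indep M I \<Longrightarrow> I \<subseteq> X \<Longrightarrow> X \<subseteq> ground M
        \<Longrightarrow> \<exists>B. inclusion_maximal (\<lambda>J. indep M J \<and> I \<subseteq> J \<and> J \<subseteq> X) B"

definition circuit :: "'e indep_system \<Rightarrow> 'e set \<Rightarrow> bool" where
  "circuit M C \<longleftrightarrow> C \<subseteq> ground M \<and> \<not> indep M C \<and> (\<forall>C'. C' \<subset> C \<longrightarrow> indep M C')"

definition finitary :: "'e indep_system \<Rightarrow> bool" where
  "finitary M \<longleftrightarrow> (\<forall>C. circuit M C \<longrightarrow> finite C)"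

definition matroid_span :: "'e indep_system \<Rightarrow> 'e set \<Rightarrow> 'e set" where
  "matroid_span M S = S \<union> {e. \<exists>C. circuit M C \<and> e \<in> C \<and> C \<subseteq> insert e S}"

text \<open>Only meaningful when the ground sets of the summands are pairwise disjoint.\<close>

definition direct_sum :: "'i set \<Rightarrow> ('i \<Rightarrow> 'e indep_system) \<Rightarrow> 'e indep_system" where
  "direct_sum V M =
    \<lparr>ground = (\<Union>v\<in>V. ground (M v)),
     indep = (\<lambda>I. I \<subseteq> (\<Union>v\<in>V. ground (M v)) \<and> (\<forall>v\<in>V. indep (M v) (I \<inter> ground (M v))))\<rparr>"

text \<open>
  The library's \<open>in_arcs\<close> is the set of all edges with a given head, loops included;
  the cuts below never contain loops.
\<close>

definition in_cut :: "('a, 'b) pre_digraph \<Rightarrow> 'a set \<Rightarrow> 'b set" where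
  "in_cut D X = {e \<in> arcs D. tail D e \<in> verts D - X \<and> head D e \<in> X}"

definition out_cut :: "('a, 'b) pre_digraph \<Rightarrow> 'a set \<Rightarrow> 'b set" where
  "out_cut D X = {e \<in> arcs D. tail D e \<in> X \<and> head D e \<in> verts D - X}"

text \<open>
  A path is given by its list of edges, with \<open>apath\<close> requiring the visited vertices to be
  distinct. For distinct end vertices the edge list determines the path.
\<close>

definition path_system :: "('a, 'b) pre_digraph \<Rightarrow> 'a \<Rightarrow> 'a \<Rightarrow> 'b list set \<Rightarrow> bool" where
  "path_system D s t P \<longleftrightarrow>
    (\<forall>p\<in>P. pre_digraph.apath D s p t) \<and> pairwise (\<lambda>p q. disjnt (set p) (set q)) P"

definition path_arcs :: "'b list set \<Rightarrow> 'b set" where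
  "path_arcs P = (\<Union>p\<in>P. set p)"

end

theory Submission
  imports Defs
begin

text \<open>
  A wave is a set of paths from \<open>s\<close> to \<open>X\<close> whose last edges span all edges entering \<open>X\<close>. Take a
  maximal wave and let \<open>B\<close> be the set of its last edges; by maximality the web inside \<open>X\<close> that is
  entered through \<open>B\<close> is loose, that is, it has no nontrivial wave. It remains to link all of \<open>B\<close>
  to \<open>t\<close> inside \<open>X\<close>, and by countability it suffices to link a single \<open>f \<in> B\<close> such that what is
  left is loose again. To this end grow a tree from \<open>f\<close>, edge by edge, along edges not spanned by
  a maximal wave of the web in which the tree is deleted and contracted. Contracting one edge of a
  loose web produces no wave that misses an edge of \<open>B\<close> (this is the only place where augmenting
  walks are needed), so the remaining edges of \<open>B\<close> are never lost. If the tree never reached \<open>t\<close>,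
  then cutting its vertices off from the limit of the waves would leave a nontrivial wave of the
  original web.
\<close>

subsection \<open>Finitary matroids as closure operators\<close>

text \<open>The matroid arguments about waves use only a closure operator on edges that is decided
  head by head (\<open>local_closure\<close>). This makes the direct sum implicit, turns contraction
  of \<open>T\<close> into \<open>cl (S \<union> T)\<close> with no change of ground set, and allows
  freeness and spanning of a composed or limiting wave to be checked separately at heads inside and
  outside a region. Finitariness reduces freeness to finite subsets, so it survives the limits of
  chains of waves and the union of the countably many links. The obstacle throughout is that the
  closure changes whenever an edge is used. Contraction enlarges spans but endangers freeness, so
  the two halves of a wave are treated apart: the spanning half passes to larger contractions for
  free, while freeness is recovered from the fact that each new tree edge is not spanned.
  Augmentation works with trails, since rerouting cannot keep vertices distinct; paths are extracted
  only from the final walks.\<close>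

lemma (in matroid) relative_augment:
  assumes "indep M I" "I \<subseteq> Y" "indep M (insert w I)" "w \<in> Y - I" "Y \<subseteq> ground M"
    and J: "inclusion_maximal (\<lambda>K. indep M K \<and> K \<subseteq> Y) J"
  shows "\<exists>y\<in>J - I. indep M (insert y I)"
proof (rule ccontr)
  assume "\<not> ?thesis"
  then have no: "\<not> indep M (insert y I)" if "y \<in> J - I" for y
    using that by blast
  have Ji: "indep M J" and JY: "J \<subseteq> Y" and Jmax: "\<And>K. indep M K \<Longrightarrow> K \<subseteq> Y \<Longrightarrow> J \<subseteq> K \<Longrightarrow> K = J"
    using J unfolding inclusion_maximal_def by auto
  \<comment> \<open>To reach the augmentation axiom, which speaks of bases of the whole matroid,
    \<open>J\<close> is extended to a base \<open>J'\<close>; the new elements lie outside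
    \<open>Y\<close>.\<close>
  obtain J' where "inclusion_maximal (\<lambda>K. indep M K \<and> J \<subseteq> K \<and> K \<subseteq> ground M) J'"
    using indep_maximal[OF Ji indep_subset_ground[OF Ji] order_refl] by blast
  then have J': "indep M J'" "J \<subseteq> J'"
    and J'max: "\<And>K. indep M K \<Longrightarrow> J' \<subseteq> K \<Longrightarrow> K = J'"
    using indep_subset_ground unfolding inclusion_maximal_def by (blast, blast, meson order_trans)
  have J'base: "inclusion_maximal (indep M) J'"
    using J' J'max unfolding inclusion_maximal_def by blast
  have J'Y: "J' \<inter> Y = J"
    using Jmax[of "J' \<inter> Y"] indep_subset[OF J'(1), of "J' \<inter> Y"] J'(2) JY by blast
  have relmax: "\<exists>K. inclusion_maximal (indep M) K \<and> L \<subseteq> K \<and> K \<subseteq> L \<union> N"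
    if L: "indep M L" and N: "inclusion_maximal (indep M) N" for L N
  proof -
    have "indep M N" using N unfolding inclusion_maximal_def by (rule conjunct1)
    then have "L \<union> N \<subseteq> ground M"
      using indep_subset_ground[OF L] indep_subset_ground[of N] by simp
    from indep_maximal[OF L Un_upper1 this]
    obtain K where "inclusion_maximal (\<lambda>J. indep M J \<and> L \<subseteq> J \<and> J \<subseteq> L \<union> N) K" by blast
    then have K: "indep M K" "L \<subseteq> K" "K \<subseteq> L \<union> N"
      and Kmax: "\<And>K'. indep M K' \<Longrightarrow> K \<subseteq> K' \<Longrightarrow> K' \<subseteq> L \<union> N \<Longrightarrow> K' = K"
      unfolding inclusion_maximal_def by (blast, blast, blast, meson order_trans)
    have "inclusion_maximal (indep M) K"
    proof (rule ccontr)
      assume "\<not> ?thesis"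
      from indep_augment[OF K(1) this N] obtain x where "x \<in> N - K" "indep M (insert x K)" by blast
      with Kmax[of "insert x K"] K(3) show False by blast
    qed
    with K show ?thesis by blast
  qed
  obtain K where K: "inclusion_maximal (indep M) K" "I \<subseteq> K" "K \<subseteq> I \<union> J'"
    using relmax[OF assms(1) J'base] by blast
  have Ki: "indep M K" using K(1) unfolding inclusion_maximal_def by blast
  have KJ: "y \<in> I" if "y \<in> K" "y \<in> J" for y
    using no[of y] indep_subset[OF Ki, of "insert y I"] K(2) that by blast
  have wK: "w \<notin> K" using KJ[of w] J'Y K(3) assms(4) by blast
  obtain L where L: "inclusion_maximal (indep M) L" "insert w I \<subseteq> L" "L \<subseteq> insert w I \<union> K"
    using relmax[OF assms(3) K(1)] by blast
  have Li: "indep M L" using L(1) unfolding inclusion_maximal_def by blast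
  \<comment> \<open>The base \<open>L\<close> omits some \<open>z\<close> of \<open>K\<close>, and
    \<open>z\<close> has to lie in \<open>J' - Y\<close>. Replacing \<open>z\<close> in
    \<open>J'\<close> by an element of \<open>L\<close> brings in an element of
    \<open>insert w I\<close>, so \<open>J\<close> was not maximal in \<open>Y\<close>.\<close>
  have "\<not> K \<subseteq> L"
    using K(1) L(2) wK Li unfolding inclusion_maximal_def by blast
  then obtain z where z: "z \<in> K" "z \<notin> L" by blast
  have zJ: "z \<in> J'" "z \<notin> Y" using z L(2) K(3) KJ[of z] J'Y by blast+
  have "indep M (J' - {z})" using indep_subset[OF J'(1), of "J' - {z}"] by blast
  moreover have "\<not> inclusion_maximal (indep M) (J' - {z})"
    using J'(1) zJ unfolding inclusion_maximal_def by blast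
  ultimately obtain y where y: "y \<in> L - (J' - {z})" "indep M (insert y (J' - {z}))"
    using indep_augment L(1) by blast
  have "y \<in> insert w I" "y \<notin> J'" using y(1) z(2) L(3) K(3) by blast+
  then have yY: "y \<in> Y" "y \<notin> J" using assms(2,4) J'(2) by blast+
  have "indep M (insert y J)"
    using indep_subset[OF y(2), of "insert y J"] J'(2) zJ(2) JY by blast
  then show False using Jmax[of "insert y J"] yY JY by blast
qed

lemma (in matroid) ex_relative_base:
  assumes "indep M I" "I \<subseteq> X" "X \<subseteq> ground M"
  obtains J where "I \<subseteq> J" "inclusion_maximal (\<lambda>K. indep M K \<and> K \<subseteq> X) J"
proof -
  obtain B where "inclusion_maximal (\<lambda>J. indep M J \<and> I \<subseteq> J \<and> J \<subseteq> X) B"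
    using indep_maximal[OF assms] by blast
  then have "I \<subseteq> B" "inclusion_maximal (\<lambda>K. indep M K \<and> K \<subseteq> X) B"
    unfolding inclusion_maximal_def by (auto 0 3)
  then show thesis by (rule that)
qed

text \<open>An infinite dependent set cannot be shrunk to a minimal one element by element. Instead
  one element \<open>x\<close> is added to a maximal independent subset \<open>B\<close>, and the
  fundamental circuit of \<open>x\<close> is written down explicitly: the elements whose removal
  makes \<open>insert x B\<close> independent.\<close>

lemma (in matroid) dependent_has_circuit:
  assumes "\<not> indep M S" "S \<subseteq> ground M"
  obtains C where "circuit M C" "C \<subseteq> S"
proof -
  obtain B where B: "inclusion_maximal (\<lambda>K. indep M K \<and> K \<subseteq> S) B"
    using ex_relative_base[OF indep_empty _ assms(2)] by blast
  then have Bi: "indep M B" and BS: "B \<subseteq> S" and Bmax: "\<And>K. indep M K \<Longrightarrow> K \<subseteq> S \<Longrightarrow> B \<subseteq> K \<Longrightarrow> K = B"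
    unfolding inclusion_maximal_def by auto
  have "B \<noteq> S" using assms(1) Bi by auto
  then obtain x where x: "x \<in> S" "x \<notin> B" using BS by blast
  let ?Y = "insert x B"
  have YS: "?Y \<subseteq> S" using x BS by blast
  have dep: "\<not> indep M ?Y" using Bmax[of ?Y] x BS by blast
  define C where "C = {b \<in> ?Y. indep M (?Y - {b})}"
  have xC: "x \<in> C" using Bi x by (simp add: C_def)
  have "\<not> indep M C"
  proof
    assume "indep M C"
    then obtain J where J: "C \<subseteq> J" "inclusion_maximal (\<lambda>K. indep M K \<and> K \<subseteq> ?Y) J"
      using ex_relative_base[of C ?Y] YS assms(2) unfolding C_def by blast
    then have Ji: "indep M J" "J \<subseteq> ?Y" unfolding inclusion_maximal_def by auto
    then have "J \<noteq> ?Y" using dep by auto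
    then obtain z where z: "z \<in> ?Y" "z \<notin> J" using Ji(2) by blast
    then have zB: "z \<in> B" "z \<notin> C" using xC J(1) by blast+
    \<comment> \<open>Exchanging \<open>z\<close> in \<open>B\<close> for an element of
      \<open>J\<close> can only bring in \<open>x\<close>, so \<open>z\<close> belongs to
      \<open>C\<close> after all.\<close>
    have "insert z (B - {z}) = B" using zB by blast
    then obtain y where y: "y \<in> J - (B - {z})" "indep M (insert y (B - {z}))"
      using relative_augment[OF indep_subset[OF Bi, of "B - {z}"], of ?Y z J] J(2) zB YS assms(2) Bi
      by auto
    then have "y = x" using Ji(2) z by blast
    then have "indep M (?Y - {z})" using y(2) x zB by (metis insert_Diff_if singletonD)
    then show False using zB z(1) by (simp add: C_def)
  qed
  moreover have "indep M C'" if "C' \<subset> C" for C'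
  proof -
    obtain b where "b \<in> C" "C' \<subseteq> ?Y - {b}" using \<open>C' \<subset> C\<close> unfolding C_def by blast
    then show ?thesis using indep_subset unfolding C_def by blast
  qed
  moreover have "C \<subseteq> S" using YS unfolding C_def by blast
  ultimately have "circuit M C" using assms(2) unfolding circuit_def by blast
  then show thesis using that \<open>C \<subseteq> S\<close> by blast
qed

text \<open>Spanning in terms of independent sets, which avoids circuit elimination.\<close>

definition mspan :: "'e indep_system \<Rightarrow> 'e set \<Rightarrow> 'e set" where
  "mspan M S = {e \<in> ground M. \<exists>J\<subseteq>S. indep M J \<and> (e \<in> J \<or> \<not> indep M (insert e J))}"

context matroid begin

text \<open>In \<open>mspan\<close> the witness may depend on \<open>e\<close>; here one maximal
  independent subset \<open>J\<close> of \<open>S\<close> serves for all spanned \<open>e\<close>. A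
  base of \<open>S\<close> that extends the witness of \<open>e\<close> stays maximal in
  \<open>insert e S\<close>. If \<open>insert e J\<close> were independent, \<open>J\<close> could
  therefore be augmented from that base inside \<open>S\<close>.\<close>

lemma mspan_base:
  assumes S: "S \<subseteq> ground M" and J: "inclusion_maximal (\<lambda>K. indep M K \<and> K \<subseteq> S) J"
    and e: "e \<in> mspan M S"
  shows "e \<in> J \<or> \<not> indep M (insert e J)"
proof (rule ccontr)
  assume c: "\<not> ?thesis"
  have Ji: "indep M J" "J \<subseteq> S" and Jmax: "\<And>K. indep M K \<Longrightarrow> K \<subseteq> S \<Longrightarrow> J \<subseteq> K \<Longrightarrow> K = J"
    using J unfolding inclusion_maximal_def by auto
  obtain I where I: "I \<subseteq> S" "indep M I" "e \<in> I \<or> \<not> indep M (insert e I)" and eg: "e \<in> ground M"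
    using e unfolding mspan_def by blast
  have "e \<notin> S" using Jmax[of "insert e J"] c Ji by blast
  then have dep: "\<not> indep M (insert e I)" using I by blast
  obtain I' where I': "I \<subseteq> I'" "inclusion_maximal (\<lambda>K. indep M K \<and> K \<subseteq> S) I'"
    using ex_relative_base[OF I(2,1) S] by blast
  have "inclusion_maximal (\<lambda>K. indep M K \<and> K \<subseteq> insert e S) I'"
  proof -
    have "K = I'" if K: "indep M K" "K \<subseteq> insert e S" "I' \<subseteq> K" for K
    proof -
      have "e \<notin> K" using dep indep_subset[OF K(1), of "insert e I"] K(3) I'(1) by blast
      then show ?thesis using I'(2) K unfolding inclusion_maximal_def by blast
    qed
    then show ?thesis using I'(2) unfolding inclusion_maximal_def by blast
  qed
  from relative_augment[OF Ji(1) _ _ _ _ this, of e] obtain y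
    where y: "y \<in> I' - J" "indep M (insert y J)"
    using c Ji(2) S eg by blast
  have "y \<in> S" using y(1) I'(2) unfolding inclusion_maximal_def by blast
  then show False using Jmax[of "insert y J"] y Ji(2) by blast
qed

lemma mspan_ground: "mspan M S \<subseteq> ground M"
  unfolding mspan_def by blast

lemma mspan_mono: "S \<subseteq> S' \<Longrightarrow> mspan M S \<subseteq> mspan M S'"
  unfolding mspan_def by blast

lemma mspan_extensive:
  assumes "S \<subseteq> ground M" shows "S \<subseteq> mspan M S"
proof
  fix e assume "e \<in> S"
  then have "\<exists>J\<subseteq>S. indep M J \<and> (e \<in> J \<or> \<not> indep M (insert e J))"
    using indep_empty by (cases "indep M {e}") blast+
  then show "e \<in> mspan M S" using \<open>e \<in> S\<close> assms unfolding mspan_def by blast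
qed

text \<open>A base of \<open>S\<close> stays maximal independent in \<open>mspan M S\<close>, so it
  decides both spans.\<close>

lemma mspan_idem:
  assumes "S \<subseteq> ground M" shows "mspan M (mspan M S) \<subseteq> mspan M S"
proof
  fix e assume e: "e \<in> mspan M (mspan M S)"
  obtain J where J: "inclusion_maximal (\<lambda>K. indep M K \<and> K \<subseteq> S) J"
    using ex_relative_base[OF indep_empty _ assms] by blast
  have JS: "indep M J" "J \<subseteq> S" using J unfolding inclusion_maximal_def by auto
  have "K \<subseteq> J" if K: "indep M K" "K \<subseteq> mspan M S" "J \<subseteq> K" for K
  proof
    fix x assume x: "x \<in> K"
    have "indep M (insert x J)" using indep_subset[OF K(1), of "insert x J"] K(3) x by simp
    then show "x \<in> J" using mspan_base[OF assms J, of x] K(2) x by blast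
  qed
  then have "inclusion_maximal (\<lambda>K. indep M K \<and> K \<subseteq> mspan M S) J"
    using JS mspan_extensive[OF assms] unfolding inclusion_maximal_def by blast
  from mspan_base[OF mspan_ground this e] show "e \<in> mspan M S"
    using JS e mspan_ground unfolding mspan_def[of M S] by blast
qed

lemma mspan_exchange:
  assumes "insert x S \<subseteq> ground M" "y \<in> mspan M (insert x S)" "y \<notin> mspan M S"
  shows "x \<in> mspan M (insert y S)"
proof -
  have S: "S \<subseteq> ground M" and y: "y \<in> ground M" using assms mspan_ground by blast+
  obtain J where J: "inclusion_maximal (\<lambda>K. indep M K \<and> K \<subseteq> S) J"
    using ex_relative_base[OF indep_empty _ S] by blast
  have JS: "indep M J" "J \<subseteq> S" and Jmax: "\<And>K. indep M K \<Longrightarrow> K \<subseteq> S \<Longrightarrow> J \<subseteq> K \<Longrightarrow> K = J"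
    using J unfolding inclusion_maximal_def by auto
  have yJ: "y \<notin> J" "indep M (insert y J)"
    using assms(3) JS y unfolding mspan_def by blast+
  have x: "x \<notin> mspan M S"
  proof
    assume "x \<in> mspan M S"
    then have "mspan M (insert x S) \<subseteq> mspan M (mspan M S)"
      using mspan_mono[of "insert x S" "mspan M S"] mspan_extensive[OF S] by blast
    then show False using assms(2,3) mspan_idem[OF S] by blast
  qed
  then have xJ: "x \<notin> J" "indep M (insert x J)"
    using JS assms(1) unfolding mspan_def by blast+
  have "inclusion_maximal (\<lambda>K. indep M K \<and> K \<subseteq> insert x S) (insert x J)"
  proof -
    have "K \<subseteq> insert x J" if K: "indep M K" "K \<subseteq> insert x S" "insert x J \<subseteq> K" for K
    proof
      fix z assume z: "z \<in> K"
      have "indep M (insert z J)" using indep_subset[OF K(1), of "insert z J"] K(3) z by simp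
      then have "z = x \<or> insert z J = J"
        using Jmax[of "insert z J"] z K(2) JS(2) by (cases "z = x") auto
      then show "z \<in> insert x J" by blast
    qed
    then show ?thesis using xJ(2) JS(2) unfolding inclusion_maximal_def by blast
  qed
  from mspan_base[OF assms(1) this assms(2)] consider "y = x" | "\<not> indep M (insert x (insert y J))"
    using yJ(1) by (auto simp: insert_commute)
  then show ?thesis
  proof cases
    case 1
    then show ?thesis using mspan_extensive[OF assms(1)] by blast
  next
    case 2
    then show ?thesis using yJ(2) JS(2) assms(1) unfolding mspan_def by blast
  qed
qed

lemma circuit_mspan:
  assumes "circuit M C" "e \<in> C" shows "e \<in> mspan M (C - {e})"
proof -
  have "indep M (C - {e})" "\<not> indep M (insert e (C - {e}))" "e \<in> ground M"
    using assms unfolding circuit_def by (auto simp: insert_absorb)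
  then show ?thesis unfolding mspan_def by blast
qed

lemma mspan_finitary:
  assumes "finitary M" "S \<subseteq> ground M" "e \<in> mspan M S"
  shows "\<exists>S0\<subseteq>S. finite S0 \<and> e \<in> mspan M S0"
proof -
  obtain J where J: "J \<subseteq> S" "indep M J" "e \<in> J \<or> \<not> indep M (insert e J)" and eg: "e \<in> ground M"
    using assms(3) unfolding mspan_def by blast
  show ?thesis
  proof (cases "e \<in> J")
    case True
    then show ?thesis
      using J eg mspan_extensive[of "{e}"] by (intro exI[of _ "{e}"]) auto
  next
    case False
    then obtain C where C: "circuit M C" "C \<subseteq> insert e J"
      using dependent_has_circuit[of "insert e J"] J assms(2) eg by blast
    then have "e \<in> C" using indep_subset[OF J(2), of C] unfolding circuit_def by blast
    then have "e \<in> mspan M (C - {e})" by (rule circuit_mspan[OF C(1)])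
    moreover have "finite (C - {e})" using assms(1) C(1) unfolding finitary_def by blast
    moreover have "C - {e} \<subseteq> S" using C(2) J(1) by blast
    ultimately show ?thesis by blast
  qed
qed

lemma indep_if_no_spanned:
  assumes "I \<subseteq> ground M" "\<And>e. e \<in> I \<Longrightarrow> e \<notin> mspan M (I - {e})"
  shows "indep M I"
proof (rule ccontr)
  assume "\<not> indep M I"
  then obtain C where C: "circuit M C" "C \<subseteq> I" using dependent_has_circuit assms(1) by blast
  then have "C \<noteq> {}" using indep_empty unfolding circuit_def by auto
  then obtain e where e: "e \<in> C" by blast
  then have "e \<in> mspan M (C - {e})" by (rule circuit_mspan[OF C(1)])
  then show False using assms(2)[of e] e C(2) mspan_mono[of "C - {e}" "I - {e}"] by blast
qed

lemma mspan_subset_matroid_span: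
  assumes "S \<subseteq> ground M" shows "mspan M S \<subseteq> matroid_span M S"
proof
  fix e assume "e \<in> mspan M S"
  then obtain J where J: "J \<subseteq> S" "indep M J" "e \<in> J \<or> \<not> indep M (insert e J)" "e \<in> ground M"
    unfolding mspan_def by blast
  show "e \<in> matroid_span M S"
  proof (cases "e \<in> J")
    case True
    then show ?thesis using J unfolding matroid_span_def by blast
  next
    case False
    then obtain C where C: "circuit M C" "C \<subseteq> insert e J"
      using dependent_has_circuit[of "insert e J"] J assms by blast
    then have "e \<in> C" using indep_subset[OF J(2), of C] unfolding circuit_def by blast
    then show ?thesis using C J(1) unfolding matroid_span_def by blast
  qed
qed

end

section \<open>Closure operators that are decided head by head\<close>

definition free_in :: "('b set \<Rightarrow> 'b set) \<Rightarrow> 'b set \<Rightarrow> bool" where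
  "free_in cl I \<longleftrightarrow> (\<forall>e\<in>I. e \<notin> cl (I - {e}))"

text \<open>The elements of \<open>T\<close> are kept and become loops. A set that is free for the
  contraction therefore avoids \<open>T\<close>, so that contraction also acts as deletion.\<close>

definition contract :: "('b set \<Rightarrow> 'b set) \<Rightarrow> 'b set \<Rightarrow> 'b set \<Rightarrow> 'b set" where
  "contract cl T S = cl (S \<union> T)"

text \<open>A finitary matroid in closure form; \<open>local\<close> says that it is the direct sum
  of its restrictions to the edges with a common head. There is no ground set: the operator acts on
  all sets of edges.\<close>

locale local_closure =
  fixes dst :: "'b \<Rightarrow> 'v" and cl :: "'b set \<Rightarrow> 'b set"
  assumes ext: "S \<subseteq> cl S"
    and mono: "S \<subseteq> S' \<Longrightarrow> cl S \<subseteq> cl S'"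
    and idem: "cl (cl S) \<subseteq> cl S"
    and exchange: "y \<in> cl (insert x S) \<Longrightarrow> y \<notin> cl S \<Longrightarrow> x \<in> cl (insert y S)"
    and finitary: "e \<in> cl S \<Longrightarrow> \<exists>S0\<subseteq>S. finite S0 \<and> e \<in> cl S0"
    and local: "e \<in> cl S \<Longrightarrow> e \<in> cl {g\<in>S. dst g = dst e}"
begin

lemma closed_under: "e \<in> cl S \<Longrightarrow> S \<subseteq> cl S' \<Longrightarrow> e \<in> cl S'"
  using mono[of S "cl S'"] idem[of S'] by blast

lemma local_mono: "e \<in> cl S \<Longrightarrow> (\<And>g. g \<in> S \<Longrightarrow> dst g = dst e \<Longrightarrow> g \<in> S') \<Longrightarrow> e \<in> cl S'"
  using local[of e S] mono[of "{g\<in>S. dst g = dst e}" S'] by blast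

lemma local_closed_under:
  "e \<in> cl S \<Longrightarrow> (\<And>g. g \<in> S \<Longrightarrow> dst g = dst e \<Longrightarrow> g \<in> cl S') \<Longrightarrow> e \<in> cl S'"
  using local[of e S] closed_under[of e "{g\<in>S. dst g = dst e}" S'] by blast

lemma contract: "local_closure dst (contract cl T)"
proof
  fix S S' :: "'b set" and x y e
  show "S \<subseteq> contract cl T S" using ext[of "S \<union> T"] unfolding contract_def by blast
  show "S \<subseteq> S' \<Longrightarrow> contract cl T S \<subseteq> contract cl T S'"
    unfolding contract_def using mono[of "S \<union> T" "S' \<union> T"] by blast
  show "contract cl T (contract cl T S) \<subseteq> contract cl T S"
  proof -
    have "cl (S \<union> T) \<union> T \<subseteq> cl (S \<union> T)" using ext[of "S \<union> T"] by blast
    then show ?thesis unfolding contract_def using closed_under[of _ "cl (S \<union> T) \<union> T" "S \<union> T"] by blast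
  qed
  show "y \<in> contract cl T (insert x S) \<Longrightarrow> y \<notin> contract cl T S \<Longrightarrow> x \<in> contract cl T (insert y S)"
    unfolding contract_def using exchange[of y x "S \<union> T"] by simp
  show "\<exists>S0\<subseteq>S. finite S0 \<and> e \<in> contract cl T S0" if "e \<in> contract cl T S"
  proof -
    obtain S0 where S0: "S0 \<subseteq> S \<union> T" "finite S0" "e \<in> cl S0"
      using finitary \<open>e \<in> contract cl T S\<close> unfolding contract_def by blast
    have "e \<in> cl ((S0 \<inter> S) \<union> T)" using mono[of S0 "(S0 \<inter> S) \<union> T"] S0 by blast
    then show ?thesis using S0(2) unfolding contract_def by blast
  qed
  show "e \<in> contract cl T S \<Longrightarrow> e \<in> contract cl T {g\<in>S. dst g = dst e}"
    unfolding contract_def by (erule local_mono) blast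
qed

lemma free_subset: "free_in cl I \<Longrightarrow> J \<subseteq> I \<Longrightarrow> free_in cl J"
  unfolding free_in_def using mono[of "J - {e}" "I - {e}" for e] by blast

lemma free_insert: "free_in cl I \<Longrightarrow> e \<notin> cl I \<Longrightarrow> free_in cl (insert e I)"
proof -
  assume I: "free_in cl I" and e: "e \<notin> cl I"
  have eI: "e \<notin> I" using e ext[of I] by blast
  have "g \<notin> cl (insert e I - {g})" if "g \<in> I" for g
  proof
    assume g: "g \<in> cl (insert e I - {g})"
    have "g \<notin> cl (I - {g})" using I that unfolding free_in_def by blast
    moreover have "insert e I - {g} = insert e (I - {g})" using that eI by blast
    ultimately have "e \<in> cl (insert g (I - {g}))" using exchange g by metis
    then show False using e that by (simp add: insert_absorb)
  qed
  then show "free_in cl (insert e I)" using e eI unfolding free_in_def by auto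
qed

lemma free_local: "(\<And>v. free_in cl {g\<in>I. dst g = v}) \<Longrightarrow> free_in cl I"
proof -
  assume *: "\<And>v. free_in cl {g\<in>I. dst g = v}"
  have "e \<notin> cl (I - {e})" if "e \<in> I" for e
  proof
    assume "e \<in> cl (I - {e})"
    then have "e \<in> cl ({g\<in>I. dst g = dst e} - {e})" by (rule local_mono) blast
    then show False using *[of "dst e"] that unfolding free_in_def by blast
  qed
  then show ?thesis unfolding free_in_def by blast
qed

lemma free_finitary:
  assumes "\<And>I0. I0 \<subseteq> I \<Longrightarrow> finite I0 \<Longrightarrow> free_in cl I0" shows "free_in cl I"
  unfolding free_in_def
proof
  fix e assume e: "e \<in> I"
  show "e \<notin> cl (I - {e})"
  proof
    assume "e \<in> cl (I - {e})"
    then obtain S where S: "S \<subseteq> I - {e}" "finite S" "e \<in> cl S" using finitary by blast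
    then have "insert e S - {e} = S" by blast
    then show False using assms[of "insert e S"] S e unfolding free_in_def by auto
  qed
qed

lemma free_contract:
  "free_in (contract cl T) I \<Longrightarrow> free_in cl I"
  unfolding free_in_def contract_def using mono[of "I - {e}" "I - {e} \<union> T" for e] by blast

lemma free_contract_disjnt:
  "free_in (contract cl T) I \<Longrightarrow> I \<inter> T = {}"
  unfolding free_in_def contract_def using ext[of "I - {e} \<union> T" for e] by blast

text \<open>Only finitely many elements of \<open>I\<close> matter. They are added to
  \<open>T\<close> one at a time, each unspanned by \<open>T\<close> and the rest of
  \<open>I\<close>.\<close>

lemma free_Un_contract:
  assumes "free_in cl T" "free_in (contract cl T) I"
  shows "free_in cl (I \<union> T)"
proof (rule free_finitary)
  fix I0 assume I0: "I0 \<subseteq> I \<union> T" "finite I0"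
  define J where "J = I0 \<inter> I"
  have "finite J" "J \<subseteq> I" using I0 unfolding J_def by auto
  then have "free_in cl (J \<union> T)"
  proof (induction J)
    case empty
    then show ?case using assms(1) by simp
  next
    case (insert x J)
    have "x \<notin> cl ((I - {x}) \<union> T)" using insert.prems assms(2) unfolding free_in_def contract_def by blast
    then have "x \<notin> cl (J \<union> T)" using mono[of "J \<union> T" "(I - {x}) \<union> T"] insert by blast
    then show ?case using free_insert[of "J \<union> T" x] insert by simp
  qed
  then show "free_in cl I0" using free_subset[of "J \<union> T" I0] I0 unfolding J_def by blast
qed

lemma contract_if_free_Un:
  assumes "free_in cl (I \<union> T)" "I \<inter> T = {}"
  shows "free_in (contract cl T) I"
proof -
  have "e \<notin> cl ((I - {e}) \<union> T)" if "e \<in> I" for e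
  proof -
    have "I \<union> T - {e} = (I - {e}) \<union> T" using that assms(2) by blast
    then show ?thesis using assms(1) that unfolding free_in_def by (metis UnI1)
  qed
  then show ?thesis unfolding free_in_def contract_def by blast
qed

text \<open>Zorn's lemma applies because a finite subset of the union of a chain lies in one member,
  and freeness depends on finite subsets only.\<close>

lemma ex_free_spanning:
  assumes "free_in cl I" "I \<subseteq> S"
  obtains J where "I \<subseteq> J" "J \<subseteq> S" "free_in cl J" "S \<subseteq> cl J"
proof -
  let ?\<A> = "{J. I \<subseteq> J \<and> J \<subseteq> S \<and> free_in cl J}"
  have "\<exists>M\<in>?\<A>. \<forall>X\<in>?\<A>. M \<subseteq> X \<longrightarrow> X = M"
  proof (rule subset_Zorn_nonempty)
    show "?\<A> \<noteq> {}" using assms by blast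
    fix \<C> assume C: "\<C> \<noteq> {}" "subset.chain ?\<A> \<C>"
    have "free_in cl (\<Union>\<C>)"
    proof (rule free_finitary)
      fix I0 assume "I0 \<subseteq> \<Union>\<C>" "finite I0"
      then obtain K where "K \<in> \<C>" "I0 \<subseteq> K"
        using finite_subset_Union_chain[OF _ _ C] by blast
      moreover have "free_in cl K" using C(2) \<open>K \<in> \<C>\<close> unfolding subset.chain_def by blast
      ultimately show "free_in cl I0" by (blast intro: free_subset)
    qed
    then show "\<Union>\<C> \<in> ?\<A>" using C unfolding subset.chain_def by blast
  qed
  then obtain J where J: "I \<subseteq> J" "J \<subseteq> S" "free_in cl J"
    and max: "\<And>X. I \<subseteq> X \<Longrightarrow> X \<subseteq> S \<Longrightarrow> free_in cl X \<Longrightarrow> J \<subseteq> X \<Longrightarrow> X = J" by auto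
  have "S \<subseteq> cl J"
  proof
    fix e assume "e \<in> S"
    show "e \<in> cl J"
    proof (rule ccontr)
      assume e: "e \<notin> cl J"
      have "free_in cl (insert e J)" by (rule free_insert[OF J(3) e])
      then have "insert e J = J" using max[of "insert e J"] J \<open>e \<in> S\<close> by blast
      then show False using e ext[of J] by blast
    qed
  qed
  then show thesis using that J by blast
qed

definition coll :: "'b set \<Rightarrow> 'b \<Rightarrow> 'b set" where
  "coll F e = {g\<in>F. e \<notin> cl (F - {g})}"

text \<open>For free \<open>F\<close> spanning \<open>e\<close>, this is the fundamental circuit of \<open>e\<close> without \<open>e\<close>.\<close>

lemma coll_extend:
  assumes "F \<subseteq> F'" "free_in cl F'" "e \<in> cl F"
  shows "coll F' e = coll F e"
proof (intro set_eqI iffI)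
  fix g assume g: "g \<in> coll F' e"
  have "g \<in> F"
  proof (rule ccontr)
    assume "g \<notin> F"
    then have "F \<subseteq> F' - {g}" using assms(1) by blast
    then show False using g mono[of F "F' - {g}"] assms(3) unfolding coll_def by blast
  qed
  moreover have "e \<notin> cl (F - {g})"
    using g mono[of "F - {g}" "F' - {g}"] assms(1) unfolding coll_def by blast
  ultimately show "g \<in> coll F e" unfolding coll_def by blast
next
  fix g assume g: "g \<in> coll F e"
  then have gF: "g \<in> F" and e: "e \<notin> cl (F - {g})" unfolding coll_def by blast+
  have "e \<notin> cl (F' - {g})"
  proof
    assume e': "e \<in> cl (F' - {g})"
    have "e \<in> cl (insert g (F - {g}))" using assms(3) gF by (simp add: insert_absorb)
    then have "g \<in> cl (insert e (F - {g}))" using exchange e by blast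
    moreover have "insert e (F - {g}) \<subseteq> cl (F' - {g})" using e' ext[of "F' - {g}"] assms(1) by blast
    ultimately have "g \<in> cl (F' - {g})" by (rule closed_under)
    then show False using assms(1,2) gF unfolding free_in_def by blast
  qed
  then show "g \<in> coll F' e" using gF assms(1) unfolding coll_def by blast
qed

text \<open>A minimal finite subset \<open>S0\<close> of \<open>F\<close> that spans
  \<open>e\<close> equals \<open>coll S0 e\<close>, and by \<open>coll_extend\<close> this is also
  \<open>coll F e\<close>.\<close>

lemma coll_spans:
  assumes "free_in cl F" "e \<in> cl F"
  shows "e \<in> cl (coll F e)"
proof -
  obtain S where S: "finite S" "S \<subseteq> F" "e \<in> cl S" using finitary assms(2) by blast
  then obtain S0 where "S0 \<in> {S1\<in>Pow S. e \<in> cl S1}"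
    and "\<forall>S1\<in>{S1\<in>Pow S. e \<in> cl S1}. S1 \<subseteq> S0 \<longrightarrow> S0 = S1"
    using finite_has_minimal2[of "{S1\<in>Pow S. e \<in> cl S1}" S] by auto
  then have S0: "S0 \<subseteq> S" "e \<in> cl S0" and min: "\<And>S1. S1 \<subseteq> S0 \<Longrightarrow> e \<in> cl S1 \<Longrightarrow> S1 = S0"
    by auto
  have "coll S0 e = S0" unfolding coll_def using min[of "S0 - {g}" for g] by blast
  moreover have "coll F e = coll S0 e" using coll_extend[of S0 F e] S0 S assms(1) by blast
  ultimately show ?thesis using S0 by simp
qed

lemma coll_local:
  assumes "e \<in> cl F" "g \<in> coll F e" shows "dst g = dst e"
proof (rule ccontr)
  assume "dst g \<noteq> dst e"
  then have "e \<in> cl (F - {g})" by (intro local_mono[OF assms(1)]) auto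
  then show False using assms(2) unfolding coll_def by blast
qed

end

subsection \<open>Augmentation\<close>

fun walk :: "('b \<Rightarrow> 'v) \<Rightarrow> ('b \<Rightarrow> 'v) \<Rightarrow> 'v \<Rightarrow> 'b list \<Rightarrow> 'v \<Rightarrow> bool" where
  "walk src dst u [] w \<longleftrightarrow> u = w"
| "walk src dst u (e # p) w \<longleftrightarrow> src e = u \<and> walk src dst (dst e) p w"

lemma walk_append:
  "walk src dst u (p @ q) w \<longleftrightarrow> (\<exists>v. walk src dst u p v \<and> walk src dst v q w)"
  by (induction p arbitrary: u) auto

text \<open>The closed walk is rotated so that \<open>e\<close> comes last; its first edge then
  starts at the head of \<open>e\<close>.\<close>

lemma closed_walk_succ:
  assumes "walk src dst w p w" "e \<in> set p"
  shows "\<exists>e'\<in>set p. src e' = dst e"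
proof -
  obtain a b where p: "p = a @ e # b" using assms(2) by (auto simp: in_set_conv_decomp)
  have "walk src dst (dst e) (b @ a @ [e]) (dst e)"
    using assms(1) unfolding p by (auto simp: walk_append)
  moreover obtain x xs where x: "b @ a @ [e] = x # xs" by (cases "b @ a @ [e]") auto
  ultimately have "src x = dst e" by (simp only: walk.simps)
  moreover have "x \<in> set p" using arg_cong[OF x, of set] unfolding p by auto
  ultimately show ?thesis by blast
qed

lemma closed_walk_pred:
  assumes "walk src dst w p w" "e \<in> set p"
  shows "\<exists>e'\<in>set p. dst e' = src e"
proof -
  obtain a b where p: "p = a @ e # b" using assms(2) by (auto simp: in_set_conv_decomp)
  have "walk src dst (src e) (e # b @ a) (src e)"
    using assms(1) unfolding p by (auto simp: walk_append)
  moreover obtain x xs where x: "e # b @ a = xs @ [x]" by (cases "e # b @ a" rule: rev_cases) auto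
  ultimately have "dst x = src e" by (simp only: walk_append walk.simps) blast
  moreover have "x \<in> set p" using arg_cong[OF x, of set] unfolding p by auto
  ultimately show ?thesis by blast
qed

definition disjoint_trails :: "'b list set \<Rightarrow> bool" where
  "disjoint_trails \<K> \<longleftrightarrow> (\<forall>p\<in>\<K>. distinct p) \<and> (\<forall>p\<in>\<K>. \<forall>q\<in>\<K>. p \<noteq> q \<longrightarrow> set p \<inter> set q = {})"

abbreviation edges :: "'b list set \<Rightarrow> 'b set" where
  "edges \<K> \<equiv> \<Union>(set ` \<K>)"

text \<open>No edge leaves the target set \<open>Y\<close> and none enters \<open>s\<close>. A
  closed trail in \<open>E\<close> therefore has no edge into \<open>Y\<close> or out of
  \<open>s\<close>, which is why such trails can be discarded in the end.\<close>

locale flow = local_closure dst cl for dst :: "'b \<Rightarrow> 'v" and cl :: "'b set \<Rightarrow> 'b set" +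
  fixes src :: "'b \<Rightarrow> 'v" and E :: "'b set" and s :: 'v and Y :: "'v set"
  assumes src_notin: "e \<in> E \<Longrightarrow> src e \<notin> Y" and dst_neq: "e \<in> E \<Longrightarrow> dst e \<noteq> s"
    and s_notin: "s \<notin> Y"
begin

text \<open>
  A partially augmented flow: the trail \<open>r\<close> still has to be continued backwards to \<open>s\<close>.
  Rerouting can split off closed trails, which are kept because their edges may be needed
  to span others.
\<close>

definition stub_flow :: "'b list set \<Rightarrow> 'b list \<Rightarrow> 'v \<Rightarrow> 'b set \<Rightarrow> bool" where
  "stub_flow \<K> r u F \<longleftrightarrow>
    disjoint_trails \<K> \<and> distinct r \<and> edges \<K> \<inter> set r = {} \<and> F = edges \<K> \<union> set r
    \<and> (\<exists>w\<in>Y. walk src dst u r w)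
    \<and> (\<forall>p\<in>\<K>. (\<exists>w\<in>Y. walk src dst s p w) \<or> (\<exists>w. walk src dst w p w))"

lemma stub_flow_prepend:
  "stub_flow \<K> r (dst e) F \<Longrightarrow> e \<notin> F \<Longrightarrow> stub_flow \<K> (e # r) (src e) (insert e F)"
  unfolding stub_flow_def by auto

text \<open>Shared bookkeeping for removing an edge \<open>g\<close>: the component \<open>p\<close>
  and the stub \<open>r\<close>, without \<open>g\<close>, are reassembled into a component
  \<open>q\<close> and a stub \<open>r'\<close> that starts at the head of \<open>g\<close>. The
  choice \<open>p = []\<close> covers the case in which \<open>g\<close> lies on the stub and no
  component loses an edge.\<close>

lemma stub_flow_exchange:
  assumes "stub_flow \<K> r u F" and p: "p \<in> \<K> \<or> p = []" and g: "g \<in> set p \<union> set r"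
    and eq: "set q \<union> set r' = set p \<union> set r - {g}" and dist: "distinct (q @ r')"
    and r': "\<exists>w\<in>Y. walk src dst (dst g) r' w"
    and q: "(\<exists>w\<in>Y. walk src dst s q w) \<or> (\<exists>w. walk src dst w q w)"
  shows "stub_flow (insert q (\<K> - {p})) r' (dst g) (F - {g})"
proof -
  have K: "disjoint_trails \<K>" "edges \<K> \<inter> set r = {}" "F = edges \<K> \<union> set r"
    using assms(1) unfolding stub_flow_def by auto
  have rest: "set p' \<inter> (set p \<union> set r) = {}" if "p' \<in> \<K> - {p}" for p'
  proof -
    have "set p' \<inter> set p = {}" using that p K(1) unfolding disjoint_trails_def by auto
    moreover have "set p' \<inter> set r = {}" using that K(2) by blast
    ultimately show ?thesis by blast
  qed
  have rest': "set p' \<inter> (set q \<union> set r') = {}" if "p' \<in> \<K> - {p}" for p'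
    using rest[OF that] eq by blast
  have "edges \<K> = set p \<union> edges (\<K> - {p})" using p by auto
  then have "F - {g} = set q \<union> set r' \<union> edges (\<K> - {p})"
  proof -
    have "g \<notin> edges (\<K> - {p})" using rest g by blast
    then show ?thesis unfolding K(3) \<open>edges \<K> = _\<close> eq by blast
  qed
  moreover have "disjoint_trails (insert q (\<K> - {p}))"
  proof -
    have "set p' \<inter> set q = {}" "set q \<inter> set p' = {}" if "p' \<in> \<K> - {p}" for p'
      using rest'[OF that] by blast+
    then show ?thesis using K(1) dist unfolding disjoint_trails_def by auto
  qed
  moreover have "edges (insert q (\<K> - {p})) \<inter> set r' = {}"
  proof -
    have "set p' \<inter> set r' = {}" if "p' \<in> \<K> - {p}" for p'
      using rest'[OF that] by blast
    moreover have "set q \<inter> set r' = {}" using dist by simp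
    ultimately show ?thesis by blast
  qed
  ultimately show ?thesis using assms(1) dist r' q unfolding stub_flow_def by auto
qed

lemma stub_flow_cut:
  assumes "stub_flow \<K> r (src g) F" "g \<in> F"
  shows "\<exists>\<K>' r'. stub_flow \<K>' r' (dst g) (F - {g})"
proof -
  have K: "\<And>p. p \<in> \<K> \<Longrightarrow> distinct p" "distinct r" "edges \<K> \<inter> set r = {}" "F = edges \<K> \<union> set r"
    and good: "\<And>p. p \<in> \<K> \<Longrightarrow> (\<exists>w\<in>Y. walk src dst s p w) \<or> (\<exists>w. walk src dst w p w)"
    using assms(1) unfolding stub_flow_def disjoint_trails_def by blast+
  obtain w where r: "walk src dst (src g) r w" "w \<in> Y"
    using assms(1) unfolding stub_flow_def by blast
  consider (stub) "g \<in> set r" | (comp) p where "p \<in> \<K>" "g \<in> set p"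
    using K(4) assms(2) by blast
  then show ?thesis
  proof cases
    case stub
    then obtain a b where ab: "r = a @ g # b" by (auto simp: in_set_conv_decomp)
    \<comment> \<open>The stub starts at \<open>src g\<close>, so its part before \<open>g\<close>
      is a closed trail.\<close>
    have "stub_flow (insert a (\<K> - {[]})) b (dst g) (F - {g})"
      using K(2) r by (intro stub_flow_exchange[OF assms(1)]) (auto simp: ab walk_append)
    then show ?thesis by blast
  next
    case comp
    then obtain a b where ab: "p = a @ g # b" by (auto simp: in_set_conv_decomp)
    have dis: "set p \<inter> set r = {}" "distinct p" using K(1,3) comp(1) by blast+
    from good[OF comp(1)] show ?thesis
    proof
      assume "\<exists>w\<in>Y. walk src dst s p w"
      \<comment> \<open>The beginning of \<open>p\<close> is continued along the old stub, and the
        end of \<open>p\<close> becomes the new stub.\<close>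
      then have "stub_flow (insert (a @ r) (\<K> - {p})) b (dst g) (F - {g})"
        using K(2) r dis comp(1)
        by (intro stub_flow_exchange[OF assms(1)]) (auto simp: ab walk_append)
      then show ?thesis by blast
    next
      assume "\<exists>w. walk src dst w p w"
      \<comment> \<open>The closed trail is opened at \<open>g\<close> and runs from the head of
        \<open>g\<close> once around into the old stub; the empty trail counts as closed.\<close>
      then have "stub_flow (insert [] (\<K> - {p})) (b @ a @ r) (dst g) (F - {g})"
        using K(2) r dis comp(1)
        by (intro stub_flow_exchange[OF assms(1)]) (auto simp: ab walk_append)
      then show ?thesis by blast
    qed
  qed
qed

text \<open>The residual digraph of the flow \<open>F\<close>. In the first alternative
  \<open>e\<close> is used forwards and an edge \<open>g\<close> of its fundamental circuit
  backwards; both have the same head, which is passed within the step. The other two alternatives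
  add an unspanned edge and cancel a flow edge.\<close>

definition step :: "'b set \<Rightarrow> 'v \<Rightarrow> 'v \<Rightarrow> bool" where
  "step F u v \<longleftrightarrow>
    (\<exists>e\<in>E. src e = u \<and> e \<in> cl F \<and> (\<exists>g\<in>coll F e. src g = v))
    \<or> (\<exists>e\<in>E. src e = u \<and> e \<notin> cl F \<and> dst e = v \<and> v \<notin> Y)
    \<or> (\<exists>g\<in>F. dst g = u \<and> src g = v)"

text \<open>A fundamental circuit does not depend on the ambient free set, so for edges spanned by
  \<open>F \<inter> F'\<close> it is the same in \<open>F\<close> and in \<open>F'\<close>.\<close>

lemma step_cong:
  assumes "free_in cl F" "free_in cl F'"
    and "\<And>e. e \<in> E \<Longrightarrow> src e = u \<Longrightarrow> e \<in> cl F \<Longrightarrow> e \<in> cl (F \<inter> F')"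
    and "\<And>e. e \<in> E \<Longrightarrow> src e = u \<Longrightarrow> e \<notin> cl F \<Longrightarrow> e \<notin> cl F'"
    and F': "\<And>g. dst g = u \<Longrightarrow> g \<in> F \<longleftrightarrow> g \<in> F'"
  shows "step F u v \<longleftrightarrow> step F' u v"
proof -
  have "e \<in> cl F \<longleftrightarrow> e \<in> cl F'" "coll F e = coll F' e \<or> e \<notin> cl F" if "e \<in> E" "src e = u" for e
  proof -
    show "e \<in> cl F \<longleftrightarrow> e \<in> cl F'"
      using assms(3,4)[OF that] mono[of "F \<inter> F'" F'] by blast
    show "coll F e = coll F' e \<or> e \<notin> cl F"
      using assms(3)[OF that] coll_extend[of "F \<inter> F'" F e] coll_extend[of "F \<inter> F'" F' e] assms(1,2)
      by auto
  qed
  then have "(e \<in> cl F \<and> (\<exists>g\<in>coll F e. src g = v)) \<longleftrightarrow> (e \<in> cl F' \<and> (\<exists>g\<in>coll F' e. src g = v))"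
    "e \<notin> cl F \<longleftrightarrow> e \<notin> cl F'" if "e \<in> E" "src e = u" for e
    using that by metis+
  then show ?thesis unfolding step_def using F' by blast
qed

lemma free_swap:
  assumes F: "free_in cl F" and e: "e \<in> cl F" and g: "g \<in> coll F e"
  shows "free_in cl (insert e (F - {g}))" "cl (insert e (F - {g})) = cl F"
proof -
  have g': "g \<in> F" "e \<notin> cl (F - {g})" using g unfolding coll_def by auto
  then show "free_in cl (insert e (F - {g}))"
    using free_insert free_subset[OF F, of "F - {g}"] by blast
  have "g \<in> cl (insert e (F - {g}))"
    using exchange[of e g "F - {g}"] g' e by (simp add: insert_absorb)
  then have "F \<subseteq> cl (insert e (F - {g}))"
    using ext[of "insert e (F - {g})"] by blast
  moreover have "insert e (F - {g}) \<subseteq> cl F" using e ext[of F] by blast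
  ultimately show "cl (insert e (F - {g})) = cl F"
    using closed_under[of _ F "insert e (F - {g})"] closed_under[of _ "insert e (F - {g})" F] by blast
qed

text \<open>
  An augmenting walk is processed from its last vertex backwards; the absence of shortcuts
  guarantees that an exchange at the end leaves the steps at all earlier vertices unchanged.
\<close>

lemma augment_backwards:
  assumes "stub_flow \<K> r (u n) F" "free_in cl F" "F \<subseteq> E"
    and "\<And>i. i < n \<Longrightarrow> step F (u i) (u (Suc i))"
    and "\<And>i j. Suc i < j \<Longrightarrow> j \<le> n \<Longrightarrow> \<not> step F (u i) (u j)"
    and "inj_on u {..n}" and "\<And>i. i \<le> n \<Longrightarrow> u i \<notin> Y" and "u 0 = s"
  shows "\<exists>\<K>' r' F'. stub_flow \<K>' r' s F' \<and> free_in cl F' \<and> F' \<subseteq> E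
    \<and> (\<forall>e. dst e \<in> Y \<longrightarrow> e \<in> cl F \<longrightarrow> e \<in> cl F') \<and> (\<forall>e\<in>F. src e = s \<longrightarrow> e \<in> F')"
  using assms
proof (induction n arbitrary: \<K> r F)
  case 0
  then show ?case by auto
next
  case (Suc n)
  note flow = Suc.prems(1) and free = Suc.prems(2) and FE = Suc.prems(3)
    and no_shortcut = Suc.prems(5)
  have inj: "u i = u j \<longleftrightarrow> i = j" if "i \<le> Suc n" "j \<le> Suc n" for i j
    using Suc.prems(6) that unfolding inj_on_def by auto
  have no_last: "\<not> step F (u i) (u (Suc n))" if "i < n" for i
    using no_shortcut[of i "Suc n"] that by simp
  have last_step: "step F (u n) (u (Suc n))" using Suc.prems(4) by simp
  have un: "u (Suc n) \<noteq> s" using inj[of "Suc n" 0] Suc.prems(8) by simp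
  \<comment> \<open>Every kind of last step moves the start of the stub back to \<open>u n\<close>;
    what remains in each case is that the steps from earlier vertices are unchanged.\<close>
  have conclude: ?case
    if flow': "stub_flow \<K>1 r1 (u n) F1" and F1: "free_in cl F1" "F1 \<subseteq> E"
      and same: "\<And>i v. i < n \<Longrightarrow> step F (u i) v \<longleftrightarrow> step F1 (u i) v"
      and cl1: "\<And>e. dst e \<in> Y \<Longrightarrow> e \<in> cl F \<Longrightarrow> e \<in> cl F1"
      and src1: "\<And>e. e \<in> F \<Longrightarrow> src e = s \<Longrightarrow> e \<in> F1"
    for \<K>1 r1 F1
  proof -
    have w: "step F1 (u i) (u (Suc i))" if "i < n" for i
      using same[OF that] Suc.prems(4)[of i] that by simp
    have ns: "\<not> step F1 (u i) (u j)" if "Suc i < j" "j \<le> n" for i j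
      using same[of i] no_shortcut[of i j] that by simp
    have "inj_on u {..n}" "\<And>i. i \<le> n \<Longrightarrow> u i \<notin> Y"
      using Suc.prems(6,7) by (auto simp: inj_on_def)
    from Suc.IH[OF flow' F1 w ns this Suc.prems(8)] show ?case
      using cl1 src1 by blast
  qed
  consider
      (swap) e g where "e \<in> E" "src e = u n" "e \<in> cl F" "g \<in> coll F e" "src g = u (Suc n)"
    | (forward) e where "e \<in> E" "src e = u n" "e \<notin> cl F" "dst e = u (Suc n)" "u (Suc n) \<notin> Y"
    | (backward) g where "g \<in> F" "dst g = u n" "src g = u (Suc n)"
    using last_step unfolding step_def by blast
  then show ?case
  proof cases
    case swap
    have gF: "g \<in> F" "e \<notin> cl (F - {g})" using swap(4) unfolding coll_def by auto
    have "e \<noteq> g" using swap(2,5) inj[of n "Suc n"] by auto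
    have eF: "e \<notin> F" using gF(2) \<open>e \<noteq> g\<close> ext[of "F - {g}"] by blast
    have dg: "dst g = dst e" using coll_local swap(3,4) by blast
    let ?F1 = "insert e (F - {g})"
    obtain \<K>1 r1 where "stub_flow \<K>1 r1 (dst g) (F - {g})"
      using stub_flow_cut[of \<K> r g F] flow gF(1) swap(5) by auto
    then have "stub_flow \<K>1 (e # r1) (u n) ?F1"
      using stub_flow_prepend[of \<K>1 r1 e "F - {g}"] dg eF swap(2) by simp
    moreover have f1: "free_in cl ?F1" and same_cl: "cl ?F1 = cl F"
      using free_swap[OF free swap(3,4)] by auto
    note f1
    moreover have "?F1 \<subseteq> E" using FE swap(1) by blast
    moreover have "step F (u i) v \<longleftrightarrow> step ?F1 (u i) v" if i: "i < n" for i v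
    proof (rule step_cong[OF free f1])
      show "e' \<in> cl (F \<inter> ?F1)" if "e' \<in> E" "src e' = u i" "e' \<in> cl F" for e'
      proof -
        \<comment> \<open>Otherwise \<open>e'\<close> and \<open>g\<close> would give a swap step
          from \<open>u i\<close> to \<open>u (Suc n)\<close>, a shortcut.\<close>
        have "g \<notin> coll F e'" using no_last[OF i] that swap(5) unfolding step_def by blast
        then have "e' \<in> cl (F - {g})" using gF(1) unfolding coll_def by blast
        then show ?thesis using mono[of "F - {g}" "F \<inter> ?F1"] by blast
      qed
      show "e' \<notin> cl F \<Longrightarrow> e' \<notin> cl ?F1" for e' using same_cl by blast
      have "dst g \<noteq> u i" using no_last[OF i] gF(1) swap(5) unfolding step_def by blast
      then show "g' \<in> F \<longleftrightarrow> g' \<in> ?F1" if "dst g' = u i" for g' using that dg by auto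
    qed
    moreover have "e' \<in> cl ?F1" if "dst e' \<in> Y" "e' \<in> cl F" for e' using that same_cl by simp
    moreover have "e' \<in> ?F1" if "e' \<in> F" "src e' = s" for e' using that swap(5) un by auto
    ultimately show ?thesis by (intro conclude)
  next
    case forward
    let ?F1 = "insert e F"
    have eF: "e \<notin> F" using forward(3) ext[of F] by blast
    have "stub_flow \<K> (e # r) (u n) ?F1"
      using stub_flow_prepend[of \<K> r e F] eF forward(2,4) flow by simp
    moreover have f1: "free_in cl ?F1" using free_insert[OF free forward(3)] .
    moreover have "?F1 \<subseteq> E" using FE forward(1) by blast
    moreover have "step F (u i) v \<longleftrightarrow> step ?F1 (u i) v" if i: "i < n" for i v
    proof (rule step_cong[OF free f1])
      show "e' \<in> cl (F \<inter> ?F1)" if "e' \<in> cl F" for e' using that by (simp add: Int_absorb2 subset_insertI)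
      show "e' \<notin> cl ?F1" if "e' \<in> E" "src e' = u i" "e' \<notin> cl F" for e'
      proof
        assume "e' \<in> cl ?F1"
        \<comment> \<open>With the same head as \<open>e\<close>, the unspanned edge
          \<open>e'\<close> would be a forward step from \<open>u i\<close> to
          \<open>u (Suc n)\<close>.\<close>
        moreover have "dst e' \<noteq> dst e"
          using no_last[OF i] that forward(4,5) unfolding step_def by auto
        ultimately have "e' \<in> cl F" by (elim local_mono) auto
        then show False using that by blast
      qed
      show "g' \<in> F \<longleftrightarrow> g' \<in> ?F1" if "dst g' = u i" for g'
        using that forward(4) inj[of i "Suc n"] i by auto
    qed
    moreover have "e' \<in> cl ?F1" if "dst e' \<in> Y" "e' \<in> cl F" for e' using that mono[of F ?F1] by blast
    moreover have "e' \<in> ?F1" if "e' \<in> F" "src e' = s" for e' using that by blast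
    ultimately show ?thesis by (intro conclude)
  next
    case backward
    let ?F1 = "F - {g}"
    obtain \<K>1 r1 where "stub_flow \<K>1 r1 (u n) ?F1"
      using stub_flow_cut[of \<K> r g F] flow backward by auto
    moreover have f1: "free_in cl ?F1" using free_subset[OF free] by blast
    moreover have "?F1 \<subseteq> E" using FE by blast
    moreover have "step F (u i) v \<longleftrightarrow> step ?F1 (u i) v" if i: "i < n" for i v
    proof (rule step_cong[OF free f1])
      show "e' \<in> cl (F \<inter> ?F1)" if "e' \<in> E" "src e' = u i" "e' \<in> cl F" for e'
      proof -
        have "g \<notin> coll F e'" using no_last[OF i] that backward(3) unfolding step_def by blast
        then have "e' \<in> cl (F - {g})" using backward(1) unfolding coll_def by blast
        then show ?thesis using mono[of "F - {g}" "F \<inter> ?F1"] by blast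
      qed
      show "e' \<notin> cl F \<Longrightarrow> e' \<notin> cl ?F1" for e' using mono[of ?F1 F] by blast
      show "g' \<in> F \<longleftrightarrow> g' \<in> ?F1" if "dst g' = u i" for g'
        using that backward(2) inj[of i n] i by auto
    qed
    moreover have "e' \<in> cl ?F1" if "dst e' \<in> Y" "e' \<in> cl F" for e'
    proof -
      \<comment> \<open>The removed edge has its head \<open>u n\<close> outside \<open>Y\<close>,
        so spans at heads in \<open>Y\<close> are unaffected.\<close>
      have "dst e' \<noteq> dst g" using that(1) backward(2) Suc.prems(7)[of n] by auto
      then show ?thesis using that(2) by (elim local_mono) auto
    qed
    moreover have "e' \<in> ?F1" if "e' \<in> F" "src e' = s" for e' using that backward(3) un by auto
    ultimately show ?thesis by (intro conclude)
  qed
qed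

section \<open>The augmentation dichotomy\<close>

definition trail_flow :: "'b list set \<Rightarrow> bool" where
  "trail_flow \<Q> \<longleftrightarrow> disjoint_trails \<Q> \<and> (\<forall>p\<in>\<Q>. \<exists>w\<in>Y. walk src dst s p w)
    \<and> edges \<Q> \<subseteq> E \<and> free_in cl (edges \<Q>)"

text \<open>Once it starts at \<open>s\<close>, the stub is an ordinary trail into \<open>Y\<close>.
  Dropping the closed trails loses no edge into \<open>Y\<close> or out of \<open>s\<close>: on a
  closed trail such an edge would have a successor leaving \<open>Y\<close> or a predecessor
  entering \<open>s\<close>.\<close>

lemma trail_flow_of_stub_flow:
  assumes "stub_flow \<K> r s F" "free_in cl F" "F \<subseteq> E"
  shows "\<exists>\<Q>. trail_flow \<Q> \<and> (\<forall>e\<in>F. dst e \<in> Y \<or> src e = s \<longrightarrow> e \<in> edges \<Q>)"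
proof -
  define \<Q> where "\<Q> = {p \<in> insert r \<K>. \<exists>w\<in>Y. walk src dst s p w}"
  have K: "disjoint_trails \<K>" "distinct r" "edges \<K> \<inter> set r = {}" "F = edges \<K> \<union> set r"
    and good: "\<And>p. p \<in> \<K> \<Longrightarrow> (\<exists>w\<in>Y. walk src dst s p w) \<or> (\<exists>w. walk src dst w p w)"
    and r: "r \<in> \<Q>"
    using assms(1) unfolding stub_flow_def \<Q>_def by blast+
  have sub: "edges \<Q> \<subseteq> F" unfolding K(4) \<Q>_def by blast
  have "disjoint_trails \<Q>"
    using K(1-3) unfolding disjoint_trails_def \<Q>_def by blast
  then have "trail_flow \<Q>"
    using sub assms(3) free_subset[OF assms(2) sub] unfolding trail_flow_def \<Q>_def by blast
  moreover have "e \<in> edges \<Q>" if e: "e \<in> F" "dst e \<in> Y \<or> src e = s" for e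
  proof (cases "e \<in> set r")
    case True
    then show ?thesis using r by blast
  next
    case False
    then obtain p where p: "p \<in> \<K>" "e \<in> set p" using e(1) K(4) by blast
    have pE: "set p \<subseteq> E" using p(1) K(4) assms(3) by blast
    have "\<not> (\<exists>w. walk src dst w p w)"
      using closed_walk_succ[of src dst _ p e] closed_walk_pred[of src dst _ p e] p(2) e(2)
        src_notin dst_neq pE by (metis subsetD)
    then show ?thesis using good[OF p(1)] p unfolding \<Q>_def by blast
  qed
  ultimately show ?thesis by blast
qed

text \<open>Search from \<open>s\<close> in the residual digraph. If no reachable vertex has an
  unspanned edge into \<open>Y\<close>, the reachable set \<open>R\<close> is the dual certificate.
  Otherwise a shortest residual walk to such a vertex is used, because it has no shortcuts, as
  \<open>augment_backwards\<close> demands.\<close>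

theorem augment:
  assumes "trail_flow \<Q>"
  obtains (closed) R where "s \<in> R" "R \<inter> Y = {}" "\<And>g. g \<in> edges \<Q> \<Longrightarrow> dst g \<in> R \<Longrightarrow> src g \<in> R"
      "\<And>e. e \<in> E \<Longrightarrow> src e \<in> R \<Longrightarrow> dst e \<notin> R \<Longrightarrow> e \<in> cl {g \<in> edges \<Q>. src g \<in> R}"
  | (augmented) \<Q>' y where "trail_flow \<Q>'" "y \<in> E" "dst y \<in> Y" "y \<notin> cl (edges \<Q>)"
      "\<And>e. dst e \<in> Y \<Longrightarrow> e \<in> cl (insert y (edges \<Q>)) \<Longrightarrow> e \<in> cl (edges \<Q>')"
      "\<And>e. e \<in> edges \<Q> \<Longrightarrow> src e = s \<Longrightarrow> e \<in> edges \<Q>'"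
proof -
  define F where "F = edges \<Q>"
  have F: "free_in cl F" "F \<subseteq> E" "disjoint_trails \<Q>"
    using assms unfolding trail_flow_def F_def by auto
  define terminal where "terminal w \<longleftrightarrow> (\<exists>y\<in>E. src y = w \<and> y \<notin> cl F \<and> dst y \<in> Y)" for w
  let ?S = "{(v, w). step F v w}"
  have stepY: "w \<notin> Y" if "step F v w" for v w
    using that F(2) src_notin unfolding step_def coll_def by blast
  show thesis
  proof (cases "\<exists>w. (s, w) \<in> ?S\<^sup>* \<and> terminal w")
    case False
    define R where "R = {w. (s, w) \<in> ?S\<^sup>*}"
    have R_step: "w \<in> R" if "v \<in> R" "step F v w" for v w
      using that unfolding R_def by (auto intro: rtrancl_into_rtrancl)
    have RY: "R \<inter> Y = {}"
    proof -
      have "w \<notin> Y" if "(s, w) \<in> ?S\<^sup>*" for w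
        using that s_notin stepY by (cases rule: rtranclE) auto
      then show ?thesis unfolding R_def by blast
    qed
    have bk: "src g \<in> R" if "g \<in> F" "dst g \<in> R" for g
      using R_step[of "dst g" "src g"] that unfolding step_def by blast
    have "e \<in> cl {g \<in> F. src g \<in> R}" if e: "e \<in> E" "src e \<in> R" "dst e \<notin> R" for e
    proof -
      have "\<not> terminal (src e)" using False e(2) unfolding R_def by blast
      then have eF: "e \<in> cl F"
        using R_step[of "src e" "dst e"] e unfolding terminal_def step_def by blast
      \<comment> \<open>A circuit edge starting outside \<open>R\<close> would be the end of a swap
        step leaving \<open>R\<close>.\<close>
      have "coll F e \<subseteq> {g \<in> F. src g \<in> R}"
        using R_step[of "src e"] e eF unfolding step_def coll_def by blast
      then show ?thesis using coll_spans[OF F(1) eF] mono by blast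
    qed
    then show thesis using closed[of R] RY bk unfolding F_def R_def by blast
  next
    case True
    define P where "P n \<longleftrightarrow> (\<exists>w. (s, w) \<in> ?S ^^ n \<and> terminal w)" for n
    have "\<exists>n. P n" using True unfolding P_def by (meson rtrancl_imp_relpow)
    then obtain n where n: "P n" and least: "\<And>m. m < n \<Longrightarrow> \<not> P m"
      using exists_least_iff[of P] by blast
    then obtain u where u: "u 0 = s" "terminal (u n)" "\<And>i. i < n \<Longrightarrow> step F (u i) (u (Suc i))"
      unfolding P_def relpow_fun_conv by auto
    have path: "(u i, u j) \<in> ?S ^^ (j - i)" if "i \<le> j" "j \<le> n" for i j
      unfolding relpow_fun_conv using that u(3) by (intro exI[of _ "\<lambda>k. u (i + k)"]) auto
    \<comment> \<open>Used with \<open>k = 0\<close> for injectivity and with \<open>k = 1\<close>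
      for the absence of shortcuts.\<close>
    have shorter: False if "(u i, u j) \<in> ?S ^^ k" "i \<le> n" "j \<le> n" "i + k < j" for i j k
    proof -
      have "(s, u n) \<in> ?S ^^ (i + (k + (n - j)))"
        unfolding relpow_add using path[of 0 i] path[of j n] that u(1) by auto
      then show False using least[of "i + (k + (n - j))"] that u(2) unfolding P_def by auto
    qed
    have uY: "u i \<notin> Y" if "i \<le> n" for i
      using that u(1) s_notin stepY u(3)[of "i - 1"] by (cases i) auto
    have inj: "inj_on u {..n}"
    proof (rule linorder_inj_onI)
      show "u i \<noteq> u j" if "i < j" "i \<in> {..n}" "j \<in> {..n}" for i j
        using shorter[of i j 0] that by auto
    qed auto
    have not_term: "\<not> terminal (u i)" if "i < n" for i
      using path[of 0 i] that least[OF that] u(1) unfolding P_def by auto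
    obtain y where y: "y \<in> E" "src y = u n" "y \<notin> cl F" "dst y \<in> Y"
      using u(2) unfolding terminal_def by blast
    have yF: "y \<notin> F" using y(3) ext[of F] by blast
    let ?F1 = "insert y F"
    have "stub_flow \<Q> [] (dst y) F"
      using assms y(4) unfolding stub_flow_def trail_flow_def F_def by auto
    then have "stub_flow \<Q> [y] (u n) ?F1" using stub_flow_prepend yF y(2) by metis
    moreover have f1: "free_in cl ?F1" using free_insert[OF F(1) y(3)] .
    moreover have "?F1 \<subseteq> E" using F(2) y(1) by blast
    moreover have same: "step F (u i) v \<longleftrightarrow> step ?F1 (u i) v" if i: "i < n" for i v
    proof (rule step_cong[OF F(1) f1])
      show "e' \<in> cl (F \<inter> ?F1)" if "e' \<in> cl F" for e' using that by (simp add: Int_absorb2 subset_insertI)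
      show "e' \<notin> cl ?F1" if "e' \<in> E" "src e' = u i" "e' \<notin> cl F" for e'
      proof
        assume "e' \<in> cl ?F1"
        \<comment> \<open>With the same head as \<open>y\<close>, the edge \<open>e'\<close> would
          make \<open>u i\<close> terminal before the end of the shortest walk.\<close>
        moreover have "dst e' \<noteq> dst y"
          using not_term[OF i] that y(4) unfolding terminal_def by auto
        ultimately have "e' \<in> cl F" by (elim local_mono) auto
        then show False using that by blast
      qed
      show "g' \<in> F \<longleftrightarrow> g' \<in> ?F1" if "dst g' = u i" for g'
        using that y(4) uY[of i] i by auto
    qed
    moreover have "step ?F1 (u i) (u (Suc i))" if "i < n" for i
      using same that u(3) by blast
    moreover have "\<not> step ?F1 (u i) (u j)" if "Suc i < j" "j \<le> n" for i j
      using same[of i "u j"] shorter[of i j 1] that by auto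
    ultimately have "\<exists>\<K>' r' F'. stub_flow \<K>' r' s F' \<and> free_in cl F' \<and> F' \<subseteq> E
      \<and> (\<forall>e. dst e \<in> Y \<longrightarrow> e \<in> cl ?F1 \<longrightarrow> e \<in> cl F') \<and> (\<forall>e\<in>?F1. src e = s \<longrightarrow> e \<in> F')"
      by (intro augment_backwards[OF _ _ _ _ _ inj uY u(1)])
    then obtain \<K>' r' F' where F': "stub_flow \<K>' r' s F'" "free_in cl F'" "F' \<subseteq> E"
      "\<And>e. dst e \<in> Y \<Longrightarrow> e \<in> cl ?F1 \<Longrightarrow> e \<in> cl F'" "\<And>e. e \<in> ?F1 \<Longrightarrow> src e = s \<Longrightarrow> e \<in> F'"
      by blast
    obtain \<Q>' where Q': "trail_flow \<Q>'" "\<And>e. e \<in> F' \<Longrightarrow> dst e \<in> Y \<or> src e = s \<Longrightarrow> e \<in> edges \<Q>'"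
      using trail_flow_of_stub_flow[OF F'(1-3)] by blast
    have "e \<in> cl (edges \<Q>')" if "dst e \<in> Y" "e \<in> cl ?F1" for e
      using F'(4)[OF that] Q'(2) that(1) by (elim local_mono) auto
    moreover have "e \<in> edges \<Q>'" if "e \<in> F" "src e = s" for e
      using F'(5)[of e] Q'(2)[of e] that by blast
    ultimately show thesis using augmented[of \<Q>' y] Q'(1) y(1,3,4) unfolding F_def by blast
  qed
qed

end

subsection \<open>Waves\<close>

lemma walk_last: "walk src dst u p w \<Longrightarrow> w = (if p = [] then u else dst (last p))"
  by (induction p arbitrary: u) auto

lemma walk_next:
  "walk src dst u p w \<Longrightarrow> e \<in> set p \<Longrightarrow> e \<noteq> last p \<Longrightarrow> \<exists>e'\<in>set p. src e' = dst e"
proof (induction p arbitrary: u)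
  case (Cons a p)
  show ?case
  proof (cases "e \<in> set p")
    case True
    then have "last (a # p) = last p" by auto
    then show ?thesis using Cons.IH[of "dst a"] Cons.prems True by auto
  next
    case False
    then show ?thesis using Cons.prems by (cases p) auto
  qed
qed simp

locale web_graph =
  fixes A :: "'b set" and src dst :: "'b \<Rightarrow> 'a" and t :: 'a
begin

text \<open>Edges starting in \<open>Y\<close> are left out, so a trail of inner edges ends as soon
  as it meets \<open>Y\<close>.\<close>

definition inner :: "'a set \<Rightarrow> 'a set \<Rightarrow> 'b set" where
  "inner X Y = {e\<in>A. src e \<in> X - Y \<and> dst e \<in> X}"

definition linkage :: "'a set \<Rightarrow> 'b set \<Rightarrow> 'a set \<Rightarrow> 'b list set \<Rightarrow> bool" where
  "linkage X B Y W \<longleftrightarrow> disjoint_trails W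
    \<and> (\<forall>p\<in>W. \<exists>b q. p = b # q \<and> b \<in> B \<and> set q \<subseteq> inner X Y \<and> (\<exists>w\<in>Y. walk src dst (dst b) q w))"

text \<open>Kept apart from freeness because a larger closure preserves this part of a wave, while
  freeness passes to smaller closures. The demand that \<open>[b]\<close> be a path makes
  composition keep every path of the first wave that ends in the smaller region.\<close>

definition prewave :: "('b set \<Rightarrow> 'b set) \<Rightarrow> 'a set \<Rightarrow> 'b set \<Rightarrow> 'b list set \<Rightarrow> 'a set \<Rightarrow> bool" where
  "prewave cl X B W Y \<longleftrightarrow> t \<in> Y \<and> Y \<subseteq> X \<and> linkage X B Y W
    \<and> (\<forall>b\<in>B. dst b \<in> Y \<longrightarrow> [b] \<in> W) \<and> (\<forall>e\<in>inner X Y. dst e \<in> Y \<longrightarrow> e \<in> cl (edges W))"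

definition wave :: "('b set \<Rightarrow> 'b set) \<Rightarrow> 'a set \<Rightarrow> 'b set \<Rightarrow> 'b list set \<Rightarrow> 'a set \<Rightarrow> bool" where
  "wave cl X B W Y \<longleftrightarrow> prewave cl X B W Y \<and> free_in cl (edges W)"

text \<open>A web: the part of the graph inside \<open>X\<close>, to be entered through the edges in \<open>B\<close>.\<close>

definition web :: "('b set \<Rightarrow> 'b set) \<Rightarrow> 'a set \<Rightarrow> 'b set \<Rightarrow> bool" where
  "web cl X B \<longleftrightarrow> t \<in> X \<and> B \<subseteq> A \<and> (\<forall>b\<in>B. dst b \<in> X \<and> src b \<notin> X) \<and> free_in cl B"

text \<open>The wave with region \<open>X\<close> is the trivial one: there are no inner edges, so
  all its paths are single edges of \<open>B\<close>.\<close>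

definition loose :: "('b set \<Rightarrow> 'b set) \<Rightarrow> 'a set \<Rightarrow> 'b set \<Rightarrow> bool" where
  "loose cl X B \<longleftrightarrow> (\<forall>W Y. wave cl X B W Y \<longrightarrow> Y = X)"

text \<open>The order for Zorn's lemma: a path may be dropped only when its end leaves the
  region.\<close>

definition extends :: "'b list set \<times> 'a set \<Rightarrow> 'b list set \<times> 'a set \<Rightarrow> bool" where
  "extends c c' \<longleftrightarrow> snd c' \<subseteq> snd c \<and> (\<forall>p\<in>fst c. dst (last p) \<in> snd c' \<longrightarrow> p \<in> fst c')"

text \<open>The inner web is entered through the last edges of \<open>W\<close>; this shared edge is
  listed only once, hence \<open>tl q\<close>.\<close>

definition compose :: "'b list set \<Rightarrow> 'b list set \<Rightarrow> 'b list set" where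
  "compose W W' = {p @ tl q | p q. p \<in> W \<and> q \<in> W' \<and> hd q = last p}"

lemma linkage_disjoint: "linkage X B Y W \<Longrightarrow> p \<in> W \<Longrightarrow> q \<in> W \<Longrightarrow> e \<in> set p \<Longrightarrow> e \<in> set q \<Longrightarrow> p = q"
  unfolding linkage_def disjoint_trails_def by (metis disjoint_iff)

lemma linkage_path:
  assumes "linkage X B Y W" "p \<in> W"
  shows "p \<noteq> []" "hd p \<in> B" "set (tl p) \<subseteq> inner X Y" "dst (last p) \<in> Y" "distinct p"
    "walk src dst (dst (hd p)) (tl p) (dst (last p))"
proof -
  obtain b q w where p: "p = b # q" "b \<in> B" "set q \<subseteq> inner X Y" "w \<in> Y" "walk src dst (dst b) q w"
    using assms unfolding linkage_def by blast
  moreover have "w = dst (last p)" using walk_last[OF p(5)] p(1) by simp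
  moreover have "distinct p" using assms unfolding linkage_def disjoint_trails_def by blast
  ultimately show "p \<noteq> []" "hd p \<in> B" "set (tl p) \<subseteq> inner X Y" "dst (last p) \<in> Y" "distinct p"
    "walk src dst (dst (hd p)) (tl p) (dst (last p))" by auto
qed

lemma linkageI:
  assumes "disjoint_trails W"
    and "\<And>p. p \<in> W \<Longrightarrow> p \<noteq> [] \<and> hd p \<in> B \<and> set (tl p) \<subseteq> inner X Y \<and> dst (last p) \<in> Y
      \<and> walk src dst (dst (hd p)) (tl p) (dst (last p))"
  shows "linkage X B Y W"
  unfolding linkage_def
proof (intro conjI ballI assms(1))
  fix p assume "p \<in> W"
  from assms(2)[OF this]
  show "\<exists>b q. p = b # q \<and> b \<in> B \<and> set q \<subseteq> inner X Y \<and> (\<exists>w\<in>Y. walk src dst (dst b) q w)"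
    by (cases p) auto
qed

lemma linkage_edge:
  assumes "linkage X B Y W" "p \<in> W" "e \<in> set p"
  shows "e = hd p \<or> e \<in> inner X Y"
  using linkage_path[OF assms(1,2)] assms(3) by (cases p) auto

lemma linkage_last:
  assumes "linkage X B Y W" "p \<in> W" "e \<in> set p" "dst e \<in> Y"
  shows "e = last p"
proof (rule ccontr)
  assume e: "e \<noteq> last p"
  obtain b q where p: "p = b # q" "set q \<subseteq> inner X Y" "walk src dst (dst b) q (dst (last p))"
    using linkage_path[OF assms(1,2)] by (cases p) auto
  have "\<exists>e'\<in>set q. src e' = dst e"
  proof (cases "e \<in> set q")
    case True
    then show ?thesis using walk_next[OF p(3), of e] e p(1) by (cases q) auto
  next
    case False
    then show ?thesis using assms(3) e p by (cases q) auto
  qed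
  then obtain e' where "e' \<in> inner X Y" "src e' = dst e" using p(2) by blast
  then show False using assms(4) unfolding inner_def by simp
qed

lemma linkage_source:
  assumes "linkage X B Y W" "p \<in> W" "e \<in> set p" "src e \<notin> X"
  shows "e = hd p"
  using linkage_edge[OF assms(1-3)] assms(4) unfolding inner_def by blast

lemma linkage_cut:
  assumes "linkage X B Y W" "e \<in> edges W" "dst e \<in> Y"
  shows "e \<in> last ` W"
proof -
  obtain p where p: "p \<in> W" "e \<in> set p" using assms(2) by blast
  then have "e = last p" using linkage_last[OF assms(1) _ _ assms(3)] by blast
  then show ?thesis using p(1) by blast
qed

lemma wave_linkage: "wave cl X B W Y \<Longrightarrow> linkage X B Y W"
  and wave_free: "wave cl X B W Y \<Longrightarrow> free_in cl (edges W)"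
  and wave_region: "wave cl X B W Y \<Longrightarrow> Y \<subseteq> X" "wave cl X B W Y \<Longrightarrow> t \<in> Y"
  and wave_start: "wave cl X B W Y \<Longrightarrow> b \<in> B \<Longrightarrow> dst b \<in> Y \<Longrightarrow> [b] \<in> W"
  and wave_spans: "wave cl X B W Y \<Longrightarrow> e \<in> inner X Y \<Longrightarrow> dst e \<in> Y \<Longrightarrow> e \<in> cl (edges W)"
  unfolding wave_def prewave_def by auto

lemma waveI:
  assumes "t \<in> Y" "Y \<subseteq> X" "linkage X B Y W" "free_in cl (edges W)"
    "\<And>b. b \<in> B \<Longrightarrow> dst b \<in> Y \<Longrightarrow> [b] \<in> W" "\<And>e. e \<in> inner X Y \<Longrightarrow> dst e \<in> Y \<Longrightarrow> e \<in> cl (edges W)"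
  shows "wave cl X B W Y"
  unfolding wave_def prewave_def using assms by (intro conjI ballI impI) simp_all

lemma webD: "web cl X B \<Longrightarrow> t \<in> X" "web cl X B \<Longrightarrow> B \<subseteq> A" "web cl X B \<Longrightarrow> b \<in> B \<Longrightarrow> dst b \<in> X"
    "web cl X B \<Longrightarrow> b \<in> B \<Longrightarrow> src b \<notin> X" "web cl X B \<Longrightarrow> free_in cl B"
  unfolding web_def by auto

lemma linkage_edges:
  assumes "web cl X B" "linkage X B Y W" "Y \<subseteq> X" "e \<in> edges W"
  shows "e \<in> A" "src e \<notin> Y" "dst e \<in> X"
proof -
  obtain p where p: "p \<in> W" "e \<in> set p" using assms(4) by blast
  have "e \<in> B \<or> e \<in> inner X Y"
    using linkage_edge[OF assms(2) p] linkage_path(2)[OF assms(2) p(1)] by auto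
  then show "e \<in> A" "src e \<notin> Y" "dst e \<in> X"
    using webD[OF assms(1)] assms(3) unfolding inner_def by auto
qed

lemma last_in_edges:
  assumes "linkage X B Y W" shows "last ` W \<subseteq> edges W"
proof
  fix e assume "e \<in> last ` W"
  then obtain p where "p \<in> W" "e = last p" by blast
  moreover from this have "last p \<in> set p" using linkage_path(1)[OF assms, of p] by simp
  ultimately show "e \<in> edges W" by blast
qed

lemma wave_web:
  assumes "local_closure dst cl" "web cl X B" "wave cl X B W Y"
  shows "web cl Y (last ` W)"
proof -
  note l = wave_linkage[OF assms(3)]
  have "free_in cl (last ` W)"
    by (rule local_closure.free_subset[OF assms(1) wave_free[OF assms(3)] last_in_edges[OF l]])
  moreover have "b \<in> A \<and> dst b \<in> Y \<and> src b \<notin> Y" if "b \<in> last ` W" for b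
    using that last_in_edges[OF l] linkage_edges[OF assms(2) l wave_region(1)[OF assms(3)], of b]
      linkage_path(4)[OF l] by blast
  ultimately show ?thesis using wave_region(2)[OF assms(3)] unfolding web_def by blast
qed

lemma trivial_wave:
  assumes "web cl X B" shows "wave cl X B ((\<lambda>b. [b]) ` B) X"
proof (rule waveI)
  show "linkage X B X ((\<lambda>b. [b]) ` B)"
    using webD[OF assms] by (intro linkageI) (auto simp: disjoint_trails_def)
  have "edges ((\<lambda>b. [b]) ` B) = B" by auto
  then show "free_in cl (edges ((\<lambda>b. [b]) ` B))" using webD(5)[OF assms] by simp
  show "t \<in> X" by (rule webD(1)[OF assms])
  show "b \<in> B \<Longrightarrow> [b] \<in> (\<lambda>b. [b]) ` B" for b by (rule imageI)
  show "e \<in> inner X X \<Longrightarrow> e \<in> cl (edges ((\<lambda>b. [b]) ` B))" for e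
    unfolding inner_def by blast
qed (rule order_refl)

lemma inner_mono: "Z \<subseteq> Y \<Longrightarrow> Y \<subseteq> X \<Longrightarrow> inner X Y \<subseteq> inner X Z" "Z \<subseteq> Y \<Longrightarrow> Y \<subseteq> X \<Longrightarrow> inner Y Z \<subseteq> inner X Z"
  unfolding inner_def by blast+

lemma compose_linkage:
  assumes web: "web cl X B" and W: "linkage X B Y W" and YX: "Y \<subseteq> X"
    and W': "linkage Y (last ` W) Z W'" and ZY: "Z \<subseteq> Y"
  shows "linkage X B Z (compose W W')"
proof (rule linkageI)
  \<comment> \<open>Continuations consist of edges starting in \<open>Y\<close>, whereas no edge of
    \<open>W\<close> starts there.\<close>
  have tails: "set (tl q) \<inter> set p = {}" if "p \<in> W" "q \<in> W'" for p q
    using linkage_edges(2)[OF web W YX] that linkage_path(3)[OF W' that(2)] unfolding inner_def by blast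
  show "disjoint_trails (compose W W')"
    unfolding disjoint_trails_def
  proof (intro conjI ballI impI)
    fix r assume "r \<in> compose W W'"
    then obtain p q where r: "r = p @ tl q" "p \<in> W" "q \<in> W'" unfolding compose_def by blast
    then show "distinct r"
      using tails[OF r(2,3)] linkage_path(5)[OF W r(2)] linkage_path(5)[OF W' r(3)]
      by (auto simp: distinct_tl)
  next
    fix r r' assume "r \<in> compose W W'" "r' \<in> compose W W'" and ne: "r \<noteq> r'"
    then obtain p q p' q' where r: "r = p @ tl q" "p \<in> W" "q \<in> W'" "hd q = last p"
      and r': "r' = p' @ tl q'" "p' \<in> W" "q' \<in> W'" "hd q' = last p'" unfolding compose_def by blast
    have "p \<noteq> p'"
    proof
      assume "p = p'"
      then have "hd q = hd q'" using r r' by simp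
      then have "q = q'"
        using linkage_disjoint[OF W' r(3) r'(3), of "hd q"] linkage_path(1)[OF W' r(3)]
          linkage_path(1)[OF W' r'(3)] by (metis hd_in_set)
      then show False using ne r r' \<open>p = p'\<close> by simp
    qed
    then have 1: "set p \<inter> set p' = {}" using linkage_disjoint[OF W r(2) r'(2)] by blast
    have "q \<noteq> q'"
    proof
      assume "q = q'"
      then have "last p = last p'" using r r' by simp
      moreover have "last p \<in> set p" "last p' \<in> set p'"
        using linkage_path(1)[OF W r(2)] linkage_path(1)[OF W r'(2)] by simp_all
      ultimately show False using 1 by auto
    qed
    then have "set q \<inter> set q' = {}" using linkage_disjoint[OF W' r(3) r'(3)] by blast
    moreover have "set (tl q) \<subseteq> set q" "set (tl q') \<subseteq> set q'" by (cases q; auto)(cases q'; auto)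
    ultimately have "set (tl q) \<inter> set (tl q') = {}" by blast
    then show "set r \<inter> set r' = {}"
      using 1 tails[OF r(2) r'(3)] tails[OF r'(2) r(3)] unfolding r(1) r'(1) by auto
  qed
  fix r assume "r \<in> compose W W'"
  then obtain p q where r: "r = p @ tl q" "p \<in> W" "q \<in> W'" "hd q = last p" unfolding compose_def by blast
  note p = linkage_path[OF W r(2)] and q = linkage_path[OF W' r(3)]
  obtain b p' where p': "p = b # p'" using p(1) by (cases p) auto
  have "last r = last q" using r(1,4) p(1) q(1) by (cases q) auto
  moreover have "walk src dst (dst b) (p' @ tl q) (dst (last q))"
    unfolding walk_append using p(6) q(6) r(4) p' by auto
  moreover have "set (p' @ tl q) \<subseteq> inner X Z"
    using p(3) q(3) p' inner_mono[OF ZY YX] by auto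
  ultimately show "r \<noteq> [] \<and> hd r \<in> B \<and> set (tl r) \<subseteq> inner X Z \<and> dst (last r) \<in> Z \<and>
      walk src dst (dst (hd r)) (tl r) (dst (last r))"
    using p(2) q(4) unfolding r(1) p' by auto
qed

lemma compose_last:
  assumes W: "linkage X B Y W" and W': "linkage Y (last ` W) Z W'"
  shows "last ` compose W W' = last ` W'"
proof (intro set_eqI iffI)
  fix e assume "e \<in> last ` compose W W'"
  then obtain p q where r: "e = last (p @ tl q)" "p \<in> W" "q \<in> W'" "hd q = last p" unfolding compose_def by blast
  then have "e = last q" using linkage_path(1)[OF W r(2)] linkage_path(1)[OF W' r(3)] by (cases q) auto
  then show "e \<in> last ` W'" using r(3) by blast
next
  fix e assume "e \<in> last ` W'"
  then obtain q where q: "q \<in> W'" "e = last q" by blast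
  then obtain p where p: "p \<in> W" "hd q = last p" using linkage_path(2)[OF W'] by blast
  have "e = last (p @ tl q)"
    using q p linkage_path(1)[OF W p(1)] linkage_path(1)[OF W' q(1)] by (cases q) auto
  then show "e \<in> last ` compose W W'" using p q(1) unfolding compose_def by blast
qed

text \<open>Edges of the composition with head in \<open>Y\<close> come from \<open>W'\<close> and
  all others from \<open>W\<close>, so by locality freeness is inherited head by head. An edge
  entering \<open>Z\<close> from outside \<open>Y\<close> is spanned by \<open>W\<close>, whose
  edges at that head recur in \<open>W'\<close> as one-edge paths.\<close>

lemma compose_wave:
  assumes cl: "local_closure dst cl" and web: "web cl X B"
    and W: "wave cl X B W Y" and W': "wave cl Y (last ` W) W' Z"
  shows "wave cl X B (compose W W') Z" "extends (W, Y) (compose W W', Z)"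
    and "B \<subseteq> edges W \<Longrightarrow> last ` W \<subseteq> edges W' \<Longrightarrow> B \<subseteq> edges (compose W W')"
proof -
  interpret local_closure dst cl by (rule cl)
  note l = wave_linkage[OF W] and l' = wave_linkage[OF W']
  have YX: "Y \<subseteq> X" and ZY: "Z \<subseteq> Y" using wave_region W W' by blast+
  have web': "web cl Y (last ` W)" using wave_web[OF cl web W] .
  let ?C = "compose W W'"
  have lc: "linkage X B Z ?C" by (rule compose_linkage[OF web l YX l' ZY])
  have keep: "p \<in> ?C" if "p \<in> W" "dst (last p) \<in> Z" for p
  proof -
    have "[last p] \<in> W'" using wave_start[OF W'] that by blast
    then have "p @ tl [last p] \<in> ?C" using that(1) unfolding compose_def by fastforce
    then show ?thesis by simp
  qed
  then show "extends (W, Y) (?C, Z)" using ZY unfolding extends_def by simp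
  have edge: "g \<in> edges W' \<and> dst g \<in> Y \<or> g \<in> edges W \<and> dst g \<notin> Y" if g: "g \<in> edges ?C" for g
  proof -
    obtain p q where r: "g \<in> set (p @ tl q)" "p \<in> W" "q \<in> W'" "hd q = last p"
      using g unfolding compose_def by blast
    have q: "hd q \<in> set q" using linkage_path(1)[OF l' r(3)] by simp
    show ?thesis
    proof (cases "g \<in> set (tl q)")
      case True
      then have "g \<in> set q" by (cases q) auto
      then have "g \<in> edges W'" using r(3) by blast
      then show ?thesis using linkage_edges(3)[OF web' l' ZY] by blast
    next
      case False
      then have "g \<in> set p" using r(1) by simp
      then show ?thesis using linkage_last[OF l r(2)] r q by fastforce
    qed
  qed
  have lasts: "g \<in> edges ?C" if "g \<in> edges W'" "dst g \<in> Z" for g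
    using linkage_cut[OF l' that] compose_last[OF l l'] last_in_edges[OF lc] by blast
  show "wave cl X B ?C Z"
  proof (rule waveI)
    show "t \<in> Z" using wave_region(2)[OF W'] .
    show "Z \<subseteq> X" using YX ZY by blast
    show "linkage X B Z ?C" by (rule lc)
    show "free_in cl (edges ?C)"
    proof (rule free_local)
      fix v
      show "free_in cl {g \<in> edges ?C. dst g = v}"
      proof (cases "v \<in> Y")
        case True
        then have "{g \<in> edges ?C. dst g = v} \<subseteq> edges W'" using edge by blast
        then show ?thesis by (rule free_subset[OF wave_free[OF W']])
      next
        case False
        then have "{g \<in> edges ?C. dst g = v} \<subseteq> edges W" using edge by blast
        then show ?thesis by (rule free_subset[OF wave_free[OF W]])
      qed
    qed
    show "[b] \<in> ?C" if "b \<in> B" "dst b \<in> Z" for b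
      using keep[of "[b]"] wave_start[OF W, of b] that ZY by auto
    fix e assume e: "e \<in> inner X Z" "dst e \<in> Z"
    have "e \<in> cl (edges W')"
    proof (cases "src e \<in> Y")
      case True
      then have "e \<in> inner Y Z" using e ZY unfolding inner_def by blast
      then show ?thesis using wave_spans[OF W'] e(2) by blast
    next
      case False
      then have "e \<in> inner X Y" using e ZY unfolding inner_def by blast
      then have "e \<in> cl (edges W)" using wave_spans[OF W] e(2) ZY by blast
      then show ?thesis
      proof (rule local_mono)
        fix g assume g: "g \<in> edges W" "dst g = dst e"
        then have "g \<in> last ` W" using linkage_cut[OF l g(1)] e(2) ZY by auto
        then have "[g] \<in> W'" using wave_start[OF W', of g] g(2) e(2) by simp
        moreover have "g \<in> set [g]" by simp
        ultimately show "g \<in> edges W'" by blast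
      qed
    qed
    then show "e \<in> cl (edges ?C)" using lasts e(2) by (elim local_mono) auto
  qed
  show "B \<subseteq> edges ?C" if full: "B \<subseteq> edges W" "last ` W \<subseteq> edges W'"
  proof
    fix b assume b: "b \<in> B"
    then obtain p where p: "p \<in> W" "b \<in> set p" using full(1) by blast
    obtain q where q: "q \<in> W'" "last p \<in> set q" using full(2) p(1) by blast
    then have "last p = hd q"
      using linkage_source[OF l' q] webD(4)[OF web'] p(1) by blast
    then have "p @ tl q \<in> ?C" using p(1) q(1) unfolding compose_def by force
    moreover have "b \<in> set (p @ tl q)" using p(2) by simp
    ultimately show "b \<in> edges ?C" by blast
  qed
qed

section \<open>Limits of chains of waves\<close>

definition lim_region :: "('b list set \<times> 'a set) set \<Rightarrow> 'a set" where
  "lim_region \<C> = (\<Inter>c\<in>\<C>. snd c)"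

definition lim_paths :: "('b list set \<times> 'a set) set \<Rightarrow> 'b list set" where
  "lim_paths \<C> = {p. dst (last p) \<in> lim_region \<C> \<and> (\<exists>c\<in>\<C>. p \<in> fst c)}"

context
  fixes \<C> :: "('b list set \<times> 'a set) set" and X B
  assumes total: "\<And>c c'. c \<in> \<C> \<Longrightarrow> c' \<in> \<C> \<Longrightarrow> extends c c' \<or> extends c' c"
    and nonempty: "\<C> \<noteq> {}"
    and linkages: "\<And>c. c \<in> \<C> \<Longrightarrow> snd c \<subseteq> X \<and> t \<in> snd c \<and> linkage X B (snd c) (fst c)"
begin

lemma lim_extends: "c \<in> \<C> \<Longrightarrow> extends c (lim_paths \<C>, lim_region \<C>)"
  unfolding extends_def lim_paths_def lim_region_def by auto

text \<open>A limit path ends in every region of the chain, so \<open>extends\<close> never drops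
  it. This transfers disjointness and freeness to the limit.\<close>

lemma lim_paths_finite:
  assumes "finite P" "P \<subseteq> lim_paths \<C>" shows "\<exists>c\<in>\<C>. P \<subseteq> fst c"
  using assms
proof (induction P)
  case empty
  then show ?case using nonempty by auto
next
  case (insert p P)
  then obtain c where c: "c \<in> \<C>" "P \<subseteq> fst c" by blast
  obtain c' where c': "c' \<in> \<C>" "p \<in> fst c'" using insert.prems unfolding lim_paths_def by blast
  have ends: "dst (last q) \<in> snd c \<and> dst (last q) \<in> snd c'" if "q \<in> insert p P" for q
    using that insert.prems c(1) c'(1) unfolding lim_paths_def lim_region_def by blast
  from total[OF c(1) c'(1)] show ?case
  proof
    assume "extends c c'"
    then have "insert p P \<subseteq> fst c'" using c c' ends unfolding extends_def by blast
    then show ?thesis using c'(1) by blast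
  next
    assume "extends c' c"
    then have "insert p P \<subseteq> fst c" using c c' ends unfolding extends_def by blast
    then show ?thesis using c(1) by blast
  qed
qed

lemma lim_linkage: "linkage X B (lim_region \<C>) (lim_paths \<C>)"
proof (rule linkageI)
  show "disjoint_trails (lim_paths \<C>)"
    unfolding disjoint_trails_def
  proof (intro conjI ballI impI)
    fix p assume "p \<in> lim_paths \<C>"
    then obtain c where "c \<in> \<C>" "p \<in> fst c" unfolding lim_paths_def by blast
    then show "distinct p" using linkages linkage_path(5) by blast
  next
    fix p q assume "p \<in> lim_paths \<C>" "q \<in> lim_paths \<C>" "p \<noteq> q"
    then obtain c where "c \<in> \<C>" "{p, q} \<subseteq> fst c" using lim_paths_finite[of "{p, q}"] by auto
    then show "set p \<inter> set q = {}"
      using linkages[of c] linkage_disjoint[of X B "snd c" "fst c" p q] \<open>p \<noteq> q\<close> by blast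
  qed
  fix p assume p: "p \<in> lim_paths \<C>"
  then obtain c where c: "c \<in> \<C>" "p \<in> fst c" unfolding lim_paths_def by blast
  have "lim_region \<C> \<subseteq> snd c" using c(1) unfolding lim_region_def by blast
  then have "inner X (snd c) \<subseteq> inner X (lim_region \<C>)" using inner_mono(1) linkages[OF c(1)] by blast
  moreover have "linkage X B (snd c) (fst c)" using linkages[OF c(1)] by blast
  note linkage_path[OF this c(2)]
  moreover have "dst (last p) \<in> lim_region \<C>" using p unfolding lim_paths_def by blast
  ultimately show "p \<noteq> [] \<and> hd p \<in> B \<and> set (tl p) \<subseteq> inner X (lim_region \<C>) \<and> dst (last p) \<in> lim_region \<C>
      \<and> walk src dst (dst (hd p)) (tl p) (dst (last p))" by blast
qed

lemma lim_edges:
  assumes "c \<in> \<C>" "g \<in> edges (fst c)" "dst g \<in> lim_region \<C>"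
  shows "g \<in> edges (lim_paths \<C>)"
proof -
  have l: "linkage X B (snd c) (fst c)" using linkages[OF assms(1)] by blast
  have "dst g \<in> snd c" using assms(1,3) unfolding lim_region_def by blast
  then obtain p where "p \<in> fst c" "g = last p" using linkage_cut[OF l assms(2)] by blast
  then have "p \<in> lim_paths \<C>" "g \<in> set p"
    using assms(1,3) linkage_path(1)[OF l] unfolding lim_paths_def by auto
  then show ?thesis by blast
qed

lemma lim_prewave:
  assumes "local_closure dst cl" "\<And>c. c \<in> \<C> \<Longrightarrow> prewave cl X B (fst c) (snd c)"
  shows "prewave cl X B (lim_paths \<C>) (lim_region \<C>)"
  unfolding prewave_def
proof (intro conjI ballI impI)
  interpret local_closure dst cl by fact
  obtain c0 where c0: "c0 \<in> \<C>" using nonempty by blast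
  show "t \<in> lim_region \<C>" using linkages unfolding lim_region_def by blast
  show "lim_region \<C> \<subseteq> X" using linkages[OF c0] c0 unfolding lim_region_def by blast
  show "linkage X B (lim_region \<C>) (lim_paths \<C>)" by (rule lim_linkage)
  show "[b] \<in> lim_paths \<C>" if b: "b \<in> B" "dst b \<in> lim_region \<C>" for b
  proof -
    have "dst b \<in> snd c0" using b(2) c0 unfolding lim_region_def by blast
    then have "[b] \<in> fst c0" using assms(2)[OF c0] b(1) unfolding prewave_def by blast
    then show ?thesis using b(2) c0 unfolding lim_paths_def by auto
  qed
  show "e \<in> cl (edges (lim_paths \<C>))" if e: "e \<in> inner X (lim_region \<C>)" "dst e \<in> lim_region \<C>" for e
  proof -
    \<comment> \<open>The tail of \<open>e\<close> is outside the intersection, hence outside the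
      region of some member \<open>c\<close>, which already spans \<open>e\<close>. Edges of
      \<open>c\<close> with head in the limit region persist by \<open>lim_edges\<close>.\<close>
    obtain c where c: "c \<in> \<C>" "src e \<notin> snd c" using e(1) unfolding inner_def lim_region_def by blast
    have "e \<in> inner X (snd c)" "dst e \<in> snd c"
      using e c unfolding inner_def lim_region_def by blast+
    then have "e \<in> cl (edges (fst c))" using assms(2)[OF c(1)] unfolding prewave_def by blast
    then show ?thesis using lim_edges[OF c(1)] e(2) by (elim local_mono) auto
  qed
qed

lemma lim_free:
  assumes "local_closure dst cl" "\<And>c. c \<in> \<C> \<Longrightarrow> free_in cl (edges (fst c))"
  shows "free_in cl (edges (lim_paths \<C>))"
proof (rule local_closure.free_finitary[OF assms(1)])
  fix I0 assume I0: "I0 \<subseteq> edges (lim_paths \<C>)" "finite I0"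
  have "\<forall>e\<in>I0. \<exists>p\<in>lim_paths \<C>. e \<in> set p" using I0(1) by blast
  then obtain f where f: "\<And>e. e \<in> I0 \<Longrightarrow> f e \<in> lim_paths \<C> \<and> e \<in> set (f e)" by metis
  then obtain c where c: "c \<in> \<C>" "f ` I0 \<subseteq> fst c"
    using lim_paths_finite[of "f ` I0"] I0(2) by blast
  then have "I0 \<subseteq> edges (fst c)" using f by blast
  then show "free_in cl I0" using local_closure.free_subset[OF assms(1) assms(2)[OF c(1)]] by blast
qed

end

lemma maximal_wave:
  assumes cl: "local_closure dst cl" and web: "web cl X B"
  shows "\<exists>W Y. wave cl X B W Y \<and> loose cl Y (last ` W)"
proof -
  let ?\<W> = "{c. wave cl X B (fst c) (snd c)}"
  have "\<exists>m\<in>?\<W>. \<forall>a\<in>?\<W>. extends m a \<longrightarrow> a = m"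
  proof (rule predicate_Zorn)
    show "partial_order_on ?\<W> (relation_of extends ?\<W>)"
    proof (rule partial_order_on_relation_ofI)
      show "extends a a" for a unfolding extends_def by simp
      show "extends a c" if "extends a b" "extends b c" for a b c
        using that unfolding extends_def by blast
      show "a = b" if "a \<in> ?\<W>" "b \<in> ?\<W>" "extends a b" "extends b a" for a b
      proof -
        have "\<forall>p\<in>fst a. dst (last p) \<in> snd a" "\<forall>p\<in>fst b. dst (last p) \<in> snd b"
          using that(1,2) linkage_path(4)[OF wave_linkage] by blast+
        then have "fst a = fst b" "snd a = snd b" using that(3,4) unfolding extends_def by blast+
        then show ?thesis by (simp add: prod_eq_iff)
      qed
    qed
    fix \<C> assume C: "\<C> \<in> Chains (relation_of extends ?\<W>)"
    show "\<exists>u\<in>?\<W>. \<forall>a\<in>\<C>. extends a u"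
    proof (cases "\<C> = {}")
      case True
      then show ?thesis using trivial_wave[OF web] by (intro bexI[of _ "((\<lambda>b. [b]) ` B, X)"]) auto
    next
      case False
      have total: "\<And>c c'. c \<in> \<C> \<Longrightarrow> c' \<in> \<C> \<Longrightarrow> extends c c' \<or> extends c' c"
        and waves: "\<And>c. c \<in> \<C> \<Longrightarrow> wave cl X B (fst c) (snd c)"
        using C unfolding Chains_def relation_of_def by blast+
      have link: "\<And>c. c \<in> \<C> \<Longrightarrow> snd c \<subseteq> X \<and> t \<in> snd c \<and> linkage X B (snd c) (fst c)"
        using waves wave_region wave_linkage by blast
      have "wave cl X B (lim_paths \<C>) (lim_region \<C>)"
        unfolding wave_def
        using lim_prewave[OF total False link cl] lim_free[OF total False link cl] waves
        unfolding wave_def by blast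
      then show ?thesis
        using lim_extends[OF total False link] by (intro bexI[of _ "(lim_paths \<C>, lim_region \<C>)"]) auto
    qed
  qed
  then obtain W Y where W: "wave cl X B W Y"
    and max: "\<And>W' Y'. wave cl X B W' Y' \<Longrightarrow> extends (W, Y) (W', Y') \<Longrightarrow> Y' = Y"
    by fastforce
  \<comment> \<open>A nontrivial wave inside \<open>Y\<close> would compose with \<open>W\<close> to
    a proper extension.\<close>
  have "loose cl Y (last ` W)"
    unfolding loose_def using max compose_wave[OF cl web W] by blast
  then show ?thesis using W by blast
qed

end

section \<open>Contracting one edge of a loose web\<close>

lemma contract_contract: "contract (contract cl S) T = contract cl (S \<union> T)"
  unfolding contract_def by (rule ext) (simp add: Un_ac)

text \<open>No edge of the walk enters \<open>R\<close> from outside. Applied to the reachable set,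
  this says that a trail of the flow that has left the set never returns.\<close>

lemma walk_no_exit:
  assumes "walk src dst u p w" "u \<notin> R" "\<And>g. g \<in> set p \<Longrightarrow> dst g \<in> R \<Longrightarrow> src g \<in> R"
  shows "e \<in> set p \<Longrightarrow> src e \<notin> R"
  using assms by (induction p arbitrary: u) auto

lemma walk_Some:
  assumes "\<And>e. e \<in> set p \<Longrightarrow> src' e = Some (src e)"
  shows "walk src' (\<lambda>e. Some (dst e)) (Some u) p (Some w) \<longleftrightarrow> walk src dst u p w"
  using assms by (induction p arbitrary: u) auto

lemma walk_src_Some:
  assumes "walk src' (\<lambda>e. Some (dst e)) (Some u) p w"
  shows "e \<in> set p \<Longrightarrow> src' e \<noteq> None"
  using assms by (induction p arbitrary: u) auto

context web_graph begin

lemma linkage_singleton: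
  assumes "linkage X B Y W" "p \<in> W" "b \<in> set p" "src b \<notin> X" "dst b \<in> Y"
  shows "p = [b]"
proof -
  have "b = hd p" "b = last p" using linkage_source linkage_last assms by blast+
  then show ?thesis using linkage_path(1,5)[OF assms(1,2)] by (cases p) (auto split: if_splits)
qed

text \<open>At the vertices of \<open>Z\<close>, last edges of \<open>W\<close> are exchanged for edges of \<open>B\<close>.\<close>

lemma wave_if_starts_spanned:
  assumes cl: "local_closure dst cl" and web: "web cl X B" and l: "linkage X B Z W"
    and free: "free_in cl (edges W)" and Z: "t \<in> Z" "Z \<subseteq> X"
    and starts: "\<And>b. b \<in> B \<Longrightarrow> dst b \<in> Z \<Longrightarrow> b \<in> cl (edges W)"
    and spans: "\<And>e. e \<in> inner X Z \<Longrightarrow> dst e \<in> Z \<Longrightarrow> e \<in> cl (edges W)"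
  shows "\<exists>W'. wave cl X B W' Z"
proof -
  interpret local_closure dst cl by (rule cl)
  define D where "D = {b\<in>B. dst b \<in> Z}"
  have "free_in cl D" by (rule free_subset[OF webD(5)[OF web]]) (simp add: D_def)
  then obtain J where J: "D \<subseteq> J" "J \<subseteq> D \<union> last ` W" "free_in cl J" "D \<union> last ` W \<subseteq> cl J"
    using ex_free_spanning[of D "D \<union> last ` W"] by blast
  define W' where "W' = {p\<in>W. last p \<in> J} \<union> (\<lambda>b. [b]) ` D"
  \<comment> \<open>A path of \<open>W\<close> that meets \<open>D\<close> consists of this one
    edge, so adding the one-edge paths keeps the system disjoint.\<close>
  have single: "p = [b]" if "p \<in> W" "b \<in> D" "b \<in> set p" for p b
    using linkage_singleton[OF l that(1,3)] webD(4)[OF web] that(2) unfolding D_def by blast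
  have l': "linkage X B Z W'"
  proof (rule linkageI)
    have "set p \<inter> set q = {}" if pq: "p \<in> W'" "q \<in> W'" "p \<noteq> q" for p q
    proof (rule ccontr)
      assume "set p \<inter> set q \<noteq> {}"
      then obtain e where e: "e \<in> set p" "e \<in> set q" by blast
      consider "p \<in> W" "q \<in> W" | "p \<in> W" "q \<in> (\<lambda>b. [b]) ` D" | "q \<in> W" "p \<in> (\<lambda>b. [b]) ` D"
        | "p \<in> (\<lambda>b. [b]) ` D" "q \<in> (\<lambda>b. [b]) ` D"
        using pq(1,2) unfolding W'_def by blast
      then show False
      proof cases
        case 1
        then show ?thesis using linkage_disjoint[OF l _ _ e] pq(3) by blast
      next
        case 2
        then show ?thesis using single[OF 2(1)] e pq(3) by auto
      next
        case 3
        then show ?thesis using single[OF 3(1)] e pq(3) by auto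
      next
        case 4
        then show ?thesis using e pq(3) by auto
      qed
    qed
    moreover have "distinct p" if "p \<in> W'" for p
      using that linkage_path(5)[OF l] unfolding W'_def by auto
    ultimately show "disjoint_trails W'" unfolding disjoint_trails_def by blast
    fix p assume "p \<in> W'"
    then consider "p \<in> W" | b where "b \<in> B" "dst b \<in> Z" "p = [b]" unfolding W'_def D_def by blast
    then show "p \<noteq> [] \<and> hd p \<in> B \<and> set (tl p) \<subseteq> inner X Z \<and> dst (last p) \<in> Z
      \<and> walk src dst (dst (hd p)) (tl p) (dst (last p))"
      by cases (use linkage_path[OF l, of p] in auto)
  qed
  have toJ: "g \<in> J" if g: "g \<in> edges W'" "dst g \<in> Z" for g
  proof -
    consider p where "p \<in> W" "last p \<in> J" "g \<in> set p" | "g \<in> D"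
      using g(1) unfolding W'_def by auto
    then show ?thesis
    proof cases
      case 1
      then show ?thesis using linkage_last[OF l 1(1,3) g(2)] by simp
    qed (use J(1) in blast)
  qed
  have ofJ: "g \<in> edges W'" if g: "g \<in> J" for g
  proof -
    consider "g \<in> D" | p where "p \<in> W" "g = last p" using g J(2) by blast
    then show ?thesis
    proof cases
      case 1
      then show ?thesis unfolding W'_def by auto
    next
      case 2
      then have "p \<in> W'" "g \<in> set p" using g linkage_path(1)[OF l] unfolding W'_def by auto
      then show ?thesis by blast
    qed
  qed
  have Wcl: "e \<in> cl (edges W')" if "e \<in> cl (edges W)" "dst e \<in> Z" for e
    using that(1)
  proof (rule local_closed_under)
    fix g assume "g \<in> edges W" "dst g = dst e"
    then have "g \<in> cl J" using linkage_cut[OF l, of g] that(2) J(4) by auto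
    then show "g \<in> cl (edges W')" by (rule local_mono) (rule ofJ)
  qed
  have "wave cl X B W' Z"
  proof (rule waveI[OF Z l'])
    show "free_in cl (edges W')"
    proof (rule free_local)
      fix v
      show "free_in cl {g \<in> edges W'. dst g = v}"
      proof (cases "v \<in> Z")
        case True
        then have "{g \<in> edges W'. dst g = v} \<subseteq> J" using toJ by blast
        then show ?thesis by (rule free_subset[OF J(3)])
      next
        case False
        then have "{g \<in> edges W'. dst g = v} \<subseteq> edges W"
          unfolding W'_def D_def by auto
        then show ?thesis by (rule free_subset[OF free])
      qed
    qed
    show "[b] \<in> W'" if "b \<in> B" "dst b \<in> Z" for b
      using that unfolding W'_def D_def by blast
    show "e \<in> cl (edges W')" if "e \<in> inner X Z" "dst e \<in> Z" for e
      using Wcl spans that by blast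
  qed
  then show ?thesis by blast
qed

text \<open>
  If some edge of \<open>B\<close> is missed, augment inside the original web: an augmented linkage is a wave
  of that web because \<open>x\<close> and the new edge \<open>y\<close> are exchangeable, and otherwise the unreachable
  vertices carry a wave missing this edge. Both contradict looseness.
\<close>

lemma loose_contract_full:
  assumes cl: "local_closure dst cl" and web: "web cl X B" and loose: "loose cl X B"
    and W: "wave (contract cl {x}) X B W Y"
  shows "B \<subseteq> edges W"
proof
  fix f assume f: "f \<in> B"
  interpret lc: local_closure dst cl by (rule cl)
  \<comment> \<open>All edges of \<open>B\<close> get the common source \<open>None\<close>, which
    turns linkages into flows from one vertex.\<close>
  define src' where "src' e = (if e \<in> B then None else Some (src e))" for e
  define dst' where "dst' e = Some (dst e)" for e
  define E where "E = B \<union> inner X Y"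
  note l = wave_linkage[OF W] and YX = wave_region(1)[OF W]
  have BA: "B \<subseteq> A" and Bsrc: "\<And>b. b \<in> B \<Longrightarrow> src b \<notin> X" and Bdst: "\<And>b. b \<in> B \<Longrightarrow> dst b \<in> X"
    using webD[OF web] by auto
  have inB: "e \<notin> B" if "src e \<in> X" for e using that Bsrc by blast
  have src'_inner: "src' e = Some (src e)" if "e \<in> inner X Z" for e Z
    using that inB unfolding inner_def src'_def by auto
  have lc': "local_closure dst' cl"
    using cl unfolding local_closure_def dst'_def by simp
  interpret flow dst' cl src' E None "Some ` Y"
  proof (intro flow.intro lc' flow_axioms.intro)
    show "src' e \<notin> Some ` Y" if "e \<in> E" for e
      using that src'_inner[of e Y] unfolding E_def inner_def src'_def by auto
  qed (auto simp: dst'_def)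
  have walk': "walk src' dst' None p (Some (dst (last p)))" if "p \<in> W" for p
  proof -
    note p = linkage_path[OF l that]
    obtain b q where bq: "p = b # q" using p(1) by (cases p) auto
    have "src' e = Some (src e)" if "e \<in> set q" for e using src'_inner[of e Y] p(3) bq that by auto
    then have "walk src' dst' (Some (dst b)) q (Some (dst (last p)))"
      unfolding dst'_def using walk_Some[of q src' src dst "dst b" "dst (last p)"] p(6) bq by simp
    then show ?thesis using p(2) bq by (simp add: src'_def dst'_def)
  qed
  have WE: "edges W \<subseteq> E"
  proof
    fix e assume "e \<in> edges W"
    then obtain p where p: "p \<in> W" "e \<in> set p" by blast
    then show "e \<in> E" using linkage_edge[OF l p] linkage_path(2)[OF l p(1)] unfolding E_def by blast
  qed
  moreover have freeW: "free_in cl (edges W)"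
    using lc.free_contract[OF wave_free[OF W]] .
  ultimately have "trail_flow W"
    using l walk' linkage_path(4)[OF l] unfolding trail_flow_def linkage_def by blast
  then show "f \<in> edges W"
  proof (cases rule: augment)
    case (augmented Q y)
    have l': "linkage X B Y Q"
    proof (rule linkageI)
      show "disjoint_trails Q" using augmented(1) unfolding trail_flow_def by blast
      fix p assume p: "p \<in> Q"
      then obtain w where w: "w \<in> Y" "walk src' dst' None p (Some w)" and pE: "set p \<subseteq> E"
        using augmented(1) unfolding trail_flow_def by blast
      obtain b q where bq: "p = b # q" using w(2) by (cases p) auto
      then have b: "b \<in> B" using w(2) by (auto simp: src'_def split: if_splits)
      have wq: "walk src' dst' (Some (dst b)) q (Some w)" using w(2) bq by (simp add: dst'_def)
      have "e \<notin> B" if "e \<in> set q" for e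
        using walk_src_Some[OF wq[unfolded dst'_def] that] by (auto simp: src'_def)
      then have q: "set q \<subseteq> inner X Y" using pE bq unfolding E_def by auto
      then have "src' e = Some (src e)" if "e \<in> set q" for e using src'_inner[of e Y] that by blast
      then have "walk src dst (dst b) q w"
        using wq walk_Some[of q src' src dst "dst b" w] unfolding dst'_def by simp
      then show "p \<noteq> [] \<and> hd p \<in> B \<and> set (tl p) \<subseteq> inner X Y \<and> dst (last p) \<in> Y
        \<and> walk src dst (dst (hd p)) (tl p) (dst (last p))"
        using walk_last[of src dst "dst b" q w] b q w(1) bq by auto
    qed
    \<comment> \<open>The new edge is not in \<open>B\<close>, because every edge of
      \<open>B\<close> with head in \<open>Y\<close> is already a path of \<open>W\<close>.\<close>
    have y: "y \<in> inner X Y" "dst y \<in> Y"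
    proof -
      show "dst y \<in> Y" using augmented(3) by (auto simp: dst'_def)
      then have "y \<notin> B"
        using wave_start[OF W, of y] augmented(4) ext[of "edges W"] by fastforce
      then show "y \<in> inner X Y" using augmented(2) unfolding E_def by blast
    qed
    have span_x: "e \<in> cl (insert x (edges W))" if "e \<in> inner X Y" "dst e \<in> Y" for e
      using wave_spans[OF W that] by (simp add: contract_def)
    \<comment> \<open>As \<open>y\<close> is spanned by \<open>W\<close> together with
      \<open>x\<close> but not by \<open>W\<close> alone, it can take over the role of the
      contracted edge \<open>x\<close>.\<close>
    then have "x \<in> cl (insert y (edges W))" using exchange[of y x "edges W"] y augmented(4) by blast
    then have "insert x (edges W) \<subseteq> cl (insert y (edges W))" using ext[of "insert y (edges W)"] by blast
    then have span_y: "e \<in> cl (insert y (edges W))" if "e \<in> inner X Y" "dst e \<in> Y" for e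
      by (rule closed_under[OF span_x[OF that]])
    have "wave cl X B Q Y"
    proof (rule waveI[OF wave_region(2)[OF W] YX l'])
      show "free_in cl (edges Q)" using augmented(1) unfolding trail_flow_def by blast
      show "[b] \<in> Q" if b: "b \<in> B" "dst b \<in> Y" for b
      proof -
        have "b \<in> edges W" using wave_start[OF W b] by force
        then have "b \<in> edges Q" using augmented(6)[of b] b(1) by (simp add: src'_def)
        then obtain p where "p \<in> Q" "b \<in> set p" by blast
        then show ?thesis using linkage_singleton[OF l'] Bsrc b by blast
      qed
      show "e \<in> cl (edges Q)" if "e \<in> inner X Y" "dst e \<in> Y" for e
        using augmented(5)[of e] span_y[OF that] that(2) by (simp add: dst'_def)
    qed
    then have "Y = X" using loose unfolding loose_def by blast
    then show ?thesis using y(1) unfolding inner_def by blast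
  next
    case (closed R)
    define Z where "Z = {v\<in>X. Some v \<notin> R}"
    \<comment> \<open>Each path is cut where it leaves \<open>R\<close>. It cannot return, so the
      edges that remain are exactly the flow edges starting in \<open>R\<close>, which span the
      edges leaving \<open>R\<close>.\<close>
    define cut where "cut p = takeWhile (\<lambda>e. src' e \<in> R) p" for p
    define W' where "W' = cut ` W"
    have YZ: "Y \<subseteq> Z" using YX closed(2) unfolding Z_def by blast
    have cut: "set (cut p) = {e\<in>set p. src' e \<in> R}" "cut p \<noteq> []" "hd (cut p) = hd p"
      "dst (last (cut p)) \<in> Z" "set (tl (cut p)) \<subseteq> set (tl p)"
      "walk src dst (dst (hd p)) (tl (cut p)) (dst (last (cut p)))" if pW: "p \<in> W" for p
    proof -
      note p = linkage_path[OF l pW]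
      obtain b q where bq: "p = b # q" using p(1) by (cases p) auto
      have "src' b = None" using p(2) bq by (simp add: src'_def)
      then obtain c where c: "cut p = b # c" using closed(1) bq unfolding cut_def by simp
      define rest where "rest = dropWhile (\<lambda>e. src' e \<in> R) p"
      have split: "p = cut p @ rest" unfolding cut_def rest_def by simp
      obtain v where v: "walk src' dst' None (cut p) v" "walk src' dst' v rest (Some (dst (last p)))"
        using walk'[OF pW] split walk_append[of src' dst' None "cut p" rest] by metis
      have vlast: "v = Some (dst (last (cut p)))" using walk_last[OF v(1)] c by (simp add: dst'_def)
      have vR: "v \<notin> R"
      proof (cases rest)
        case Nil
        then show ?thesis using v(2) p(4) closed(2) by auto
      next
        case (Cons e r)
        then have "src' e \<notin> R" using hd_dropWhile[of "\<lambda>e. src' e \<in> R" p] unfolding rest_def by simp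
        then show ?thesis using v(2) Cons by simp
      qed
      have "src' e \<notin> R" if "e \<in> set rest" for e
      proof (rule walk_no_exit[OF v(2) vR _ that])
        fix g assume "g \<in> set rest" "dst' g \<in> R"
        moreover from this have "g \<in> edges W" using split pW by (metis UN_I UnCI set_append)
        ultimately show "src' g \<in> R" using closed(3) by blast
      qed
      moreover have "src' e \<in> R" if "e \<in> set (cut p)" for e
        using set_takeWhileD that unfolding cut_def by fast
      moreover have "set p = set (cut p) \<union> set rest" using split by (metis set_append)
      ultimately show "set (cut p) = {e\<in>set p. src' e \<in> R}" by blast
      show "cut p \<noteq> []" "hd (cut p) = hd p" using c bq by auto
      have "last (cut p) \<in> set p" using split c by (metis UnCI last_in_set list.distinct(1) set_append)
      then have "dst (last (cut p)) \<in> X" using linkage_edges(3)[OF web l YX] pW by blast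
      then show "dst (last (cut p)) \<in> Z" using vR vlast unfolding Z_def by simp
      have q: "q = c @ rest" using split c bq by simp
      then show "set (tl (cut p)) \<subseteq> set (tl p)" using c bq by simp
      obtain u where u: "walk src dst (dst b) c u"
        using p(6) bq q by (auto simp: walk_append)
      then show "walk src dst (dst (hd p)) (tl (cut p)) (dst (last (cut p)))"
        using walk_last[OF u] c bq by auto
    qed
    have edgesW': "edges W' = {g \<in> edges W. src' g \<in> R}"
      unfolding W'_def using cut(1) by auto
    have l': "linkage X B Z W'"
    proof (rule linkageI)
      show "disjoint_trails W'"
        unfolding disjoint_trails_def
      proof (intro conjI ballI impI)
        fix p assume "p \<in> W'"
        then show "distinct p" unfolding W'_def cut_def using linkage_path(5)[OF l] by auto
      next
        fix p q assume "p \<in> W'" "q \<in> W'" "p \<noteq> q"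
        then obtain p0 q0 where pq: "p0 \<in> W" "q0 \<in> W" "p = cut p0" "q = cut q0" "p0 \<noteq> q0"
          unfolding W'_def by blast
        then have "set p0 \<inter> set q0 = {}" using linkage_disjoint[OF l] by blast
        then show "set p \<inter> set q = {}" using cut(1) pq by blast
      qed
      fix p assume "p \<in> W'"
      then obtain p0 where p0: "p0 \<in> W" "p = cut p0" unfolding W'_def by blast
      note c = cut[OF p0(1)]
      have "set (tl p) \<subseteq> inner X Z"
      proof
        fix e assume e: "e \<in> set (tl p)"
        then have "e \<in> inner X Y" using c(5) linkage_path(3)[OF l p0(1)] p0(2) by blast
        moreover have "e \<in> set p" using e by (cases p) auto
        then have "src' e \<in> R" using c(1) p0(2) by simp
        ultimately show "e \<in> inner X Z"
          using src'_inner[of e Y] unfolding inner_def Z_def by auto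
      qed
      then show "p \<noteq> [] \<and> hd p \<in> B \<and> set (tl p) \<subseteq> inner X Z \<and> dst (last p) \<in> Z
        \<and> walk src dst (dst (hd p)) (tl p) (dst (last p))"
        using c p0 linkage_path(2)[OF l p0(1)] by auto
    qed
    have starts: "b \<in> cl (edges W')" if "b \<in> B" "dst b \<in> Z" for b
      using closed(1) closed(4)[of b] that
      unfolding edgesW' by (auto simp: E_def src'_def dst'_def Z_def)
    have "\<exists>W''. wave cl X B W'' Z"
    proof (rule wave_if_starts_spanned[OF cl web l'])
      show "free_in cl (edges W')" unfolding edgesW' by (rule free_subset[OF freeW]) blast
      show "t \<in> Z" using YZ wave_region(2)[OF W] by blast
      show "Z \<subseteq> X" unfolding Z_def by blast
      show "e \<in> cl (edges W')" if e: "e \<in> inner X Z" "dst e \<in> Z" for e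
      proof -
        have "Some (src e) \<in> R" using e(1) unfolding inner_def Z_def by blast
        moreover from this have "src e \<notin> Y" using closed(2) by blast
        then have "e \<in> E" using e(1) unfolding E_def inner_def by blast
        ultimately show ?thesis
          using closed(4)[of e] src'_inner[OF e(1)] e(2) unfolding edgesW' by (auto simp: dst'_def Z_def)
      qed
    qed (rule starts)
    then have "Z = X" using loose unfolding loose_def by blast
    \<comment> \<open>With no vertex of \<open>X\<close> reachable, all edges of \<open>W'\<close>
      start at \<open>None\<close>, that is, belong to \<open>B\<close>. They span all of
      \<open>B\<close>, so none can be missing from the free set \<open>B\<close>.\<close>
    then have noR: "Some v \<notin> R" if "v \<in> X" for v using that unfolding Z_def by blast
    have sub: "edges W' \<subseteq> B \<inter> edges W"
    proof
      fix g assume g: "g \<in> edges W'"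
      then have "g \<in> E" "g \<in> edges W" "src' g \<in> R" using WE unfolding edgesW' by auto
      moreover from this have "g \<notin> inner X Y" using src'_inner[of g Y] noR unfolding inner_def by auto
      ultimately show "g \<in> B \<inter> edges W" unfolding E_def by blast
    qed
    show ?thesis
    proof (rule ccontr)
      assume "f \<notin> edges W"
      then have "edges W' \<subseteq> B - {f}" using sub by blast
      moreover have "f \<in> cl (edges W')" using starts f Bdst \<open>Z = X\<close> by blast
      ultimately have "f \<in> cl (B - {f})" using mono[of "edges W'" "B - {f}"] by blast
      then show False using webD(5)[OF web] f unfolding free_in_def by blast
    qed
  qed
qed

end

subsection \<open>Linking one edge\<close>

lemma (in local_closure) contract_mono: "S \<subseteq> T \<Longrightarrow> contract cl S I \<subseteq> contract cl T I"
  unfolding contract_def by (rule mono) blast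

context web_graph begin

lemma prewave_mono:
  assumes "prewave cl X B W Y" "\<And>S. cl S \<subseteq> cl' S" shows "prewave cl' X B W Y"
  using assms unfolding prewave_def by blast

definition edges_in :: "'a set \<Rightarrow> 'b set" where
  "edges_in X = {e\<in>A. src e \<in> X \<and> dst e \<in> X}"

lemma extends_trans: "extends a b \<Longrightarrow> extends b c \<Longrightarrow> extends a c"
  unfolding extends_def by blast

context
  fixes cl X B f
  assumes cl: "local_closure dst cl" and web: "web cl X B" and loose: "loose cl X B" and f: "f \<in> B"
begin

interpretation local_closure dst cl by (rule cl)

text \<open>
  The whole tree \<open>S\<close> is deleted and contracted although only its path from \<open>f\<close> to \<open>t\<close> will
  be used. Wasting the rest is harmless: the spanning condition is already secured by \<open>B\<close>,
  and only the linking of \<open>B\<close> to \<open>t\<close> remains to be done.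
\<close>

definition tree_state :: "'b set \<Rightarrow> 'b list set \<Rightarrow> 'a set \<Rightarrow> bool" where
  "tree_state S W Y \<longleftrightarrow> finite S \<and> f \<in> S \<and> S - {f} \<subseteq> edges_in X \<and> free_in cl S
    \<and> (\<forall>e\<in>S. \<exists>q. walk src dst (dst f) q (dst e) \<and> set q \<subseteq> S - {f})
    \<and> wave (contract cl S) X (B - {f}) W Y \<and> B - {f} \<subseteq> edges W
    \<and> loose (contract cl S) Y (last ` W)"

text \<open>When there is no such edge, all edges from the tree into the rest of \<open>Y\<close>
  are spanned, which is what cutting off the vertices of the tree requires.\<close>

definition candidate :: "'b set \<Rightarrow> 'b list set \<Rightarrow> 'a set \<Rightarrow> 'b \<Rightarrow> bool" where
  "candidate S W Y x \<longleftrightarrow> x \<in> A \<and> src x \<in> dst ` S \<and> dst x \<in> Y - dst ` S \<and> x \<notin> cl (edges W \<union> S)"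

lemma web_sub: "free_in cl' (B - {f}) \<Longrightarrow> web cl' X (B - {f})"
  using web unfolding web_def by blast

text \<open>Using up \<open>f\<close> keeps the web loose: a wave of the smaller web becomes a wave
  of the original one, with the path \<open>[f]\<close> added if \<open>f\<close> enters its
  region.\<close>

lemma tree_state_init: "\<exists>W Y. tree_state {f} W Y"
proof -
  let ?cl = "contract cl {f}" and ?W = "(\<lambda>b. [b]) ` (B - {f})"
  have lc: "local_closure dst ?cl" by (rule contract)
  have B: "B - {f} \<union> {f} = B" using f by blast
  have "free_in ?cl (B - {f})"
    using contract_if_free_Un[of "B - {f}" "{f}"] webD(5)[OF web] B by simp
  then have web': "web ?cl X (B - {f})" by (rule web_sub)
  have "free_in cl {f}" by (rule free_subset[OF webD(5)[OF web]]) (use f in blast)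
  moreover have "edges ?W = B - {f}" "last ` ?W = B - {f}" by (auto simp: image_image)
  moreover have "loose ?cl X (B - {f})"
    unfolding loose_def
  proof (intro allI impI)
    fix W Y assume W: "wave ?cl X (B - {f}) W Y"
    note l = wave_linkage[OF W]
    have fW: "f \<notin> edges W" using free_contract_disjnt[OF wave_free[OF W]] by blast
    have freeW: "free_in cl (edges W \<union> {f})"
      by (rule free_Un_contract[OF \<open>free_in cl {f}\<close> wave_free[OF W]])
    have spans: "e \<in> cl (insert f (edges W))" if "e \<in> inner X Y" "dst e \<in> Y" for e
      using wave_spans[OF W that] by (simp add: contract_def)
    show "Y = X"
    proof (cases "dst f \<in> Y")
      case True
      have "wave cl X B (insert [f] W) Y"
      proof (rule waveI[OF wave_region(2)[OF W] wave_region(1)[OF W]])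
        show "linkage X B Y (insert [f] W)"
        proof (rule linkageI)
          have "set p \<inter> {f} = {}" if "p \<in> W" for p using fW that by blast
          then show "disjoint_trails (insert [f] W)"
            using l unfolding linkage_def disjoint_trails_def by auto
          fix p assume "p \<in> insert [f] W"
          then show "p \<noteq> [] \<and> hd p \<in> B \<and> set (tl p) \<subseteq> inner X Y \<and> dst (last p) \<in> Y
            \<and> walk src dst (dst (hd p)) (tl p) (dst (last p))"
            using linkage_path[OF l, of p] f True by auto
        qed
        show "free_in cl (edges (insert [f] W))" using freeW by simp
        show "[b] \<in> insert [f] W" if "b \<in> B" "dst b \<in> Y" for b
          using wave_start[OF W, of b] that by auto
        show "e \<in> cl (edges (insert [f] W))" if "e \<in> inner X Y" "dst e \<in> Y" for e
          using spans[OF that] by simp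
      qed
      then show ?thesis using loose unfolding loose_def by blast
    next
      case False
      have "wave cl X B W Y"
      proof (rule waveI[OF wave_region(2)[OF W] wave_region(1)[OF W]])
        show "linkage X B Y W"
          using linkage_path[OF l] l by (intro linkageI) (auto simp: linkage_def)
        show "free_in cl (edges W)" using free_contract[OF wave_free[OF W]] .
        show "[b] \<in> W" if "b \<in> B" "dst b \<in> Y" for b
          using wave_start[OF W, of b] that False by auto
        show "e \<in> cl (edges W)" if "e \<in> inner X Y" "dst e \<in> Y" for e
          using spans[OF that] by (rule local_mono) (use that False in auto)
      qed
      then show ?thesis using loose unfolding loose_def by blast
    qed
  qed
  moreover have "walk src dst (dst f) [] (dst f)" by simp
  ultimately have "tree_state {f} ?W X"
    using trivial_wave[OF web'] unfolding tree_state_def by (auto intro!: exI[of _ "[]"])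
  then show ?thesis by blast
qed

lemma tree_state_dst: "tree_state S W Y \<Longrightarrow> dst ` S \<subseteq> X"
  using webD(3)[OF web f] unfolding tree_state_def edges_in_def by blast

text \<open>Since \<open>x\<close> is not spanned, the old wave remains a wave after
  \<open>x\<close> is contracted. A maximal wave of the web in \<open>Y\<close> restores looseness;
  by \<open>loose_contract_full\<close> it uses all last edges of the old wave, so the composition
  still contains \<open>B - {f}\<close>.\<close>

lemma tree_state_step:
  assumes S: "tree_state S W Y" and x: "candidate S W Y x"
  shows "\<exists>W' Y'. tree_state (insert x S) W' Y' \<and> extends (W, Y) (W', Y')"
proof -
  let ?cl1 = "contract cl S" and ?cl2 = "contract cl (insert x S)"
  have lc1: "local_closure dst ?cl1" and lc2: "local_closure dst ?cl2" by (rule contract)+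
  have St: "finite S" "f \<in> S" "S - {f} \<subseteq> edges_in X" "free_in cl S"
    "\<And>e. e \<in> S \<Longrightarrow> \<exists>q. walk src dst (dst f) q (dst e) \<and> set q \<subseteq> S - {f}"
    and W: "wave ?cl1 X (B - {f}) W Y" and full: "B - {f} \<subseteq> edges W"
    and loose1: "loose ?cl1 Y (last ` W)"
    using S unfolding tree_state_def by auto
  have xc: "x \<in> A" "src x \<in> dst ` S" "dst x \<in> Y" "dst x \<notin> dst ` S" "x \<notin> cl (edges W \<union> S)"
    using x unfolding candidate_def by auto
  note l = wave_linkage[OF W]
  have xW: "x \<notin> edges W \<union> S" using xc(5) ext[of "edges W \<union> S"] by blast
  have "free_in cl (edges W \<union> S)" by (rule free_Un_contract[OF St(4) wave_free[OF W]])
  then have "free_in cl (insert x (edges W \<union> S))" using free_insert xc(5) by blast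
  moreover have "insert x (edges W \<union> S) = edges W \<union> insert x S" by blast
  moreover have "edges W \<inter> insert x S = {}"
    using free_contract_disjnt[OF wave_free[OF W]] xW by blast
  ultimately have free2: "free_in ?cl2 (edges W)" using contract_if_free_Un by metis
  have W2: "wave ?cl2 X (B - {f}) W Y"
    using W free2 prewave_mono[of ?cl1 X "B - {f}" W Y ?cl2] contract_mono[of S "insert x S"]
    unfolding wave_def by blast
  have web1: "web ?cl1 X (B - {f})"
    by (rule web_sub, rule local_closure.free_subset[OF lc1 wave_free[OF W] full])
  have web2: "web ?cl2 X (B - {f})"
    by (rule web_sub, rule local_closure.free_subset[OF lc2 free2 full])
  have web1': "web ?cl1 Y (last ` W)" by (rule wave_web[OF lc1 web1 W])
  have web2': "web ?cl2 Y (last ` W)" by (rule wave_web[OF lc2 web2 W2])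
  obtain W1 Y1 where W1: "wave ?cl2 Y (last ` W) W1 Y1" and loose2: "loose ?cl2 Y1 (last ` W1)"
    using maximal_wave[OF lc2 web2'] by blast
  have "contract ?cl1 {x} = ?cl2" by (simp add: contract_contract)
  then have full1: "last ` W \<subseteq> edges W1"
    using loose_contract_full[OF lc1 web1' loose1, of x W1 Y1] W1 by simp
  let ?W' = "compose W W1"
  have W': "wave ?cl2 X (B - {f}) ?W' Y1" "extends (W, Y) (?W', Y1)" "B - {f} \<subseteq> edges ?W'"
    using compose_wave[OF lc2 web2 W2 W1] full full1 by auto
  have last': "last ` ?W' = last ` W1" by (rule compose_last[OF l wave_linkage[OF W1]])
  have "src x \<in> X" "dst x \<in> X"
    using tree_state_dst[OF S] xc(2,3) wave_region(1)[OF W] by blast+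
  then have "x \<in> edges_in X" using xc(1) unfolding edges_in_def by blast
  moreover have "x \<noteq> f" using xW St(2) by blast
  moreover have "free_in cl (insert x S)"
  proof (rule free_insert[OF St(4)])
    show "x \<notin> cl S" using xc(5) mono[of S "edges W \<union> S"] by blast
  qed
  moreover have "\<exists>q. walk src dst (dst f) q (dst e) \<and> set q \<subseteq> insert x S - {f}" if e: "e \<in> insert x S" for e
  proof (cases "e = x")
    case True
    obtain e' q where q: "walk src dst (dst f) q (src x)" "set q \<subseteq> S - {f}"
      using xc(2) St(5) by (metis imageE)
    then have "walk src dst (dst f) (q @ [x]) (dst e)" "set (q @ [x]) \<subseteq> insert x S - {f}"
      using True \<open>x \<noteq> f\<close> by (auto simp: walk_append)
    then show ?thesis by blast
  next
    case False
    then obtain q where "walk src dst (dst f) q (dst e)" "set q \<subseteq> S - {f}" using St(5)[of e] e by blast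
    then show ?thesis by blast
  qed
  ultimately have "tree_state (insert x S) ?W' Y1"
    using St(1-3) W'(1,3) last' loose2 unfolding tree_state_def by auto
  then show ?thesis using W'(2) by blast
qed

text \<open>If no edge leaves the tree, its vertices can be cut off together with the region of the wave.\<close>

lemma candidate_exists:
  assumes W: "prewave (contract cl S) X (B - {f}) W Y" and free: "free_in cl (edges W)"
    and S: "f \<in> S" "dst ` S \<subseteq> X" "t \<notin> dst ` S"
  shows "\<exists>x. candidate S W Y x"
proof (rule ccontr)
  assume no: "\<nexists>x. candidate S W Y x"
  define Z where "Z = Y - dst ` S"
  define W' where "W' = {p\<in>W. dst (last p) \<in> Z}"
  have l: "linkage X (B - {f}) Y W" and Y: "t \<in> Y" "Y \<subseteq> X"
    and starts: "\<And>b. b \<in> B - {f} \<Longrightarrow> dst b \<in> Y \<Longrightarrow> [b] \<in> W"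
    and spans: "\<And>e. e \<in> inner X Y \<Longrightarrow> dst e \<in> Y \<Longrightarrow> e \<in> cl (edges W \<union> S)"
    using W unfolding prewave_def contract_def by auto
  have "wave cl X B W' Z"
  proof (rule waveI)
    show "t \<in> Z" "Z \<subseteq> X" using Y S(3) unfolding Z_def by blast+
    show "linkage X B Z W'"
    proof (rule linkageI)
      show "disjoint_trails W'" using l unfolding W'_def linkage_def disjoint_trails_def by blast
      fix p assume "p \<in> W'"
      then have p: "p \<in> W" "dst (last p) \<in> Z" unfolding W'_def by auto
      have "inner X Y \<subseteq> inner X Z" by (rule inner_mono) (use Y in \<open>auto simp: Z_def\<close>)
      then show "p \<noteq> [] \<and> hd p \<in> B \<and> set (tl p) \<subseteq> inner X Z \<and> dst (last p) \<in> Z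
        \<and> walk src dst (dst (hd p)) (tl p) (dst (last p))"
        using linkage_path[OF l p(1)] p(2) by blast
    qed
    show "free_in cl (edges W')" by (rule free_subset[OF free]) (auto simp: W'_def)
    show "[b] \<in> W'" if "b \<in> B" "dst b \<in> Z" for b
      using starts[of b] that S(1) unfolding W'_def Z_def by auto
    fix e assume e: "e \<in> inner X Z" "dst e \<in> Z"
    have "e \<in> cl (edges W \<union> S)"
    proof (cases "src e \<in> Y")
      case True
      then have "src e \<in> dst ` S" using e(1) unfolding inner_def Z_def by blast
      moreover have "e \<in> A" using e(1) unfolding inner_def by blast
      ultimately show ?thesis using no e(2) unfolding candidate_def Z_def by blast
    next
      case False
      then show ?thesis using spans e unfolding inner_def Z_def by blast
    qed
    \<comment> \<open>Tree edges have their heads outside \<open>Z\<close>, so locality removes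
      \<open>S\<close> from the spanning set; the edges of \<open>W\<close> at this head are last
      edges of paths that are kept.\<close>
    then show "e \<in> cl (edges W')"
    proof (rule local_mono)
      fix g assume g: "g \<in> edges W \<union> S" "dst g = dst e"
      have "dst g \<in> Z" using g(2) e(2) by simp
      then have "g \<notin> S" unfolding Z_def by blast
      then obtain p where p: "p \<in> W" "g \<in> set p" using g(1) by blast
      have "dst g \<in> Y" using g(2) e(2) unfolding Z_def by auto
      then have "g = last p" by (rule linkage_last[OF l p])
      then have "p \<in> W'" using p(1) g(2) e(2) unfolding W'_def by simp
      then show "g \<in> edges W'" using p(2) by blast
    qed
  qed
  \<comment> \<open>But \<open>Z\<close> omits the head of \<open>f\<close>, which lies in
    \<open>X\<close>.\<close>
  then have "Z = X" using loose unfolding loose_def by blast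
  then show False using S(1) webD(3)[OF web f] unfolding Z_def by blast
qed

text \<open>Always taking the candidate of least index is a fair strategy. The limit of the
  construction has a candidate \<open>y\<close>, which was a candidate at all late stages; then
  infinitely many distinct edges of index at most that of \<open>y\<close> were chosen
  instead.\<close>

lemma tree_state_reaches:
  assumes "countable A"
  shows "\<exists>S W Y. tree_state S W Y \<and> t \<in> dst ` S"
proof (rule ccontr)
  assume no: "\<nexists>S W Y. tree_state S W Y \<and> t \<in> dst ` S"
  define ix where "ix = to_nat_on A"
  have inj_ix: "inj_on ix A" using assms unfolding ix_def by (rule inj_on_to_nat_on)
  define good where "good \<sigma> \<longleftrightarrow> tree_state (fst \<sigma>) (fst (snd \<sigma>)) (snd (snd \<sigma>))" for \<sigma>
  define cand where "cand \<sigma> x \<longleftrightarrow> candidate (fst \<sigma>) (fst (snd \<sigma>)) (snd (snd \<sigma>)) x" for \<sigma> x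
  define next_state where "next_state \<sigma> \<tau> \<longleftrightarrow> extends (snd \<sigma>) (snd \<tau>)
    \<and> (\<exists>x. cand \<sigma> x \<and> fst \<tau> = insert x (fst \<sigma>) \<and> (\<forall>y. cand \<sigma> y \<longrightarrow> ix x \<le> ix y))" for \<sigma> \<tau>
  have wave_good: "wave (contract cl (fst \<sigma>)) X (B - {f}) (fst (snd \<sigma>)) (snd (snd \<sigma>))"
    "f \<in> fst \<sigma>" if "good \<sigma>" for \<sigma>
    using that unfolding good_def tree_state_def by auto
  have "\<exists>\<tau>. good \<tau> \<and> next_state \<sigma> \<tau>" if "good \<sigma>" for \<sigma>
  proof -
    obtain S W Y where \<sigma>: "\<sigma> = (S, W, Y)" by (cases \<sigma>) auto
    then have S: "tree_state S W Y" using that unfolding good_def by simp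
    have "\<exists>x. candidate S W Y x"
    proof (rule candidate_exists)
      show "prewave (contract cl S) X (B - {f}) W Y" "free_in cl (edges W)" "f \<in> S"
        using S free_contract unfolding tree_state_def wave_def by blast+
      show "dst ` S \<subseteq> X" "t \<notin> dst ` S" using S tree_state_dst no by blast+
    qed
    then obtain x where x: "candidate S W Y x" "\<And>y. candidate S W Y y \<Longrightarrow> ix x \<le> ix y"
      using ex_has_least_nat[of "candidate S W Y" _ ix] by blast
    obtain W' Y' where "tree_state (insert x S) W' Y'" "extends (W, Y) (W', Y')"
      using tree_state_step[OF S x(1)] by blast
    then have "good (insert x S, W', Y') \<and> next_state \<sigma> (insert x S, W', Y')"
      using x unfolding good_def next_state_def cand_def \<sigma> by auto
    then show ?thesis by blast
  qed
  moreover have "\<exists>\<sigma>. good \<sigma>" using tree_state_init unfolding good_def by auto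
  ultimately obtain \<sigma> where good: "\<And>n. good (\<sigma> n)" and nxt: "\<And>n. next_state (\<sigma> n) (\<sigma> (Suc n))"
    using dependent_nat_choice[of "\<lambda>_. good" "\<lambda>_. next_state"] by blast
  define S where "S n = fst (\<sigma> n)" for n
  define c where "c n = snd (\<sigma> n)" for n
  obtain x where x: "\<And>n. cand (\<sigma> n) (x n)" "\<And>n. S (Suc n) = insert (x n) (S n)"
    "\<And>n y. cand (\<sigma> n) y \<Longrightarrow> ix (x n) \<le> ix y"
    using nxt unfolding next_state_def S_def by metis
  have Smono: "S m \<subseteq> S n" if "m \<le> n" for m n
    using that by (rule lift_Suc_mono_le[rotated]) (simp add: x(2) subset_insertI)
  have ext_c: "extends (c m) (c n)" if "m \<le> n" for m n
    using that
  proof (induction n rule: dec_induct)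
    case base
    then show ?case unfolding extends_def by simp
  next
    case (step n)
    then show ?case using extends_trans nxt[of n] unfolding next_state_def c_def by blast
  qed
  define \<C> where "\<C> = range c"
  have total: "extends a b \<or> extends b a" if ab: "a \<in> \<C>" "b \<in> \<C>" for a b
  proof -
    obtain m n where "a = c m" "b = c n" using ab unfolding \<C>_def by blast
    then show ?thesis using ext_c[of m n] ext_c[of n m] nat_le_linear by blast
  qed
  have waves: "wave (contract cl (S n)) X (B - {f}) (fst (c n)) (snd (c n))" for n
    using wave_good[OF good] unfolding S_def c_def by blast
  have link: "snd a \<subseteq> X \<and> t \<in> snd a \<and> linkage X (B - {f}) (snd a) (fst a)" if "a \<in> \<C>" for a
    using that waves wave_region wave_linkage unfolding \<C>_def by blast
  have ne: "\<C> \<noteq> {}" unfolding \<C>_def by blast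
  define T where "T = (\<Union>n. S n)"
  let ?W = "lim_paths \<C>" and ?Y = "lim_region \<C>"
  have "\<exists>y. candidate T ?W ?Y y"
  proof (rule candidate_exists)
    show "prewave (contract cl T) X (B - {f}) ?W ?Y"
    proof (rule lim_prewave[OF total ne link contract])
      fix a assume "a \<in> \<C>"
      then obtain n where n: "a = c n" unfolding \<C>_def by blast
      \<comment> \<open>Enlarging the contracted set to \<open>T\<close> preserves prewaves and
        brings all stages under one closure.\<close>
      have "S n \<subseteq> T" unfolding T_def by blast
      then show "prewave (contract cl T) X (B - {f}) (fst a) (snd a)"
        using waves[of n] prewave_mono[of "contract cl (S n)" X "B - {f}" "fst a" "snd a" "contract cl T"]
          contract_mono[of "S n" T] unfolding wave_def n by blast
    qed
    \<comment> \<open>The wave that is to be cut off lives in the original web, so freeness refers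
      to \<open>cl\<close>, not to the contraction of \<open>T\<close>.\<close>
    show "free_in cl (edges ?W)"
    proof (rule lim_free[OF total ne link cl])
      fix a assume "a \<in> \<C>"
      then obtain n where n: "a = c n" unfolding \<C>_def by blast
      show "free_in cl (edges (fst a))" using free_contract[OF wave_free[OF waves[of n]]] n by simp
    qed
    have "f \<in> S 0" using wave_good(2)[OF good] unfolding S_def by blast
    then show "f \<in> T" unfolding T_def by blast
    have "dst ` S n \<subseteq> X" "t \<notin> dst ` S n" for n
      using good[of n] tree_state_dst no unfolding good_def S_def by blast+
    then show "dst ` T \<subseteq> X" "t \<notin> dst ` T" unfolding T_def by blast+
  qed
  then obtain y where y: "candidate T ?W ?Y y" by blast
  then have yT: "y \<in> A" "src y \<in> dst ` T" "dst y \<in> ?Y" "dst y \<notin> dst ` T" "y \<notin> cl (edges ?W \<union> T)"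
    unfolding candidate_def by auto
  obtain n0 where n0: "src y \<in> dst ` S n0" using yT(2) unfolding T_def by blast
  have bound: "ix (x n) \<le> ix y" if "n0 \<le> n" for n
  proof (rule x(3))
    \<comment> \<open>The head of \<open>y\<close> lies in the limit region, so the wave edges of
      stage \<open>n\<close> at this head are still present in the limit.\<close>
    have "y \<notin> cl (edges (fst (c n)) \<union> S n)"
    proof
      assume "y \<in> cl (edges (fst (c n)) \<union> S n)"
      then have "y \<in> cl (edges ?W \<union> T)"
      proof (rule local_mono)
        fix g assume g: "g \<in> edges (fst (c n)) \<union> S n" "dst g = dst y"
        show "g \<in> edges ?W \<union> T"
        proof (cases "g \<in> S n")
          case True
          then show ?thesis unfolding T_def by blast
        next
          case False
          have "c n \<in> \<C>" unfolding \<C>_def by blast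
          from lim_edges[OF total ne link this, of g] show ?thesis using False g yT(3) by auto
        qed
      qed
      then show False using yT(5) by blast
    qed
    moreover have "src y \<in> dst ` S n" using n0 Smono[OF that] by blast
    moreover have "dst y \<in> snd (c n) - dst ` S n"
      using yT(3,4) unfolding lim_region_def \<C>_def T_def by blast
    ultimately show "cand (\<sigma> n) y" using yT(1) unfolding cand_def candidate_def S_def c_def by blast
  qed
  \<comment> \<open>Every chosen edge brings a new head into the tree and is therefore never chosen
    again.\<close>
  have "inj x"
  proof (rule linorder_injI)
    fix m n :: nat assume "m < n"
    then have "x m \<in> S n" using Smono[of "Suc m" n] x(2)[of m] by auto
    moreover have "dst (x n) \<notin> dst ` S n" using x(1)[of n] unfolding cand_def candidate_def S_def by blast
    ultimately show "x m \<noteq> x n" by auto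
  qed
  moreover have "range x \<subseteq> A" using x(1) unfolding cand_def candidate_def by blast
  ultimately have "inj (ix \<circ> x)" using inj_ix by (meson comp_inj_on inj_on_subset)
  then have "infinite ((ix \<circ> x) ` {n0..})" by (meson finite_imageD inf_le1 infinite_Ici inj_on_subset subset_UNIV)
  moreover have "(ix \<circ> x) ` {n0..} \<subseteq> {..ix y}" using bound by auto
  ultimately show False using finite_subset by blast
qed

end
end

subsection \<open>Linking all edges\<close>

lemma free_in_antimono: "free_in cl' I \<Longrightarrow> (\<And>S. cl S \<subseteq> cl' S) \<Longrightarrow> free_in cl I"
  unfolding free_in_def by blast

context web_graph begin

text \<open>By locality, contracted edges with heads outside \<open>Y\<close> do not influence spans
  inside \<open>Y\<close>.\<close>

lemma loose_contract_superset:
  assumes cl: "local_closure dst cl" and loose: "loose (contract cl S) Y B"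
    and T: "S \<subseteq> T" "\<And>g. g \<in> T \<Longrightarrow> dst g \<in> Y \<Longrightarrow> g \<in> S"
  shows "loose (contract cl T) Y B"
  unfolding loose_def
proof (intro allI impI)
  fix W Z assume W: "wave (contract cl T) Y B W Z"
  have "wave (contract cl S) Y B W Z"
  proof (rule waveI[OF wave_region(2)[OF W] wave_region(1)[OF W] wave_linkage[OF W]])
    show "free_in (contract cl S) (edges W)"
      by (rule free_in_antimono[OF wave_free[OF W] local_closure.contract_mono[OF cl T(1)]])
    show "[b] \<in> W" if "b \<in> B" "dst b \<in> Z" for b by (rule wave_start[OF W that])
    fix e assume e: "e \<in> inner Y Z" "dst e \<in> Z"
    have "e \<in> cl (edges W \<union> T)" using wave_spans[OF W e] by (simp add: contract_def)
    then have "e \<in> cl (edges W \<union> S)"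
    proof (rule local_closure.local_mono[OF cl])
      fix g assume "g \<in> edges W \<union> T" "dst g = dst e"
      then show "g \<in> edges W \<union> S" using T(2)[of g] e(2) wave_region(1)[OF W] by auto
    qed
    then show "e \<in> contract cl S (edges W)" by (simp add: contract_def)
  qed
  then show "Z = Y" using loose unfolding loose_def by blast
qed

definition linking_path :: "'a set \<Rightarrow> 'b set \<Rightarrow> 'b list \<Rightarrow> bool" where
  "linking_path X B p \<longleftrightarrow>
    (\<exists>b q. p = b # q \<and> b \<in> B \<and> set q \<subseteq> edges_in X \<and> walk src dst (dst b) q t)"

context
  fixes cl X B
  assumes cl: "local_closure dst cl" and web: "web cl X B" and countable_A: "countable A"
begin

interpretation local_closure dst cl by (rule cl)

text \<open>\<open>T\<close> collects all edges used so far, including the wasted ones. The wave is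
  kept as a wave of all of \<open>X\<close>, so that every edge of \<open>B\<close> still to be
  linked has a path of \<open>W\<close> into the loose web in \<open>Y\<close>.\<close>

definition link_state :: "'b list set \<Rightarrow> 'b set \<Rightarrow> 'b list set \<Rightarrow> 'a set \<Rightarrow> bool" where
  "link_state P T W Y \<longleftrightarrow> (\<forall>p\<in>P. linking_path X B p)
    \<and> (\<forall>p\<in>P. \<forall>q\<in>P. p \<noteq> q \<longrightarrow> set p \<inter> set q = {}) \<and> edges P \<subseteq> T \<and> free_in cl T
    \<and> wave (contract cl T) X (B - hd ` P) W Y \<and> B - hd ` P \<subseteq> edges W
    \<and> loose (contract cl T) Y (last ` W)"

text \<open>The path of \<open>W\<close> from \<open>b\<close> ends with an edge \<open>f\<close>
  entering the loose web in \<open>Y\<close>, and a tree from \<open>f\<close> continues it to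
  \<open>t\<close>. Path and tree are then used up, and the rest of \<open>W\<close> is composed
  with the wave that belongs to the tree.\<close>

lemma link_state_step:
  assumes st: "link_state P T W Y" and b: "b \<in> B - hd ` P"
  shows "\<exists>P' T' W' Y'. link_state P' T' W' Y' \<and> P \<subseteq> P' \<and> b \<in> hd ` P'"
proof -
  let ?B = "B - hd ` P" and ?clT = "contract cl T"
  have P: "\<And>p. p \<in> P \<Longrightarrow> linking_path X B p" "\<And>p q. p \<in> P \<Longrightarrow> q \<in> P \<Longrightarrow> p \<noteq> q \<Longrightarrow> set p \<inter> set q = {}"
    "edges P \<subseteq> T" and freeT: "free_in cl T" and W: "wave ?clT X ?B W Y" and full: "?B \<subseteq> edges W"
    and looseT: "loose ?clT Y (last ` W)"
    using st unfolding link_state_def by auto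
  have lcT: "local_closure dst ?clT" by (rule contract)
  have web_sub: "web cl' X B'" if "free_in cl' B'" "B' \<subseteq> B" for cl' B'
    using web that unfolding web_def by blast
  have webT: "web ?clT X ?B"
    by (rule web_sub[OF local_closure.free_subset[OF lcT wave_free[OF W] full]]) blast
  have webY: "web ?clT Y (last ` W)" by (rule wave_web[OF lcT webT W])
  note l = wave_linkage[OF W] and YX = wave_region(1)[OF W]
  obtain p where p: "p \<in> W" "b \<in> set p" using full b by blast
  have hdp: "b = hd p" using linkage_source[OF l p] webD(4)[OF web] b by blast
  define f where "f = last p"
  note pp = linkage_path[OF l p(1)]
  have fW: "f \<in> last ` W" and fp: "f \<in> set p" using p(1) pp(1) unfolding f_def by auto
  have dfY: "dst f \<in> Y" using pp(4) unfolding f_def .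
  obtain S W2 Y2 where tree: "tree_state ?clT Y (last ` W) f S W2 Y2" and tS: "t \<in> dst ` S"
    using tree_state_reaches[OF lcT webY looseT fW countable_A] by blast
  have S: "f \<in> S" "S - {f} \<subseteq> edges_in Y" "free_in ?clT S"
    "\<And>e. e \<in> S \<Longrightarrow> \<exists>q. walk src dst (dst f) q (dst e) \<and> set q \<subseteq> S - {f}"
    and W2: "wave (contract ?clT S) Y (last ` W - {f}) W2 Y2" and full2: "last ` W - {f} \<subseteq> edges W2"
    and loose2: "loose (contract ?clT S) Y2 (last ` W2)"
    using tree unfolding tree_state_def[OF lcT webY looseT fW] by auto
  obtain q where q: "walk src dst (dst f) q t" "set q \<subseteq> S - {f}" using tS S(4) by blast
  define T' where "T' = T \<union> S \<union> set p"
  define P' where "P' = insert (p @ q) P"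
  define W0 where "W0 = W - {p}"
  let ?cl' = "contract cl T'"
  have lc': "local_closure dst ?cl'" by (rule contract)
  have SY: "dst g \<in> Y" if "g \<in> S" for g using S(2) that dfY unfolding edges_in_def by blast
  have W2Y: "dst g \<in> Y" if g: "g \<in> edges W2" for g
  proof -
    obtain r where r: "r \<in> W2" "g \<in> set r" using g by blast
    have "g \<in> last ` W \<or> g \<in> inner Y Y2"
      using linkage_edge[OF wave_linkage[OF W2] r] linkage_path(2)[OF wave_linkage[OF W2] r(1)] by auto
    then show ?thesis using webD(3)[OF webY] unfolding inner_def by blast
  qed
  have clS: "contract ?clT S = contract cl (T \<union> S)" by (rule contract_contract)
  have freeW: "free_in cl (edges W \<union> T)" by (rule free_Un_contract[OF freeT wave_free[OF W]])
  have "free_in ?clT (edges W2 \<union> S)"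
    by (rule local_closure.free_Un_contract[OF lcT S(3) wave_free[OF W2]])
  then have freeW2: "free_in cl (edges W2 \<union> S \<union> T)" by (rule free_Un_contract[OF freeT])
  \<comment> \<open>At heads in \<open>Y\<close> the edges of \<open>W\<close> are last edges, hence
    in \<open>W2\<close> or equal to \<open>f\<close>, which is in \<open>S\<close>; at other heads
    only edges of \<open>W\<close> and \<open>T\<close> occur.\<close>
  have free_all: "free_in cl (edges W \<union> edges W2 \<union> S \<union> T)"
  proof (rule free_local)
    fix v
    show "free_in cl {g \<in> edges W \<union> edges W2 \<union> S \<union> T. dst g = v}"
    proof (cases "v \<in> Y")
      case True
      have "g \<in> edges W2 \<union> S" if "g \<in> edges W" "dst g = v" for g
        using linkage_cut[OF l that(1)] that(2) True full2 S(1) by blast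
      then have "{g \<in> edges W \<union> edges W2 \<union> S \<union> T. dst g = v} \<subseteq> edges W2 \<union> S \<union> T" by blast
      then show ?thesis by (rule free_subset[OF freeW2])
    next
      case False
      then have "{g \<in> edges W \<union> edges W2 \<union> S \<union> T. dst g = v} \<subseteq> edges W \<union> T"
        using SY W2Y by blast
      then show ?thesis by (rule free_subset[OF freeW])
    qed
  qed
  have WT: "edges W \<inter> T = {}" by (rule free_contract_disjnt[OF wave_free[OF W]])
  have ST: "S \<inter> T = {}" by (rule free_contract_disjnt[OF S(3)])
  have W2ST: "edges W2 \<inter> (T \<union> S) = {}"
    using free_contract_disjnt[OF wave_free[OF W2, unfolded clS]] .
  have W0p: "set r \<inter> set p = {}" if "r \<in> W0" for r
    using that linkage_disjoint[OF l, of r p] p(1) unfolding W0_def by blast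
  have pY: "g = f" if "g \<in> set p" "dst g \<in> Y" for g
    using linkage_last[OF l p(1) that] unfolding f_def .
  have last0: "last ` W0 = last ` W - {f}"
  proof -
    have "last r \<noteq> f" if "r \<in> W0" for r
      using W0p[OF that] fp linkage_path(1)[OF l, of r] that unfolding W0_def by (metis DiffD1 disjoint_iff last_in_set)
    then show ?thesis unfolding W0_def f_def by auto
  qed
  have hdP': "B - hd ` P' = ?B - {b}" using hdp pp(1) unfolding P'_def by auto
  have full0: "B - hd ` P' \<subseteq> edges W0"
  proof
    fix c assume c: "c \<in> B - hd ` P'"
    then obtain r where r: "r \<in> W" "c \<in> set r" using full hdP' by blast
    have "c = hd r" using linkage_source[OF l r] webD(4)[OF web] c by blast
    then have "r \<noteq> p" using c hdP' hdp by auto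
    then show "c \<in> edges W0" using r unfolding W0_def by blast
  qed
  have l0: "linkage X (B - hd ` P') Y W0"
  proof (rule linkageI)
    show "disjoint_trails W0" using l unfolding W0_def linkage_def disjoint_trails_def by blast
    fix r assume r: "r \<in> W0"
    then have rW: "r \<in> W" unfolding W0_def by blast
    have "hd r \<noteq> b" using W0p[OF r] p(2) linkage_path(1)[OF l rW] by (metis disjoint_iff hd_in_set)
    then show "r \<noteq> [] \<and> hd r \<in> B - hd ` P' \<and> set (tl r) \<subseteq> inner X Y \<and> dst (last r) \<in> Y
      \<and> walk src dst (dst (hd r)) (tl r) (dst (last r))"
      using linkage_path[OF l rW] unfolding hdP' by blast
  qed
  have free_sub: "free_in ?cl' (edges V)"
    if "edges V \<subseteq> edges W \<union> edges W2" "edges V \<inter> T' = {}" for V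
  proof (rule contract_if_free_Un[OF _ that(2)])
    show "free_in cl (edges V \<union> T')"
      by (rule free_subset[OF free_all]) (use that(1) p(1) in \<open>auto simp: T'_def\<close>)
  qed
  have W0: "wave ?cl' X (B - hd ` P') W0 Y"
  proof (rule waveI[OF wave_region(2)[OF W] YX l0])
    show "free_in ?cl' (edges W0)"
    proof (rule free_sub)
      show "edges W0 \<subseteq> edges W \<union> edges W2" unfolding W0_def by blast
      \<comment> \<open>An edge of \<open>W0\<close> in \<open>S\<close> would be a last edge other
        than \<open>f\<close>, hence in \<open>W2\<close>, which avoids \<open>S\<close>.\<close>
      have "g \<notin> S" if g: "g \<in> edges W0" for g
      proof
        assume "g \<in> S"
        then have "g \<in> last ` W0" using linkage_cut[OF l0 g] SY by blast
        then have "g \<in> edges W2" using full2 unfolding last0 by (rule subsetD[rotated])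
        then show False using W2ST \<open>g \<in> S\<close> by blast
      qed
      moreover have "g \<notin> T \<and> g \<notin> set p" if g: "g \<in> edges W0" for g
        using W0p WT g unfolding W0_def by blast
      ultimately show "edges W0 \<inter> T' = {}" unfolding T'_def by blast
    qed
    show "[c] \<in> W0" if "c \<in> B - hd ` P'" "dst c \<in> Y" for c
      using wave_start[OF W, of c] that hdp unfolding W0_def hdP' by auto
    fix e assume e: "e \<in> inner X Y" "dst e \<in> Y"
    have "e \<in> cl (edges W \<union> T)" using wave_spans[OF W e] by (simp add: contract_def)
    moreover have "edges W \<union> T \<subseteq> edges W0 \<union> T'" unfolding W0_def T'_def by blast
    ultimately have "e \<in> cl (edges W0 \<union> T')" using mono by blast
    then show "e \<in> ?cl' (edges W0)" by (simp add: contract_def)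
  qed
  have W2': "wave ?cl' Y (last ` W0) W2 Y2"
    unfolding wave_def
  proof
    have "contract cl (T \<union> S) I \<subseteq> ?cl' I" for I by (rule contract_mono) (auto simp: T'_def)
    then show "prewave ?cl' Y (last ` W0) W2 Y2"
      using W2 prewave_mono[of "contract cl (T \<union> S)"] unfolding wave_def last0 clS by blast
    show "free_in ?cl' (edges W2)"
    proof (rule free_sub)
      have "g \<notin> set p" if "g \<in> edges W2" for g
        using pY[of g] W2Y[OF that] that S(1) W2ST by blast
      then show "edges W2 \<inter> T' = {}" using W2ST unfolding T'_def by blast
    qed blast
  qed
  have web0: "web ?cl' X (B - hd ` P')"
    by (rule web_sub[OF local_closure.free_subset[OF lc' wave_free[OF W0] full0]]) blast
  note comp = compose_wave[OF lc' web0 W0 W2']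
  have last': "last ` compose W0 W2 = last ` W2" by (rule compose_last[OF l0 wave_linkage[OF W2']])
  \<comment> \<open>The path \<open>p\<close> is contracted in addition, but its only edge with head
    in \<open>Y\<close> is \<open>f\<close>, already in \<open>S\<close>.\<close>
  have "loose ?cl' Y2 (last ` W2)"
  proof (rule loose_contract_superset[OF cl loose2[unfolded clS]])
    show "g \<in> T \<union> S" if "g \<in> T'" "dst g \<in> Y2" for g
      using that pY[of g] S(1) wave_region(1)[OF W2] unfolding T'_def by blast
  qed (auto simp: T'_def)
  moreover have "linking_path X B (p @ q)"
  proof -
    obtain p' where p': "p = b # p'" using pp(1) hdp by (cases p) auto
    have "set p' \<subseteq> edges_in X" using pp(3) p' unfolding inner_def edges_in_def by auto
    moreover have "set q \<subseteq> edges_in X" using q(2) S(2) YX unfolding edges_in_def by blast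
    moreover have "walk src dst (dst b) (p' @ q) t"
      using pp(6) q(1) p' unfolding walk_append f_def by auto
    ultimately show ?thesis using b p' unfolding linking_path_def by auto
  qed
  moreover have "set (p @ q) \<inter> set r = {}" if "r \<in> P" for r
  proof -
    have "set r \<subseteq> T" using P(3) that by blast
    then show ?thesis using WT ST p(1) q(2) by auto
  qed
  moreover have "edges P' \<subseteq> T'" using P(3) q(2) unfolding P'_def T'_def by auto
  moreover have "free_in cl T'" by (rule free_subset[OF free_all]) (use p(1) in \<open>auto simp: T'_def\<close>)
  ultimately have "link_state P' T' (compose W0 W2) Y2"
    using P(1,2) comp(1) comp(3)[OF full0] last0 full2 last'
    unfolding link_state_def P'_def by (auto simp: Int_commute)
  moreover have "b \<in> hd ` P'" using hdp pp(1) unfolding P'_def by auto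
  ultimately show ?thesis unfolding P'_def by blast
qed

text \<open>The edges of \<open>B\<close> are linked along an enumeration. Finished paths are never
  revised, so their union is the required system, and it is free by finitariness.\<close>

lemma loose_linked:
  assumes loose: "loose cl X B"
  shows "\<exists>P. (\<forall>p\<in>P. linking_path X B p) \<and> (\<forall>p\<in>P. \<forall>q\<in>P. p \<noteq> q \<longrightarrow> set p \<inter> set q = {})
    \<and> B \<subseteq> hd ` P \<and> free_in cl (edges P)"
proof (cases "B = {}")
  case True
  then show ?thesis unfolding free_in_def by (intro exI[of _ "{}"]) auto
next
  case False
  have "countable B" using countable_subset[OF webD(2)[OF web] countable_A] .
  then have enum: "range (from_nat_into B) = B" using False by (rule range_from_nat_into[rotated])
  define inv where "inv \<sigma> \<longleftrightarrow> (\<exists>T W Y. link_state \<sigma> T W Y)" for \<sigma>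
  have "contract cl {} = cl" unfolding contract_def by simp
  then have "link_state {} {} ((\<lambda>b. [b]) ` B) X"
    using trivial_wave[OF web] loose unfolding link_state_def by (auto simp: free_in_def image_image)
  then have "\<exists>\<sigma>. inv \<sigma>" unfolding inv_def by blast
  moreover have "\<exists>\<tau>. inv \<tau> \<and> \<sigma> \<subseteq> \<tau> \<and> from_nat_into B n \<in> hd ` \<tau>" if "inv \<sigma>" for \<sigma> n
  \<comment> \<open>The enumeration repeats elements when \<open>B\<close> is finite, so an edge may
    turn out to be linked already.\<close>
  proof (cases "from_nat_into B n \<in> hd ` \<sigma>")
    case True
    then show ?thesis using that by blast
  next
    case False
    then have "from_nat_into B n \<in> B - hd ` \<sigma>" using enum by blast
    then show ?thesis using that link_state_step unfolding inv_def by meson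
  qed
  ultimately obtain Q where inv: "\<And>n. inv (Q n)" and Q: "\<And>n. Q n \<subseteq> Q (Suc n)"
    "\<And>n. from_nat_into B n \<in> hd ` Q (Suc n)"
    using dependent_nat_choice[of "\<lambda>_. inv" "\<lambda>n \<sigma> \<tau>. \<sigma> \<subseteq> \<tau> \<and> from_nat_into B n \<in> hd ` \<tau>"] by blast
  have mono_Q: "Q m \<subseteq> Q n" if "m \<le> n" for m n using that Q(1) by (rule lift_Suc_mono_le[rotated])
  have Qn: "\<And>p. p \<in> Q n \<Longrightarrow> linking_path X B p"
    "\<And>p q. p \<in> Q n \<Longrightarrow> q \<in> Q n \<Longrightarrow> p \<noteq> q \<Longrightarrow> set p \<inter> set q = {}" "free_in cl (edges (Q n))" for n
  proof -
    obtain T W Y where st: "link_state (Q n) T W Y" using inv[of n] unfolding inv_def by blast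
    then show "\<And>p. p \<in> Q n \<Longrightarrow> linking_path X B p"
      "\<And>p q. p \<in> Q n \<Longrightarrow> q \<in> Q n \<Longrightarrow> p \<noteq> q \<Longrightarrow> set p \<inter> set q = {}"
      unfolding link_state_def by blast+
    have "free_in cl T" "edges (Q n) \<subseteq> T" using st unfolding link_state_def by blast+
    then show "free_in cl (edges (Q n))" by (rule free_subset)
  qed
  let ?P = "\<Union>n. Q n"
  have "free_in cl (edges ?P)"
  proof (rule free_finitary)
    fix I0 assume I0: "I0 \<subseteq> edges ?P" "finite I0"
    have "\<exists>n. I0 \<subseteq> edges (Q n)"
      using I0(2,1)
    proof (induction I0)
      case (insert e I)
      then obtain n where n: "I \<subseteq> edges (Q n)" by blast
      obtain m where m: "e \<in> edges (Q m)" using insert.prems by blast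
      have up: "edges (Q n) \<subseteq> edges (Q (max m n))" "edges (Q m) \<subseteq> edges (Q (max m n))"
        using mono_Q[of n "max m n"] mono_Q[of m "max m n"] by auto
      have "insert e I \<subseteq> edges (Q (max m n))"
        by (rule insert_subsetI[OF subsetD[OF up(2) m] subset_trans[OF n up(1)]])
      then show ?case by (rule exI)
    qed simp
    then obtain n where "I0 \<subseteq> edges (Q n)" by blast
    then show "free_in cl I0" by (rule free_subset[OF Qn(3)])
  qed
  moreover have "set p \<inter> set q = {}" if pq: "p \<in> ?P" "q \<in> ?P" "p \<noteq> q" for p q
  proof -
    obtain m n where "p \<in> Q m" "q \<in> Q n" using pq by blast
    then have "p \<in> Q (max m n)" "q \<in> Q (max m n)"
      using mono_Q[of m "max m n"] mono_Q[of n "max m n"] by auto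
    then show ?thesis using Qn(2) pq(3) by blast
  qed
  moreover have "B \<subseteq> hd ` ?P"
  proof
    fix b assume "b \<in> B"
    then obtain n where "b = from_nat_into B n" using enum by (metis imageE)
    then show "b \<in> hd ` ?P" using Q(2)[of n] by blast
  qed
  ultimately show ?thesis using Qn(1) by (intro exI[of _ ?P]) blast
qed

end
end

subsection \<open>Digraphs with matroids on the in-arcs\<close>

text \<open>Defined on all sets over the edge type, as \<open>local_closure\<close> requires: an
  element that is not an arc is spanned only by sets containing it.\<close>

definition arc_closure :: "('a, 'b) pre_digraph \<Rightarrow> ('a \<Rightarrow> 'b indep_system) \<Rightarrow> 'b set \<Rightarrow> 'b set" where
  "arc_closure D M S = S \<union> {e \<in> arcs D. e \<in> mspan (M (head D e)) (S \<inter> in_arcs D (head D e))}"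

lemma walk_eq_cas: "walk (tail D) (head D) u p w \<longleftrightarrow> pre_digraph.cas D u p w"
  by (induction p arbitrary: u) (auto simp: pre_digraph.cas.simps)

lemma walk_enters:
  assumes "walk src dst u p w" "u \<notin> Y" "w \<in> Y"
  shows "\<exists>e\<in>set p. src e \<notin> Y \<and> dst e \<in> Y"
  using assms by (induction p arbitrary: u) auto

locale matroidal_digraph = wf_digraph D for D :: "('a, 'b) pre_digraph" +
  fixes M :: "'a \<Rightarrow> 'b indep_system"
  assumes matroids: "v \<in> verts D \<Longrightarrow> matroid (M v)"
    and finitary_matroids: "v \<in> verts D \<Longrightarrow> finitary (M v)"
    and grounds: "v \<in> verts D \<Longrightarrow> ground (M v) = in_arcs D v"
begin

abbreviation arcs_at :: "'b set \<Rightarrow> 'a \<Rightarrow> 'b set" where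
  "arcs_at S v \<equiv> S \<inter> in_arcs D v"

lemma arcs_at_ground: "v \<in> verts D \<Longrightarrow> arcs_at S v \<subseteq> ground (M v)"
  using grounds by blast

lemma arc_closure_at:
  assumes "v \<in> verts D" shows "arcs_at (arc_closure D M S) v = mspan (M v) (arcs_at S v)"
proof -
  interpret matroid "M v" by (rule matroids[OF assms])
  have "arcs_at S v \<subseteq> mspan (M v) (arcs_at S v)" by (rule mspan_extensive[OF arcs_at_ground[OF assms]])
  moreover have "mspan (M v) (arcs_at S v) \<subseteq> in_arcs D v" using mspan_ground grounds[OF assms] by simp
  ultimately show ?thesis unfolding arc_closure_def by auto
qed

lemma arc_closure_iff:
  assumes "e \<in> arcs D"
  shows "e \<in> arc_closure D M S \<longleftrightarrow> e \<in> mspan (M (head D e)) (arcs_at S (head D e))"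
  unfolding arc_closure_at[OF head_in_verts[OF assms], symmetric] using assms by simp

lemma arc_closure_notin: "e \<notin> arcs D \<Longrightarrow> e \<in> arc_closure D M S \<longleftrightarrow> e \<in> S"
  unfolding arc_closure_def by blast

lemma local_closure_arc_closure: "local_closure (head D) (arc_closure D M)"
proof
  fix S S' :: "'b set" and x y e
  show "S \<subseteq> arc_closure D M S" unfolding arc_closure_def by blast
  show mono: "arc_closure D M S \<subseteq> arc_closure D M S'" if "S \<subseteq> S'"
  proof
    fix e assume e: "e \<in> arc_closure D M S"
    show "e \<in> arc_closure D M S'"
    proof (cases "e \<in> arcs D")
      case True
      interpret matroid "M (head D e)" by (rule matroids[OF head_in_verts[OF True]])
      have "arcs_at S (head D e) \<subseteq> arcs_at S' (head D e)" using that by blast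
      then show ?thesis using e mspan_mono unfolding arc_closure_iff[OF True] by blast
    next
      case False
      then show ?thesis using e that by (auto simp: arc_closure_notin)
    qed
  qed
  show "arc_closure D M (arc_closure D M S) \<subseteq> arc_closure D M S"
  proof
    fix e assume e: "e \<in> arc_closure D M (arc_closure D M S)"
    show "e \<in> arc_closure D M S"
    proof (cases "e \<in> arcs D")
      case True
      have v: "head D e \<in> verts D" by (rule head_in_verts[OF True])
      interpret matroid "M (head D e)" by (rule matroids[OF v])
      show ?thesis
        using e mspan_idem[OF arcs_at_ground[OF v, of S]]
        unfolding arc_closure_iff[OF True] arc_closure_at[OF v] by (rule subsetD[rotated])
    next
      case False
      then show ?thesis using e by (simp add: arc_closure_notin)
    qed
  qed
  show "x \<in> arc_closure D M (insert y S)"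
    if y: "y \<in> arc_closure D M (insert x S)" "y \<notin> arc_closure D M S"
  proof (cases "y = x")
    case True
    then show ?thesis unfolding arc_closure_def by blast
  next
    case False
    have "y \<notin> S" using y(2) unfolding arc_closure_def by blast
    then have yA: "y \<in> arcs D" using y(1) False by (metis arc_closure_notin insertE)
    let ?v = "head D y"
    have v: "?v \<in> verts D" by (rule head_in_verts[OF yA])
    interpret matroid "M ?v" by (rule matroids[OF v])
    have "x \<in> in_arcs D ?v"
    proof (rule ccontr)
      assume "x \<notin> in_arcs D ?v"
      then have "arcs_at (insert x S) ?v = arcs_at S ?v" by blast
      then show False using y unfolding arc_closure_iff[OF yA] by simp
    qed
    then have at: "arcs_at (insert x S) ?v = insert x (arcs_at S ?v)" "arcs_at (insert y S) ?v = insert y (arcs_at S ?v)"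
      and xA: "x \<in> arcs D" "head D x = ?v"
      using yA by auto
    have "x \<in> mspan (M ?v) (insert y (arcs_at S ?v))"
      using y at(1) arcs_at_ground[OF v, of "insert x S"] mspan_exchange[of x "arcs_at S ?v" y]
      unfolding arc_closure_iff[OF yA] by simp
    then show ?thesis using xA(2) at(2) unfolding arc_closure_iff[OF xA(1)] by simp
  qed
  show "\<exists>S0\<subseteq>S. finite S0 \<and> e \<in> arc_closure D M S0" if e: "e \<in> arc_closure D M S"
  proof (cases "e \<in> arcs D")
    case True
    have v: "head D e \<in> verts D" by (rule head_in_verts[OF True])
    interpret matroid "M (head D e)" by (rule matroids[OF v])
    obtain S0 where S0: "S0 \<subseteq> arcs_at S (head D e)" "finite S0" "e \<in> mspan (M (head D e)) S0"
      using mspan_finitary[OF finitary_matroids[OF v] arcs_at_ground[OF v]] e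
      unfolding arc_closure_iff[OF True] by blast
    then have "arcs_at S0 (head D e) = S0" by blast
    then have "e \<in> arc_closure D M S0" using S0(3) unfolding arc_closure_iff[OF True] by simp
    then show ?thesis using S0(1,2) by blast
  next
    case False
    then show ?thesis using e by (intro exI[of _ "{e}"]) (simp add: arc_closure_notin)
  qed
  show "e \<in> arc_closure D M {g \<in> S. head D g = head D e}" if e: "e \<in> arc_closure D M S"
  proof (cases "e \<in> arcs D")
    case True
    have "arcs_at {g \<in> S. head D g = head D e} (head D e) = arcs_at S (head D e)" by auto
    then show ?thesis using e unfolding arc_closure_iff[OF True] by simp
  next
    case False
    then show ?thesis using e by (simp add: arc_closure_notin)
  qed
qed

lemma indep_direct_sum_if_free:
  assumes "I \<subseteq> arcs D" "free_in (arc_closure D M) I"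
  shows "indep (direct_sum (verts D) M) I"
proof -
  have "I \<subseteq> (\<Union>v\<in>verts D. ground (M v))"
    using assms(1) grounds by fastforce
  moreover have "indep (M v) (I \<inter> ground (M v))" if v: "v \<in> verts D" for v
  proof -
    interpret matroid "M v" by (rule matroids[OF v])
    show ?thesis
    proof (rule indep_if_no_spanned)
      fix e assume e: "e \<in> I \<inter> ground (M v)"
      then have "e \<in> arcs D" "head D e = v" using grounds[OF v] by auto
      moreover have "e \<notin> arc_closure D M (I - {e})" using assms(2) e unfolding free_in_def by blast
      moreover have "arcs_at (I - {e}) v = I \<inter> ground (M v) - {e}" using grounds[OF v] by blast
      ultimately show "e \<notin> mspan (M v) (I \<inter> ground (M v) - {e})" using arc_closure_iff by metis
    qed blast
  qed
  ultimately show ?thesis unfolding direct_sum_def by simp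
qed

text \<open>Ground sets at distinct vertices are disjoint, so subsets of \<open>C\<close> meet only
  the one at \<open>v\<close>.\<close>

lemma circuit_direct_sum:
  assumes v: "v \<in> verts D" and C: "circuit (M v) C"
  shows "circuit (direct_sum (verts D) M) C"
  unfolding circuit_def
proof (intro conjI allI impI)
  have Cg: "C \<subseteq> ground (M v)" and dep: "\<not> indep (M v) C" using C unfolding circuit_def by auto
  then show "C \<subseteq> ground (direct_sum (verts D) M)" using v unfolding direct_sum_def by auto
  have "C \<inter> ground (M v) = C" using Cg by blast
  then show "\<not> indep (direct_sum (verts D) M) C" using v dep unfolding direct_sum_def by (auto intro!: bexI[of _ v])
  fix C' assume C': "C' \<subset> C"
  have "indep (M u) (C' \<inter> ground (M u))" if u: "u \<in> verts D" for u
  proof (cases "u = v")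
    case True
    then have "C' \<inter> ground (M u) = C'" using C' Cg by blast
    then show ?thesis using C C' True unfolding circuit_def by simp
  next
    case False
    then have "C' \<inter> ground (M u) = {}" using C' Cg grounds[OF u] grounds[OF v] by fastforce
    then show ?thesis using matroid.indep_empty[OF matroids[OF u]] by simp
  qed
  moreover have "C' \<subseteq> (\<Union>v\<in>verts D. ground (M v))" using C' Cg v by blast
  ultimately show "indep (direct_sum (verts D) M) C'" unfolding direct_sum_def by simp
qed

lemma arc_closure_subset_matroid_span:
  assumes e: "e \<in> arcs D" "e \<in> arc_closure D M S" and S: "S \<subseteq> S'"
  shows "e \<in> matroid_span (direct_sum (verts D) M) S'"
proof -
  let ?v = "head D e"
  have v: "?v \<in> verts D" by (rule head_in_verts[OF e(1)])
  have "e \<in> matroid_span (M ?v) (arcs_at S ?v)"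
    using matroid.mspan_subset_matroid_span[OF matroids[OF v] arcs_at_ground[OF v, of S]] e
    unfolding arc_closure_iff[OF e(1)] by blast
  then consider "e \<in> S" | C where "circuit (M ?v) C" "e \<in> C" "C \<subseteq> insert e (arcs_at S ?v)"
    unfolding matroid_span_def by blast
  then show ?thesis
  proof cases
    case 1
    then show ?thesis using S unfolding matroid_span_def by blast
  next
    case 2
    moreover from this have "C \<subseteq> insert e S'" using S by blast
    ultimately show ?thesis using circuit_direct_sum[OF v] unfolding matroid_span_def by blast
  qed
qed

text \<open>The region of a maximal wave serves as \<open>X\<close>. Wave paths are continued by
  links inside the region, so no edge leaves it, and the last edges of the wave span the entering
  cut.\<close>

theorem matroidal_menger:
  assumes countable: "countable (arcs D)" and st: "s \<in> verts D" "t \<in> verts D" "s \<noteq> t"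
  shows "\<exists>P X. path_system D s t P
    \<and> indep (direct_sum (verts D) M) (path_arcs P)
    \<and> t \<in> X \<and> X \<subseteq> verts D - {s}
    \<and> path_arcs P \<inter> out_cut D X = {}
    \<and> in_cut D X \<subseteq> matroid_span (direct_sum (verts D) M) (path_arcs P \<inter> in_cut D X)"
proof -
  let ?cl = "arc_closure D M"
  have cl: "local_closure (head D) ?cl" by (rule local_closure_arc_closure)
  interpret local_closure "head D" ?cl by (rule cl)
  interpret web_graph "arcs D" "tail D" "head D" t .
  define X0 where "X0 = verts D - {s}"
  \<comment> \<open>The starts of a web must be free and have their heads in \<open>X0\<close>.
    Hence loops at \<open>s\<close> are excluded, and a free subset \<open>B\<close> spanning the
    other edges out of \<open>s\<close> is used.\<close>
  define S0 where "S0 = {e \<in> arcs D. tail D e = s \<and> head D e \<noteq> s}"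
  have "free_in ?cl {}" unfolding free_in_def by blast
  from ex_free_spanning[OF this empty_subsetI]
  obtain B where B: "B \<subseteq> S0" "free_in ?cl B" "S0 \<subseteq> ?cl B" .
  have web: "web ?cl X0 B"
    using B st unfolding web_def X0_def S0_def by auto
  obtain W Y where W: "wave ?cl X0 B W Y" and loose: "loose ?cl Y (last ` W)"
    using maximal_wave[OF cl web] by blast
  note l = wave_linkage[OF W]
  have YX: "Y \<subseteq> X0" and tY: "t \<in> Y" using wave_region[OF W] by auto
  have webY: "web ?cl Y (last ` W)" by (rule wave_web[OF cl web W])
  obtain Q where Q: "\<And>p. p \<in> Q \<Longrightarrow> linking_path Y (last ` W) p"
    "\<And>p q. p \<in> Q \<Longrightarrow> q \<in> Q \<Longrightarrow> p \<noteq> q \<Longrightarrow> set p \<inter> set q = {}"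
    "last ` W \<subseteq> hd ` Q" "free_in ?cl (edges Q)"
    using loose_linked[OF cl webY countable loose] by meson
  have Q_path: "p \<noteq> []" "hd p \<in> last ` W" "set (tl p) \<subseteq> edges_in Y"
    "walk (tail D) (head D) (head D (hd p)) (tl p) t" if "p \<in> Q" for p
    using Q(1)[OF that] unfolding linking_path_def by auto
  define R where "R = {w @ tl p | w p. w \<in> W \<and> p \<in> Q \<and> hd p = last w}"
  have RD: "\<exists>w p. r = w @ tl p \<and> w \<in> W \<and> p \<in> Q \<and> hd p = last w" if "r \<in> R" for r
    using that unfolding R_def by blast
  have edge_R: "e \<in> edges W \<and> head D e \<notin> Y \<or> e \<in> last ` W \<or> e \<in> edges_in Y \<and> e \<in> edges Q"
    if e: "e \<in> edges R" for e
  proof -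
    obtain w p where wp: "e \<in> set (w @ tl p)" "w \<in> W" "p \<in> Q" using e RD by blast
    then consider "e \<in> set w" | "e \<in> set (tl p)" by auto
    then show ?thesis
    proof cases
      case 1
      then show ?thesis using wp(2) linkage_cut[OF l, of e] by blast
    next
      case 2
      then have "e \<in> set p" by (cases p) auto
      then show ?thesis using 2 wp(3) Q_path(3)[OF wp(3)] by blast
    qed
  qed
  have last_Q: "e \<in> edges Q" if e: "e \<in> last ` W" for e
  proof -
    obtain p where p: "p \<in> Q" "e = hd p" using Q(3) e by blast
    then have "e \<in> set p" using Q_path(1)[OF p(1)] by simp
    then show ?thesis using p(1) by blast
  qed
  have R_arcs: "edges R \<subseteq> arcs D"
    using edge_R webD(2)[OF webY] linkage_edges(1)[OF web l YX] unfolding edges_in_def by blast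
  have R_walk: "awalk s r t" if r: "r \<in> R" for r
  proof -
    obtain w p where wp: "r = w @ tl p" "w \<in> W" "p \<in> Q" "hd p = last w" using RD[OF r] by blast
    note lw = linkage_path[OF l wp(2)]
    have "tail D (hd w) = s" using lw(2) B(1) unfolding S0_def by blast
    then have "walk (tail D) (head D) s w (head D (last w))" using lw(1,6) by (cases w) auto
    then have "walk (tail D) (head D) s r t"
      using Q_path(4)[OF wp(3)] wp(4) unfolding wp(1) walk_append by auto
    then show ?thesis using R_arcs r st(1) unfolding awalk_def walk_eq_cas by blast
  qed
  have R_disjoint: "set r \<inter> set r' = {}" if r: "r \<in> R" "r' \<in> R" "r \<noteq> r'" for r r'
  proof (rule ccontr)
    assume "set r \<inter> set r' \<noteq> {}"
    then obtain e where e: "e \<in> set r" "e \<in> set r'" by blast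
    obtain w p where wp: "r = w @ tl p" "w \<in> W" "p \<in> Q" "hd p = last w" using RD[OF r(1)] by blast
    obtain w' p' where wp': "r' = w' @ tl p'" "w' \<in> W" "p' \<in> Q" "hd p' = last w'" using RD[OF r(2)] by blast
    have same_p: "p = p'" if "g \<in> set p" "g \<in> set p'" for g using Q(2)[OF wp(3) wp'(3)] that by blast
    have same_w: "w = w'" if "g \<in> set w" "g \<in> set w'" for g
      using linkage_disjoint[OF l wp(2) wp'(2) that] .
    have hds: "hd p \<in> set p" "hd p' \<in> set p'" "last w \<in> set w" "last w' \<in> set w'"
      using Q_path(1)[OF wp(3)] Q_path(1)[OF wp'(3)] linkage_path(1)[OF l wp(2)]
        linkage_path(1)[OF l wp'(2)] by simp_all
    have tls: "g \<in> set p" if "g \<in> set (tl p)" for g and p :: "'b list" using that by (cases p) auto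
    have no: "\<not> (g \<in> set u \<and> g \<in> set (tl v))" if "u \<in> W" "v \<in> Q" for g u v
    proof
      assume g: "g \<in> set u \<and> g \<in> set (tl v)"
      have "tail D g \<in> Y" using g Q_path(3)[OF that(2)] unfolding edges_in_def by blast
      then show False using linkage_edges(2)[OF web l YX, of g] that(1) g by blast
    qed
    \<comment> \<open>Continuations use edges starting in \<open>Y\<close> and wave paths do not, so
      a common edge identifies either the wave paths or the links. The shared edge
      \<open>hd p = last w\<close> then identifies the other pair.\<close>
    have "e \<in> set w \<and> e \<in> set w' \<or> e \<in> set (tl p) \<and> e \<in> set (tl p')"
      using e no[OF wp(2) wp'(3)] no[OF wp'(2) wp(3)] unfolding wp(1) wp'(1) by auto
    then have "w = w' \<or> p = p'" using same_w same_p tls by blast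
    then have "w = w' \<and> p = p'" using same_w same_p hds wp(4) wp'(4) by metis
    then show False using r(3) wp(1) wp'(1) by simp
  qed
  define P where "P = awalk_to_apath ` R"
  have P_sub: "set (awalk_to_apath r) \<subseteq> set r" if "r \<in> R" for r
    by (rule awalk_to_apath_subset[OF R_walk[OF that]])
  have P_apath: "apath s (awalk_to_apath r) t" if "r \<in> R" for r
    by (rule apath_awalk_to_apath[OF R_walk[OF that]])
  have arcs_P: "path_arcs P \<subseteq> edges R" using P_sub unfolding path_arcs_def P_def by blast
  have "path_system D s t P"
    unfolding path_system_def
  proof
    show "\<forall>p\<in>P. apath s p t" using P_apath unfolding P_def by blast
    show "pairwise (\<lambda>p q. disjnt (set p) (set q)) P"
    proof (rule pairwiseI)
      fix p q assume "p \<in> P" "q \<in> P" "p \<noteq> q"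
      then obtain r r' where r: "r \<in> R" "r' \<in> R" "p = awalk_to_apath r" "q = awalk_to_apath r'" "r \<noteq> r'"
        unfolding P_def by blast
      then show "disjnt (set p) (set q)"
        using R_disjoint[OF r(1,2,5)] P_sub[OF r(1)] P_sub[OF r(2)] unfolding disjnt_def by blast
    qed
  qed
  moreover have "indep (direct_sum (verts D) M) (path_arcs P)"
  proof (rule indep_direct_sum_if_free)
    show "path_arcs P \<subseteq> arcs D" using arcs_P R_arcs by blast
    have "free_in ?cl (edges R)"
    proof (rule free_local)
      fix v
      show "free_in ?cl {g \<in> edges R. head D g = v}"
      proof (cases "v \<in> Y")
        case True
        then have "{g \<in> edges R. head D g = v} \<subseteq> edges Q" using edge_R last_Q by blast
        then show ?thesis by (rule free_subset[OF Q(4)])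
      next
        case False
        have "{g \<in> edges R. head D g = v} \<subseteq> edges W"
          using edge_R webD(3)[OF webY] False unfolding edges_in_def by blast
        then show ?thesis by (rule free_subset[OF wave_free[OF W]])
      qed
    qed
    then show "free_in ?cl (path_arcs P)" using arcs_P by (rule free_subset)
  qed
  moreover have "Y \<subseteq> verts D - {s}" using YX unfolding X0_def .
  moreover have "path_arcs P \<inter> out_cut D Y = {}"
  proof -
    have "e \<notin> out_cut D Y" if "e \<in> edges R" for e
      using edge_R[OF that] linkage_edges(2)[OF web l YX, of e] last_in_edges[OF l]
      unfolding out_cut_def edges_in_def by blast
    then show ?thesis using arcs_P by blast
  qed
  moreover have "in_cut D Y \<subseteq> matroid_span (direct_sum (verts D) M) (path_arcs P \<inter> in_cut D Y)"
  proof
    have "b \<in> path_arcs P \<inter> in_cut D Y" if b: "b \<in> last ` W" for b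
    proof -
      obtain w where w: "w \<in> W" "b = last w" using b by blast
      obtain p where p: "p \<in> Q" "b = hd p" using Q(3) b by blast
      have r: "w @ tl p \<in> R" using w p unfolding R_def by auto
      let ?a = "awalk_to_apath (w @ tl p)"
      have "walk (tail D) (head D) s ?a t"
        using P_apath[OF r] unfolding apath_def awalk_def walk_eq_cas by blast
      \<comment> \<open>Shortening a walk may drop edges, but a path from \<open>s\<close> to
        \<open>t\<close> has to enter \<open>Y\<close>, and the only edge of the walk that does so
        is \<open>b\<close>.\<close>
      then obtain e where e: "e \<in> set ?a" "tail D e \<notin> Y" "head D e \<in> Y"
        using walk_enters[of "tail D" "head D" s ?a t Y] tY YX unfolding X0_def by blast
      have "e \<notin> set (tl p)" using e(2) Q_path(3)[OF p(1)] unfolding edges_in_def by blast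
      then have "e \<in> set w" using e(1) P_sub[OF r] by auto
      then have "e = b" using linkage_last[OF l w(1) _ e(3)] w(2) by blast
      then have "b \<in> path_arcs P" using e(1) r unfolding path_arcs_def P_def by blast
      moreover have "b \<in> arcs D" using webD(2)[OF webY] b by blast
      ultimately show ?thesis using e(2,3) \<open>e = b\<close> unfolding in_cut_def by auto
    qed
    then have sub: "last ` W \<subseteq> path_arcs P \<inter> in_cut D Y" by blast
    fix e assume e: "e \<in> in_cut D Y"
    then have eA: "e \<in> arcs D" and eY: "tail D e \<in> verts D - Y" "head D e \<in> Y" unfolding in_cut_def by auto
    have "e \<in> ?cl (last ` W)"
    \<comment> \<open>Edges from \<open>s\<close> are spanned by \<open>B\<close>, whose members
      with head in \<open>Y\<close> are one-edge wave paths; all other edges of the cut are inner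
      edges.\<close>
    proof (cases "tail D e = s")
      case True
      have "head D e \<noteq> s" using eY(2) YX unfolding X0_def by blast
      then have "e \<in> ?cl B" using B(3) eA True unfolding S0_def by blast
      then show ?thesis
      proof (rule local_mono)
        fix g assume "g \<in> B" "head D g = head D e"
        then have "[g] \<in> W" using wave_start[OF W, of g] eY(2) by simp
        then show "g \<in> last ` W" by force
      qed
    next
      case False
      then have "e \<in> inner X0 Y" using eA eY YX unfolding inner_def X0_def by blast
      then have "e \<in> ?cl (edges W)" using wave_spans[OF W] eY(2) by blast
      then show ?thesis by (rule local_mono) (use linkage_cut[OF l] eY(2) in auto)
    qed
    then show "e \<in> matroid_span (direct_sum (verts D) M) (path_arcs P \<inter> in_cut D Y)"
      using arc_closure_subset_matroid_span[OF eA _ sub] by blast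
  qed
  ultimately show ?thesis using tY by blast
qed

end

theorem theorem5:
  fixes D :: "('a, 'b) pre_digraph"
    and s t :: 'a
    and M :: "'a \<Rightarrow> 'b indep_system"
  assumes "wf_digraph D"
    and "countable (verts D)" and "countable (arcs D)"
    and "s \<in> verts D" and "t \<in> verts D" and "s \<noteq> t"
    and "\<And>v. v \<in> verts D \<Longrightarrow> matroid (M v)"
    and "\<And>v. v \<in> verts D \<Longrightarrow> finitary (M v)"
    and "\<And>v. v \<in> verts D \<Longrightarrow> ground (M v) = in_arcs D v"
  shows "\<exists>P X. path_system D s t P
    \<and> indep (direct_sum (verts D) M) (path_arcs P)
    \<and> t \<in> X \<and> X \<subseteq> verts D - {s}
    \<and> path_arcs P \<inter> out_cut D X = {}
    \<and> in_cut D X \<subseteq> matroid_span (direct_sum (verts D) M) (path_arcs P \<inter> in_cut D X)"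
proof -
  have "matroidal_digraph D M"
    using assms(1,7,8,9) by (simp add: matroidal_digraph_def matroidal_digraph_axioms_def)
  then show ?thesis by (rule matroidal_digraph.matroidal_menger[OF _ assms(3-6)])
qed

end
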